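(* Let $\Phi$ be an irreducible root system of rank at least $2$ and let $R$ be a Dedekind domain with finite class number and infinitely many maximal ideals such that $G(\Phi,R)$ is boundedly generated by root elements. Further assume that $2$ is a unit in $R$ if $\Phi=B_2$ or $\Phi=G_2$. Then $\Delta_k(G(\Phi,R))\geq k$ for all $k\in\mathbb{N}$.
   Context: Chevalley groups. For an irreducible (reduced, crystallographic) root system $\Phi$ and a commutative ring $R$ with $1$, $G(\Phi,R)$ is the group of $R$-points of the simply connected split Chevalley–Demazure group scheme of type $\Phi$ over $\mathbb{Z}$ (e.g. $G(A_{n-1},R)=\mathrm{SL}_n(R)$, $G(B_2,R)=\mathrm{Sp}_4(R)$, $G(G_2,R)=G_2(R)$). A Chevalley basis $\{X_\phi\}_{\phi\in\Phi}\cup\{H_\phi\}$ of the corresponding Lie algebra is fixed. For $\phi\in\Phi$, $\varepsilon_\phi:(R,+)\to G(\Phi,R)$ is the associated root homomorphism (coming from $Z\mapsto\sum_{k\ge 0}(Z\,X_\phi)^k/k!$); the elements $\varepsilon_\phi(x)$, $x\in R$, are called root elements. $G(\Phi,R)$ is boundedly generated by root elements if there are $N\in\mathbb{N}$ and roots $\alpha_1,\dots,\alpha_N\in\Phi$ such that every $A\in G(\Phi,R)$ can be written as $A=\prod_{i=1}^N\varepsilon_{\alpha_i}(a_i)$ with $a_1,\dots,a_N\in R$ (depending on $A$). Norms. Let $G$ be a group. For $S\subset G$, $\langle\langle S\rangle\rangle$ is the smallest normal subgroup of $G$ containing $S$; $S$ is normally generating if $\langle\langle S\rangle\rangle=G$.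 For $A\in\langle\langle S\rangle\rangle$, $\|A\|_S$ is the smallest number $k\in\mathbb{N}_0$ such that $A$ is a product of $k$ elements each conjugate in $G$ to an element of $S\cup S^{-1}$ (with $\|1\|_S=0$); $\|A\|_S=+\infty$ for $A\notin\langle\langle S\rangle\rangle$. $\mathrm{diam}(\|\cdot\|_S)$ is the smallest $N\in\mathbb{N}$ with $\|A\|_S\le N$ for all $A\in G$, or $\infty$ if there is none. For $k\in\mathbb{N}$, $$\Delta_k(G):=\sup\{\mathrm{diam}(\|\cdot\|_S)\mid S\subset G,\ |S|\le k,\ \langle\langle S\rangle\rangle=G\}\in\mathbb{N}_0\cup\{\infty\},$$ with $\Delta_k(G):=-\infty$ if there is no normally generating $S\subset G$ with $|S|\le k$. *)

theory Defs
  imports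
    "HOL-Analysis.Analysis"
    "HOL-Library.Poly_Mapping"
    "HOL-Computational_Algebra.Polynomial_Factorial"
    "HOL-Algebra.Generated_Groups"
    "HOL-Algebra.Ring_Divisibility"
    "HOL-Algebra.Algebraic_Closure_Type"
begin

section \<open>Root systems\<close>

text \<open>The Cartan integer \<open>\<langle>\<beta>, \<alpha>\<^sup>\<or>\<rangle>\<close>.\<close>

definition cartan :: "'v::euclidean_space \<Rightarrow> 'v \<Rightarrow> real" where
  "cartan \<beta> \<alpha> = 2 * (\<beta> \<bullet> \<alpha>) / (\<alpha> \<bullet> \<alpha>)"

text \<open>Reduced crystallographic root systems. They span the ambient space, so the rank is \<open>DIM('v)\<close>.\<close>

definition root_system :: "'v::euclidean_space set \<Rightarrow> bool" where
  "root_system \<Phi> \<longleftrightarrow>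
     finite \<Phi> \<and> 0 \<notin> \<Phi> \<and> span \<Phi> = UNIV \<and>
     (\<forall>\<alpha>\<in>\<Phi>. \<forall>\<beta>\<in>\<Phi>. \<beta> - cartan \<beta> \<alpha> *\<^sub>R \<alpha> \<in> \<Phi>) \<and>
     (\<forall>\<alpha>\<in>\<Phi>. \<forall>\<beta>\<in>\<Phi>. cartan \<beta> \<alpha> \<in> \<int>) \<and>
     (\<forall>\<alpha>\<in>\<Phi>. \<forall>c. c *\<^sub>R \<alpha> \<in> \<Phi> \<longrightarrow> c = 1 \<or> c = -1)"

definition irreducible_root_system :: "'v::euclidean_space set \<Rightarrow> bool" where
  "irreducible_root_system \<Phi> \<longleftrightarrow>
     root_system \<Phi> \<and> \<Phi> \<noteq> {} \<and>
     \<not> (\<exists>\<Phi>1 \<Phi>2. \<Phi>1 \<noteq> {} \<and> \<Phi>2 \<noteq> {} \<and> \<Phi>1 \<union> \<Phi>2 = \<Phi> \<and> \<Phi>1 \<inter> \<Phi>2 = {} \<and>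
          (\<forall>\<alpha>\<in>\<Phi>1. \<forall>\<beta>\<in>\<Phi>2. \<alpha> \<bullet> \<beta> = 0))"

definition root_base :: "'v::euclidean_space set \<Rightarrow> 'v set \<Rightarrow> bool" where
  "root_base \<Phi> \<Delta> \<longleftrightarrow>
     \<Delta> \<subseteq> \<Phi> \<and> independent \<Delta> \<and>
     (\<forall>\<phi>\<in>\<Phi>. \<exists>c :: 'v \<Rightarrow> nat.
        \<phi> = (\<Sum>\<delta>\<in>\<Delta>. real (c \<delta>) *\<^sub>R \<delta>) \<or> \<phi> = - (\<Sum>\<delta>\<in>\<Delta>. real (c \<delta>) *\<^sub>R \<delta>))"

text \<open>The types \<open>B\<^sub>2\<close> and \<open>G\<^sub>2\<close>, read off from the Cartan matrix.\<close>

definition type_B2 :: "'v::euclidean_space set \<Rightarrow> bool" where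
  "type_B2 \<Phi> \<longleftrightarrow> (\<exists>\<alpha> \<beta>. \<alpha> \<noteq> \<beta> \<and> root_base \<Phi> {\<alpha>, \<beta>} \<and> cartan \<alpha> \<beta> = -2 \<and> cartan \<beta> \<alpha> = -1)"

definition type_G2 :: "'v::euclidean_space set \<Rightarrow> bool" where
  "type_G2 \<Phi> \<longleftrightarrow> (\<exists>\<alpha> \<beta>. \<alpha> \<noteq> \<beta> \<and> root_base \<Phi> {\<alpha>, \<beta>} \<and> cartan \<alpha> \<beta> = -3 \<and> cartan \<beta> \<alpha> = -1)"

definition weight_lattice :: "'v::euclidean_space set \<Rightarrow> 'v set" where
  "weight_lattice \<Phi> = {\<mu>. \<forall>\<phi>\<in>\<Phi>. cartan \<mu> \<phi> \<in> \<int>}"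


section \<open>Chevalley bases and admissible lattices\<close>

definition smult_mat :: "'a::times \<Rightarrow> 'a^'n^'m \<Rightarrow> 'a^'n^'m" where
  "smult_mat c A = (\<chi> i j. c * A $ i $ j)"

definition mat_bracket :: "'a::ring_1^'n^'n \<Rightarrow> 'a^'n^'n \<Rightarrow> 'a^'n^'n" where
  "mat_bracket A B = A ** B - B ** A"

definition mat_power :: "'a::semiring_1^'n^'n \<Rightarrow> nat \<Rightarrow> 'a^'n^'n" where
  "mat_power A k = ((\<lambda>B. A ** B) ^^ k) (mat 1)"

text \<open>The largest \<open>p\<close> such that \<open>\<beta> - p\<alpha>\<close> is a root.\<close>

definition root_string :: "'v::euclidean_space set \<Rightarrow> 'v \<Rightarrow> 'v \<Rightarrow> nat" where
  "root_string \<Phi> \<alpha> \<beta> = Max {p. \<beta> - real p *\<^sub>R \<alpha> \<in> \<Phi>}"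

text \<open>
  The complex Lie algebra of type \<open>\<Phi>\<close> is taken as a Lie algebra of matrices. The family
  consisting of \<open>E \<phi>\<close> for \<open>\<phi> \<in> \<Phi>\<close> and \<open>H \<delta>\<close> for \<open>\<delta>\<close> in the base \<open>\<Delta>\<close> is a Chevalley basis of
  its linear span. For arbitrary roots \<open>\<phi>\<close>, the matrix \<open>H \<phi>\<close> is the element of the Cartan
  subalgebra that corresponds to the coroot of \<open>\<phi>\<close>.
\<close>

definition chevalley_basis ::
  "'v::euclidean_space set \<Rightarrow> 'v set \<Rightarrow> ('v \<Rightarrow> complex^'n^'n) \<Rightarrow> ('v \<Rightarrow> complex^'n^'n) \<Rightarrow> bool" where
  "chevalley_basis \<Phi> \<Delta> E H \<longleftrightarrow>
     root_base \<Phi> \<Delta> \<and>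
     (\<forall>a b. (\<Sum>\<phi>\<in>\<Phi>. smult_mat (a \<phi>) (E \<phi>)) + (\<Sum>\<delta>\<in>\<Delta>. smult_mat (b \<delta>) (H \<delta>)) = 0 \<longrightarrow>
        (\<forall>\<phi>\<in>\<Phi>. a \<phi> = 0) \<and> (\<forall>\<delta>\<in>\<Delta>. b \<delta> = 0)) \<and>
     (\<forall>\<phi>\<in>\<Phi>. \<exists>c :: 'v \<Rightarrow> int. H \<phi> = (\<Sum>\<delta>\<in>\<Delta>. smult_mat (of_int (c \<delta>)) (H \<delta>))) \<and>
     (\<forall>\<alpha>\<in>\<Phi>. \<forall>\<beta>\<in>\<Phi>. mat_bracket (H \<alpha>) (H \<beta>) = 0) \<and>
     (\<forall>\<alpha>\<in>\<Phi>. \<forall>\<beta>\<in>\<Phi>. mat_bracket (H \<alpha>) (E \<beta>) = smult_mat (of_real (cartan \<beta> \<alpha>)) (E \<beta>)) \<and>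
     (\<forall>\<alpha>\<in>\<Phi>. mat_bracket (E \<alpha>) (E (- \<alpha>)) = H \<alpha>) \<and>
     (\<forall>\<alpha>\<in>\<Phi>. \<forall>\<beta>\<in>\<Phi>. \<alpha> + \<beta> \<noteq> 0 \<and> \<alpha> + \<beta> \<notin> \<Phi> \<longrightarrow> mat_bracket (E \<alpha>) (E \<beta>) = 0) \<and>
     (\<forall>\<alpha>\<in>\<Phi>. \<forall>\<beta>\<in>\<Phi>. \<alpha> + \<beta> \<in> \<Phi> \<longrightarrow>
        mat_bracket (E \<alpha>) (E \<beta>) = smult_mat (of_nat (root_string \<Phi> \<alpha> \<beta> + 1)) (E (\<alpha> + \<beta>)) \<or>
        mat_bracket (E \<alpha>) (E \<beta>) = smult_mat (- of_nat (root_string \<Phi> \<alpha> \<beta> + 1)) (E (\<alpha> + \<beta>)))"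

text \<open>\<open>\<mu>\<close> is a weight if some nonzero vector is multiplied by \<open>\<langle>\<mu>, \<phi>\<^sup>\<or>\<rangle>\<close> by every \<open>H \<phi>\<close>.\<close>

definition weights :: "'v::euclidean_space set \<Rightarrow> ('v \<Rightarrow> complex^'n^'n) \<Rightarrow> 'v set" where
  "weights \<Phi> H =
     {\<mu>. \<exists>v. v \<noteq> 0 \<and> (\<forall>\<phi>\<in>\<Phi>. H \<phi> *v v = complex_of_real (cartan \<mu> \<phi>) *s v)}"

text \<open>
  The data from which the simply connected Chevalley-Demazure group scheme is built: a
  representation of the complex Lie algebra of type \<open>\<Phi>\<close> together with a lattice that is
  stable under all divided powers \<open>E \<phi> ^ k / k!\<close>. The integer matrices \<open>E \<phi>\<close>, \<open>H \<phi>\<close> describe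
  the action of the Chevalley basis with respect to a \<open>\<int>\<close>-basis of the lattice. Simple
  connectedness is the condition that the weights generate the whole weight lattice; in
  particular, the representation is faithful.
\<close>

definition simply_connected_realization ::
  "'v::euclidean_space set \<Rightarrow> 'v set \<Rightarrow> ('v \<Rightarrow> int^'n^'n) \<Rightarrow> ('v \<Rightarrow> int^'n^'n) \<Rightarrow> bool" where
  "simply_connected_realization \<Phi> \<Delta> E H \<longleftrightarrow>
     chevalley_basis \<Phi> \<Delta> (\<lambda>\<phi>. map_matrix of_int (E \<phi>)) (\<lambda>\<phi>. map_matrix of_int (H \<phi>)) \<and>
     (\<forall>\<phi>\<in>\<Phi>. \<forall>k i j. fact k dvd mat_power (E \<phi>) k $ i $ j) \<and>
     Modules.module.span (\<lambda>(m::int) v. of_int m *\<^sub>R v)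
       (weights \<Phi> (\<lambda>\<phi>. map_matrix of_int (H \<phi>))) = weight_lattice \<Phi>"


section \<open>Chevalley groups\<close>

text \<open>
  \<open>\<epsilon>\<^sub>\<phi>(x) = \<Sum>\<^sub>k x\<^sup>k (E\<^sub>\<phi>\<^sup>k / k!)\<close>. The division by \<open>k!\<close> is exact on admissible lattices, and since
  \<open>E\<^sub>\<phi>\<close> is nilpotent, all terms with \<open>k \<ge> CARD('n)\<close> vanish.
\<close>

definition root_elt :: "('v \<Rightarrow> int^'n^'n) \<Rightarrow> 'v \<Rightarrow> 'r::comm_ring_1 \<Rightarrow> 'r^'n^'n" where
  "root_elt E \<phi> x =
     (\<chi> i j. \<Sum>k<CARD('n). x ^ k * of_int (mat_power (E \<phi>) k $ i $ j div fact k))"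

definition GL :: "('r::comm_ring_1^'n^'n) monoid" where
  "GL = units_of \<lparr>carrier = UNIV, monoid.mult = (**), one = mat 1\<rparr>"

text \<open>Evaluation at a matrix of an integer polynomial in the matrix entries.\<close>

definition eval_mat_poly ::
  "((('n::finite \<times> 'n) \<Rightarrow>\<^sub>0 nat) \<Rightarrow>\<^sub>0 int) \<Rightarrow> 'r::comm_ring_1^'n^'n \<Rightarrow> 'r" where
  "eval_mat_poly p A =
     (\<Sum>m\<in>Poly_Mapping.keys p. of_int (Poly_Mapping.lookup p m) *
        (\<Prod>(i, j)\<in>Poly_Mapping.keys m. (A $ i $ j) ^ Poly_Mapping.lookup m (i, j)))"

definition complex_chevalley_group ::
  "'v set \<Rightarrow> ('v \<Rightarrow> int^'n^'n) \<Rightarrow> (complex^'n^'n) set" where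
  "complex_chevalley_group \<Phi> E = generate GL {root_elt E \<phi> z | \<phi> z. \<phi> \<in> \<Phi>}"

text \<open>
  The coordinate ring of the group scheme is generated over \<open>\<int>\<close> by the matrix coefficients of
  the complex group with respect to the lattice basis, that is, it is the quotient of the
  polynomial ring over \<open>\<int>\<close> in the matrix entries by the ideal of polynomials vanishing on
  the complex group. Its points over \<open>R\<close>, the ring homomorphisms into \<open>R\<close>, are the matrices
  over \<open>R\<close> annihilated by that ideal.
\<close>

definition chevalley_group ::
  "'v set \<Rightarrow> ('v \<Rightarrow> int^'n^'n) \<Rightarrow> ('r::comm_ring_1^'n^'n) monoid" where
  "chevalley_group \<Phi> E =
     GL \<lparr>carrier := {A \<in> carrier GL. \<forall>p. (\<forall>B\<in>complex_chevalley_group \<Phi> E. eval_mat_poly p B = 0)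
                        \<longrightarrow> eval_mat_poly p A = 0}\<rparr>"

definition boundedly_generated_by_root_elts ::
  "'r::comm_ring_1 itself \<Rightarrow> 'v set \<Rightarrow> ('v \<Rightarrow> int^'n^'n) \<Rightarrow> bool" where
  "boundedly_generated_by_root_elts _ \<Phi> E \<longleftrightarrow>
     (\<exists>\<alpha>s. set \<alpha>s \<subseteq> \<Phi> \<and>
        (\<forall>A \<in> carrier (chevalley_group \<Phi> E :: ('r^'n^'n) monoid).
           \<exists>as. length as = length \<alpha>s \<and> A = foldr (**) (map2 (root_elt E) \<alpha>s as) (mat 1)))"


section \<open>Dedekind domains\<close>

definition integrally_closed :: "'r::idom itself \<Rightarrow> bool" where
  "integrally_closed _ \<longleftrightarrow>
     (\<forall>x :: 'r fract. (\<exists>p :: 'r poly. Polynomial.lead_coeff p = 1 \<and> poly (map_poly to_fract p) x = 0)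
        \<longrightarrow> x \<in> range to_fract)"

text \<open>Fields are allowed here.\<close>

definition dedekind_domain :: "'r::idom itself \<Rightarrow> bool" where
  "dedekind_domain T \<longleftrightarrow>
     noetherian_ring (ring_of_type_algebra :: 'r ring) \<and>
     integrally_closed T \<and>
     (\<forall>P :: 'r set. primeideal P ring_of_type_algebra \<and> P \<noteq> {0}
        \<longrightarrow> maximalideal P ring_of_type_algebra)"

text \<open>
  Ideal classes of nonzero integral ideals: \<open>I\<close> and \<open>J\<close> are equivalent if \<open>aI = bJ\<close> for
  some nonzero \<open>a\<close>, \<open>b\<close>.
\<close>

definition finite_class_number :: "'r::idom itself \<Rightarrow> bool" where
  "finite_class_number _ \<longleftrightarrow>
     (let \<I> = {I :: 'r set. ideal I ring_of_type_algebra \<and> I \<noteq> {0}}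
      in finite (\<I> // {(I, J). I \<in> \<I> \<and> J \<in> \<I> \<and>
           (\<exists>a b. a \<noteq> 0 \<and> b \<noteq> 0 \<and> (\<lambda>x. a * x) ` I = (\<lambda>x. b * x) ` J)}))"


section \<open>Word norms of normally generating sets\<close>

definition normal_closure :: "('g, 'm) monoid_scheme \<Rightarrow> 'g set \<Rightarrow> 'g set" where
  "normal_closure G S = \<Inter>{N. N \<lhd> G \<and> S \<subseteq> N}"

definition conjugates_pm :: "('g, 'm) monoid_scheme \<Rightarrow> 'g set \<Rightarrow> 'g set" where
  "conjugates_pm G S =
     {g \<otimes>\<^bsub>G\<^esub> s \<otimes>\<^bsub>G\<^esub> inv\<^bsub>G\<^esub> g | g s. g \<in> carrier G \<and> s \<in> S \<union> (\<lambda>t. inv\<^bsub>G\<^esub> t) ` S}"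

definition word_norm :: "('g, 'm) monoid_scheme \<Rightarrow> 'g set \<Rightarrow> 'g \<Rightarrow> enat" where
  "word_norm G S A =
     (if A \<in> normal_closure G S
      then enat (LEAST k. \<exists>ys. length ys = k \<and> set ys \<subseteq> conjugates_pm G S \<and>
                            A = foldr (\<lambda>x y. x \<otimes>\<^bsub>G\<^esub> y) ys \<one>\<^bsub>G\<^esub>)
      else \<infinity>)"

text \<open>The infimum of the empty set is \<open>\<infinity>\<close>.\<close>

definition norm_diam :: "('g, 'm) monoid_scheme \<Rightarrow> 'g set \<Rightarrow> enat" where
  "norm_diam G S = Inf {enat N | N. \<forall>A\<in>carrier G. word_norm G S A \<le> enat N}"

text \<open>The supremum of the empty set in \<open>ereal\<close> is \<open>-\<infinity>\<close>.\<close>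

definition Delta :: "nat \<Rightarrow> ('g, 'm) monoid_scheme \<Rightarrow> ereal" where
  "Delta k G =
     Sup {ereal_of_enat (norm_diam G S) | S.
            S \<subseteq> carrier G \<and> finite S \<and> card S \<le> k \<and> normal_closure G S = carrier G}"

end

theory Submission
  imports Defs
begin

text \<open>
  Choose \<open>k\<close> distinct maximal ideals \<open>P\<^sub>1, \<dots>, P\<^sub>k\<close> of \<open>R\<close> and, by the Chinese remainder theorem,
  elements \<open>r\<^sub>1, \<dots>, r\<^sub>k\<close> with sum \<open>1\<close> such that \<open>r\<^sub>i\<close> lies in all \<open>P\<^sub>j\<close> with \<open>j \<noteq> i\<close>. For a suitable root
  \<open>\<alpha>\<close>, let \<open>S\<close> consist of the root elements \<open>\<epsilon>\<^sub>\<alpha>(r\<^sub>i)\<close>. A conjugate of \<open>\<epsilon>\<^sub>\<alpha>(r\<^sub>i)\<close> or of its inverse is trivial modulo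
  every \<open>P\<^sub>j\<close> except possibly \<open>P\<^sub>i\<close>. So a product of fewer than \<open>k\<close> conjugates is trivial modulo at least one of
  the ideals, whereas a root element \<open>\<epsilon>\<^sub>\<beta>(1)\<close> is trivial modulo none of them and has norm at least \<open>k\<close>
  (\<open>Delta_ge_of_maximal_ideals\<close>). Two points need work.

  Firstly, \<open>S\<close> normally generates the group (\<open>exists_generating_root\<close>). If \<open>\<alpha>\<close> belongs to a pair \<open>\<alpha>, \<beta>\<close> of
  type \<open>A\<^sub>2\<close>, the commutators of \<open>\<epsilon>\<^sub>\<alpha>(r\<^sub>i)\<close> with \<open>\<epsilon>\<^sub>\<beta>(x)\<close> are the elements \<open>\<epsilon>\<^sub>\<alpha>\<^sub>+\<^sub>\<beta>(\<plusminus>r\<^sub>ix)\<close>, and the sum over \<open>i\<close> gives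
  \<open>\<epsilon>\<^sub>\<alpha>\<^sub>+\<^sub>\<beta>(x)\<close> for all \<open>x\<close>. Representatives of reflections carry this to the other roots of the same length,
  and the commutator formula of type \<open>B\<^sub>2\<close> to the other length. An irreducible system of rank at least \<open>2\<close>
  without such a pair is of type \<open>B\<^sub>2\<close>, where commutators of short root elements give \<open>\<epsilon>(\<plusminus>2r\<^sub>ix)\<close>; in type \<open>G\<^sub>2\<close>
  the long roots contain such a pair, but only \<open>\<epsilon>(\<plusminus>2xy)\<close> is obtained for short roots. In these two types
  the element \<open>2\<close> has to be a unit.

  Secondly, \<open>\<epsilon>\<^sub>\<beta>(1)\<close> is nontrivial modulo every proper ideal (\<open>root_elt_one_not_congruent\<close>), for which an integer
  divisibility argument on the matrices \<open>E \<phi>\<close> suffices.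

  The relations between root elements hold over every commutative ring, because they hold over polynomial
  rings over the integers. There, both sides of each relation solve the same linear differential
  equation (\<open>linear_ode_unique\<close>), which replaces computations with exponential series. That the points of
  the group scheme form a group is a consequence of bounded generation: they coincide with the products of
  root elements (\<open>carrier_eq_elementary\<close>).
\<close>

section \<open>Geometry of irreducible root systems\<close>

lemma cartan_linear [simp]:
  "cartan (x + y) \<alpha> = cartan x \<alpha> + cartan y \<alpha>" "cartan (x - y) \<alpha> = cartan x \<alpha> - cartan y \<alpha>"
  "cartan (- x) \<alpha> = - cartan x \<alpha>" "cartan (c *\<^sub>R x) \<alpha> = c * cartan x \<alpha>" "cartan x (- \<alpha>) = - cartan x \<alpha>"
  by (simp_all add: cartan_def inner_left_distrib inner_diff_left diff_divide_distrib add_divide_distrib algebra_simps)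

locale root_system_facts =
  fixes \<Phi> :: "'v::euclidean_space set"
  assumes root_sys: "root_system \<Phi>"
begin

lemma root_nonzero: "\<alpha> \<in> \<Phi> \<Longrightarrow> \<alpha> \<noteq> 0"
  using root_sys by (auto simp: root_system_def)

lemma root_norm_pos: "\<alpha> \<in> \<Phi> \<Longrightarrow> \<alpha> \<bullet> \<alpha> > 0"
  using root_nonzero by simp

lemma cartan_root_self: "\<alpha> \<in> \<Phi> \<Longrightarrow> cartan \<alpha> \<alpha> = 2"
  using root_nonzero by (simp add: cartan_def)

lemma reflect_root: "\<alpha> \<in> \<Phi> \<Longrightarrow> \<beta> \<in> \<Phi> \<Longrightarrow> \<beta> - cartan \<beta> \<alpha> *\<^sub>R \<alpha> \<in> \<Phi>"
  using root_sys unfolding root_system_def by blast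

lemma cartan_integer: "\<alpha> \<in> \<Phi> \<Longrightarrow> \<beta> \<in> \<Phi> \<Longrightarrow> \<exists>c::int. cartan \<beta> \<alpha> = of_int c"
  using root_sys unfolding root_system_def Ints_def by blast

lemma root_multiple: "\<alpha> \<in> \<Phi> \<Longrightarrow> c *\<^sub>R \<alpha> \<in> \<Phi> \<Longrightarrow> c = 1 \<or> c = -1"
  using root_sys unfolding root_system_def by blast

lemma minus_root: "\<alpha> \<in> \<Phi> \<Longrightarrow> - \<alpha> \<in> \<Phi>"
  using reflect_root [of \<alpha> \<alpha>] by (simp add: cartan_root_self scaleR_2)

lemma cartan_inner: "\<alpha> \<in> \<Phi> \<Longrightarrow> cartan x \<alpha> * (\<alpha> \<bullet> \<alpha>) = 2 * (x \<bullet> \<alpha>)"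
  using root_nonzero [of \<alpha>] by (simp add: cartan_def)

lemma cartan_eq_0_iff: "\<alpha> \<in> \<Phi> \<Longrightarrow> cartan x \<alpha> = 0 \<longleftrightarrow> x \<bullet> \<alpha> = 0"
  using root_nonzero [of \<alpha>] by (simp add: cartan_def)

lemma cartan_less_0_iff: "\<alpha> \<in> \<Phi> \<Longrightarrow> cartan x \<alpha> < 0 \<longleftrightarrow> x \<bullet> \<alpha> < 0"
  using root_norm_pos [of \<alpha>] by (force simp: cartan_def divide_less_0_iff simp del: inner_gt_zero_iff)

lemma cartan_norms: "\<alpha> \<in> \<Phi> \<Longrightarrow> \<beta> \<in> \<Phi> \<Longrightarrow> cartan \<beta> \<alpha> * (\<alpha> \<bullet> \<alpha>) = cartan \<alpha> \<beta> * (\<beta> \<bullet> \<beta>)"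
  by (simp add: cartan_inner inner_commute)

lemma cartan_product_less_4:
  assumes "\<alpha> \<in> \<Phi>" "\<beta> \<in> \<Phi>" "\<beta> \<noteq> \<alpha>" "\<beta> \<noteq> - \<alpha>"
  shows "cartan \<beta> \<alpha> * cartan \<alpha> \<beta> < 4"
proof -
  let ?a = "\<alpha> \<bullet> \<alpha>" and ?b = "\<beta> \<bullet> \<beta>" and ?t = "\<beta> \<bullet> \<alpha>"
  have pos: "?a > 0" "?b > 0" using assms root_norm_pos by auto
  have "\<beta> \<noteq> c *\<^sub>R \<alpha>" for c
    using root_multiple [of \<alpha> c] assms by auto
  then have "0 < (\<beta> - (?t / ?a) *\<^sub>R \<alpha>) \<bullet> (\<beta> - (?t / ?a) *\<^sub>R \<alpha>)"
    by simp
  also have "\<dots> = ?b - ?t * ?t / ?a"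
    using pos by (simp add: inner_diff_left inner_diff_right inner_commute field_simps)
  finally have "?t * ?t < ?a * ?b"
    using pos by (simp add: field_simps)
  moreover have "(cartan \<beta> \<alpha> * cartan \<alpha> \<beta>) * (?a * ?b) = 4 * (?t * ?t)"
    using pos by (simp add: cartan_def inner_commute)
  ultimately have "(cartan \<beta> \<alpha> * cartan \<alpha> \<beta>) * (?a * ?b) < 4 * (?a * ?b)"
    by linarith
  then show ?thesis
    using pos by (simp add: mult_less_cancel_right)
qed

lemma cartan_pair_cases:
  assumes "\<alpha> \<in> \<Phi>" "\<beta> \<in> \<Phi>" "\<beta> \<noteq> - \<alpha>" "\<beta> \<bullet> \<alpha> < 0"
  shows "(cartan \<beta> \<alpha>, cartan \<alpha> \<beta>) \<in> {(-1,-1), (-1,-2), (-2,-1), (-1,-3), (-3,-1)}"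
proof -
  obtain c d :: int where cd: "cartan \<beta> \<alpha> = of_int c" "cartan \<alpha> \<beta> = of_int d"
    using cartan_integer assms by metis
  have "\<beta> \<noteq> \<alpha>" using assms(4) inner_ge_zero [of \<alpha>] by (auto simp: not_less [symmetric])
  then have "of_int (c * d) < (4::real)"
    using cartan_product_less_4 [of \<alpha> \<beta>] assms cd by simp
  then have "c * d < 4"
    by linarith
  moreover have neg: "c < 0" "d < 0"
    using cartan_less_0_iff [of \<alpha> \<beta>] cartan_less_0_iff [of \<beta> \<alpha>] assms cd by (simp_all add: inner_commute)
  then have "0 \<le> c * (d + 1)" "0 \<le> (c + 1) * d"
    by (simp_all add: mult_nonpos_nonpos)
  ultimately have "-3 \<le> c" "-3 \<le> d"
    by (simp_all add: algebra_simps)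
  then have "c \<in> {-3, -2, -1}" "d \<in> {-3, -2, -1}"
    using neg by auto
  then show ?thesis
    using \<open>c * d < 4\<close> cd by auto
qed

lemma cartan_abs_le_3:
  assumes "\<alpha> \<in> \<Phi>" "\<beta> \<in> \<Phi>"
  shows "\<bar>cartan \<beta> \<alpha>\<bar> \<le> 3"
proof -
  have neg: "\<bar>cartan \<beta> \<alpha>\<bar> \<le> 3" if "\<beta> \<in> \<Phi>" "\<beta> \<bullet> \<alpha> < 0" for \<beta>
  proof (cases "\<beta> = - \<alpha>")
    case True
    then show ?thesis using assms by (simp add: cartan_root_self)
  next
    case False
    then show ?thesis using cartan_pair_cases [OF assms(1) that(1)] that by auto
  qed
  consider "\<beta> \<bullet> \<alpha> < 0" | "\<beta> \<bullet> \<alpha> = 0" | "- \<beta> \<bullet> \<alpha> < 0" by fastforce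
  then show ?thesis
  proof cases
    case 3
    then show ?thesis using neg [of "- \<beta>"] assms minus_root by simp
  next
    case 2
    then show ?thesis using cartan_eq_0_iff [OF assms(1), of \<beta>] by simp
  qed (rule neg [OF assms(2)])
qed

end

locale irreducible_root_system_facts = root_system_facts \<Phi> for \<Phi> :: "'v::euclidean_space set" +
  assumes irreducible: "irreducible_root_system \<Phi>"
begin

text \<open>Irreducibility enters only through this closure principle and the existence of roots.\<close>

lemma irreducible_closed_eq:
  assumes "\<Psi> \<subseteq> \<Phi>" "\<Psi> \<noteq> {}" and step: "\<And>\<psi> \<xi>. \<psi> \<in> \<Psi> \<Longrightarrow> \<xi> \<in> \<Phi> \<Longrightarrow> \<psi> \<bullet> \<xi> \<noteq> 0 \<Longrightarrow> \<xi> \<in> \<Psi>"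
  shows "\<Psi> = \<Phi>"
proof (rule ccontr)
  assume "\<Psi> \<noteq> \<Phi>"
  then have "\<Phi> - \<Psi> \<noteq> {}" "\<Psi> \<union> (\<Phi> - \<Psi>) = \<Phi>" "\<Psi> \<inter> (\<Phi> - \<Psi>) = {}"
    using assms(1) by auto
  moreover have "\<forall>\<alpha>\<in>\<Psi>. \<forall>\<beta>\<in>\<Phi> - \<Psi>. \<alpha> \<bullet> \<beta> = 0"
    using step by blast
  ultimately show False
    using irreducible assms(2) unfolding irreducible_root_system_def by blast
qed

lemma exists_obtuse_pair:
  assumes "DIM('v) \<ge> 2"
  shows "\<exists>\<alpha>\<in>\<Phi>. \<exists>\<beta>\<in>\<Phi>. \<beta> \<noteq> - \<alpha> \<and> \<beta> \<bullet> \<alpha> < 0"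
proof (rule ccontr)
  assume no: "\<not> ?thesis"
  obtain \<alpha> where \<alpha>: "\<alpha> \<in> \<Phi>"
    using irreducible by (auto simp: irreducible_root_system_def)
  have "{\<alpha>, - \<alpha>} = \<Phi>"
  proof (rule irreducible_closed_eq)
    fix \<psi> \<xi> assume *: "\<psi> \<in> {\<alpha>, - \<alpha>}" "\<xi> \<in> \<Phi>" "\<psi> \<bullet> \<xi> \<noteq> 0"
    then have "\<xi> \<bullet> \<alpha> \<noteq> 0"
      by (auto simp: inner_commute)
    then consider "\<xi> \<bullet> \<alpha> < 0" | "\<xi> \<bullet> (- \<alpha>) < 0"
      by fastforce
    then show "\<xi> \<in> {\<alpha>, - \<alpha>}"
      using no \<alpha> *(2) minus_root [OF \<alpha>] by cases fastforce+
  qed (use \<alpha> minus_root in auto)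
  then have "span {\<alpha>, - \<alpha>} = UNIV"
    using root_sys by (simp add: root_system_def)
  then have "span {\<alpha>} = (UNIV :: 'v set)"
    by (metis insert_commute span_base span_neg span_redundant insertI1)
  then have "DIM('v) \<le> card {\<alpha>}"
    using dim_le_card [of "{\<alpha>}" UNIV] by (metis dim_UNIV dim_le_card' dim_span finite.emptyI finite.insertI)
  then show False using assms by simp
qed

text \<open>
  A system in which nonorthogonal roots always differ in length by a factor \<open>2\<close> is planar:
  a root that is not orthogonal to the plane of a short and a long root is not orthogonal to a
  short and to a long root of this plane, and no length fits both.
\<close>

lemma planar_if_all_ratio_2:
  assumes \<alpha>: "\<alpha> \<in> \<Phi>" and \<beta>: "\<beta> \<in> \<Phi>" and c: "cartan \<beta> \<alpha> = -2" "cartan \<alpha> \<beta> = -1"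
    and ratio: "\<And>\<phi> \<psi>. \<phi> \<in> \<Phi> \<Longrightarrow> \<psi> \<in> \<Phi> \<Longrightarrow> \<psi> \<noteq> \<phi> \<Longrightarrow> \<psi> \<noteq> - \<phi> \<Longrightarrow> \<psi> \<bullet> \<phi> \<noteq> 0 \<Longrightarrow>
      \<psi> \<bullet> \<psi> = 2 * (\<phi> \<bullet> \<phi>) \<or> \<phi> \<bullet> \<phi> = 2 * (\<psi> \<bullet> \<psi>)"
  shows "DIM('v) \<le> 2"
proof -
  let ?V = "span {\<alpha>, \<beta>}"
  have ab: "\<alpha> + \<beta> \<in> \<Phi>" and aab: "\<beta> + 2 *\<^sub>R \<alpha> \<in> \<Phi>"
    using reflect_root [OF \<beta> \<alpha>] reflect_root [OF \<alpha> \<beta>] c by simp_all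
  have in_V: "\<alpha> \<in> ?V" "\<beta> \<in> ?V"
    by (auto intro: span_base)
  have ab_V: "\<alpha> + \<beta> \<in> ?V" "\<beta> + 2 *\<^sub>R \<alpha> \<in> ?V"
    by (auto intro: span_add span_scale in_V)
  have bb: "\<beta> \<bullet> \<beta> = 2 * (\<alpha> \<bullet> \<alpha>)"
    using cartan_norms [OF \<alpha> \<beta>] c by simp
  have t: "\<beta> \<bullet> \<alpha> = - (\<alpha> \<bullet> \<alpha>)"
    using cartan_inner [OF \<alpha>, of \<beta>] c by simp
  have norms: "(\<alpha> + \<beta>) \<bullet> (\<alpha> + \<beta>) = \<alpha> \<bullet> \<alpha>" "(\<beta> + 2 *\<^sub>R \<alpha>) \<bullet> (\<beta> + 2 *\<^sub>R \<alpha>) = 2 * (\<alpha> \<bullet> \<alpha>)"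
    using bb t by (simp_all add: inner_add_left inner_add_right inner_commute)
  have "\<Phi> \<inter> ?V = \<Phi>"
  proof (rule irreducible_closed_eq)
    fix \<psi> \<xi> assume \<psi>: "\<psi> \<in> \<Phi> \<inter> ?V" and \<xi>: "\<xi> \<in> \<Phi>" and nonorth: "\<psi> \<bullet> \<xi> \<noteq> 0"
    show "\<xi> \<in> \<Phi> \<inter> ?V"
    proof (rule ccontr)
      assume "\<xi> \<notin> \<Phi> \<inter> ?V"
      then have "\<xi> \<notin> ?V" using \<xi> by simp
      then have ne: "\<xi> \<noteq> \<phi>" "\<xi> \<noteq> - \<phi>" if "\<phi> \<in> ?V" for \<phi>
        using that span_neg by auto
      have "\<exists>\<phi>\<in>{\<alpha>, \<alpha> + \<beta>}. \<xi> \<bullet> \<phi> \<noteq> 0" and "\<exists>\<phi>\<in>{\<beta>, \<beta> + 2 *\<^sub>R \<alpha>}. \<xi> \<bullet> \<phi> \<noteq> 0"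
      proof -
        have "\<not> (\<xi> \<bullet> \<alpha> = 0 \<and> \<xi> \<bullet> \<beta> = 0)"
        proof
          assume "\<xi> \<bullet> \<alpha> = 0 \<and> \<xi> \<bullet> \<beta> = 0"
          then have "orthogonal \<xi> \<psi>"
            using \<psi> by (intro orthogonal_to_span [of \<psi> "{\<alpha>, \<beta>}"]) (auto simp: orthogonal_def)
          then show False using nonorth by (simp add: orthogonal_def inner_commute)
        qed
        then show "\<exists>\<phi>\<in>{\<alpha>, \<alpha> + \<beta>}. \<xi> \<bullet> \<phi> \<noteq> 0" "\<exists>\<phi>\<in>{\<beta>, \<beta> + 2 *\<^sub>R \<alpha>}. \<xi> \<bullet> \<phi> \<noteq> 0"
          by (auto simp: inner_add_right)
      qed
      then obtain \<phi>1 \<phi>2 where "\<phi>1 \<in> {\<alpha>, \<alpha> + \<beta>}" "\<xi> \<bullet> \<phi>1 \<noteq> 0" "\<phi>2 \<in> {\<beta>, \<beta> + 2 *\<^sub>R \<alpha>}" "\<xi> \<bullet> \<phi>2 \<noteq> 0"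
        by blast
      moreover from this have "\<phi>1 \<in> \<Phi>" "\<phi>1 \<in> ?V" "\<phi>1 \<bullet> \<phi>1 = \<alpha> \<bullet> \<alpha>"
          "\<phi>2 \<in> \<Phi>" "\<phi>2 \<in> ?V" "\<phi>2 \<bullet> \<phi>2 = 2 * (\<alpha> \<bullet> \<alpha>)"
        using \<alpha> \<beta> ab aab in_V ab_V norms bb by auto
      ultimately have "\<xi> \<bullet> \<xi> = 2 * (\<alpha> \<bullet> \<alpha>) \<or> \<alpha> \<bullet> \<alpha> = 2 * (\<xi> \<bullet> \<xi>)"
          "\<xi> \<bullet> \<xi> = 2 * (2 * (\<alpha> \<bullet> \<alpha>)) \<or> 2 * (\<alpha> \<bullet> \<alpha>) = 2 * (\<xi> \<bullet> \<xi>)"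
        using ratio [of \<phi>1 \<xi>] ratio [of \<phi>2 \<xi>] \<xi> ne by auto
      then show False
        using root_norm_pos [OF \<alpha>] by auto
    qed
  qed (use \<alpha> in_V in auto)
  then have "span \<Phi> \<subseteq> ?V"
    by (metis inf_le2 span_minimal subspace_span)
  then have "UNIV \<subseteq> ?V"
    using root_sys by (simp add: root_system_def)
  then have "DIM('v) \<le> card {\<alpha>, \<beta>}"
    by (metis dim_UNIV dim_le_card finite.emptyI finite.insertI)
  also have "\<dots> \<le> 2"
    by (simp add: card_insert_if)
  finally show ?thesis .
qed

end

context irreducible_root_system_facts
begin

text \<open>
  A base of two roots determines the type. If its two roots have the same length, every
  reflection of a positive combination must again have coefficients of one sign, which leaves
  only the six roots of \<open>A\<^sub>2\<close>.
\<close>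

lemma base_of_plane:
  assumes base: "root_base \<Phi> \<Delta>" and dim: "DIM('v) = 2"
  shows "type_B2 \<Phi> \<or> type_G2 \<Phi> \<or>
    (\<exists>a b. a \<in> \<Phi> \<and> b \<in> \<Phi> \<and> cartan a b = -1 \<and> cartan b a = -1 \<and> (\<forall>\<phi>\<in>\<Phi>. \<phi> \<bullet> \<phi> = a \<bullet> a))"
proof -
  have \<Delta>: "\<Delta> \<subseteq> \<Phi>" "independent \<Delta>"
    using base by (auto simp: root_base_def)
  then have fin: "finite \<Delta>"
    using independent_imp_finite by blast
  have "\<Phi> \<subseteq> span \<Delta>"
  proof
    fix \<phi> assume "\<phi> \<in> \<Phi>"
    then obtain c :: "'v \<Rightarrow> nat" where "\<phi> = (\<Sum>\<delta>\<in>\<Delta>. real (c \<delta>) *\<^sub>R \<delta>) \<or> \<phi> = - (\<Sum>\<delta>\<in>\<Delta>. real (c \<delta>) *\<^sub>R \<delta>)"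
      using base by (auto simp: root_base_def)
    moreover have "(\<Sum>\<delta>\<in>\<Delta>. real (c \<delta>) *\<^sub>R \<delta>) \<in> span \<Delta>"
      by (intro span_sum span_scale span_base)
    ultimately show "\<phi> \<in> span \<Delta>"
      using span_neg by auto
  qed
  then have "span \<Delta> = UNIV"
    using root_sys span_mono [of \<Phi> "span \<Delta>"] by (auto simp: root_system_def span_span)
  then have "card \<Delta> = 2"
    using \<Delta> dim by (metis dim_eq_card_independent dim_span dim_UNIV)
  then obtain a b where ab: "\<Delta> = {a, b}" "a \<noteq> b"
    by (auto simp: card_2_iff)
  have in_\<Phi>: "a \<in> \<Phi>" "b \<in> \<Phi>" using \<Delta> ab by auto
  have indep: "x = 0 \<and> y = 0" if "x *\<^sub>R a + y *\<^sub>R b = 0" for x y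
  proof -
    have "independent {a, b}" using \<Delta> ab by simp
    moreover have "(\<Sum>v\<in>{a, b}. (if v = a then x else y) *\<^sub>R v) = 0"
      using that ab by simp
    ultimately have "\<forall>v\<in>{a, b}. (if v = a then x else y) = 0"
      using independentD [of "{a, b}" "{a, b}" "\<lambda>v. if v = a then x else y"] by blast
    then show ?thesis using ab by auto
  qed
  have coords: "\<exists>m n :: nat. \<phi> = real m *\<^sub>R a + real n *\<^sub>R b \<or> \<phi> = - (real m *\<^sub>R a + real n *\<^sub>R b)"
    if "\<phi> \<in> \<Phi>" for \<phi>
  proof -
    obtain c :: "'v \<Rightarrow> nat" where "\<phi> = (\<Sum>\<delta>\<in>\<Delta>. real (c \<delta>) *\<^sub>R \<delta>) \<or> \<phi> = - (\<Sum>\<delta>\<in>\<Delta>. real (c \<delta>) *\<^sub>R \<delta>)"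
      using base \<open>\<phi> \<in> \<Phi>\<close> by (auto simp: root_base_def)
    then show ?thesis using ab by auto
  qed
  have same_sign: "0 \<le> x * y" if "x *\<^sub>R a + y *\<^sub>R b \<in> \<Phi>" for x y
  proof -
    obtain m n :: nat where "x *\<^sub>R a + y *\<^sub>R b = real m *\<^sub>R a + real n *\<^sub>R b \<or>
        x *\<^sub>R a + y *\<^sub>R b = - (real m *\<^sub>R a + real n *\<^sub>R b)"
      using coords [OF \<open>x *\<^sub>R a + y *\<^sub>R b \<in> \<Phi>\<close>] by blast
    moreover have "(x - real m) *\<^sub>R a + (y - real n) *\<^sub>R b = (x *\<^sub>R a + y *\<^sub>R b) - (real m *\<^sub>R a + real n *\<^sub>R b)"
      "(x + real m) *\<^sub>R a + (y + real n) *\<^sub>R b = (x *\<^sub>R a + y *\<^sub>R b) + (real m *\<^sub>R a + real n *\<^sub>R b)"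
      by (simp_all add: algebra_simps)
    ultimately have "(x - real m) *\<^sub>R a + (y - real n) *\<^sub>R b = 0 \<or> (x + real m) *\<^sub>R a + (y + real n) *\<^sub>R b = 0"
      by (metis add.left_inverse diff_self)
    then have "x = real m \<and> y = real n \<or> x = - real m \<and> y = - real n"
      using indep by force
    then show ?thesis by auto
  qed
  have ne: "a \<noteq> - b"
    using indep [of 1 1] by auto
  have "\<not> a \<bullet> b > 0"
  proof
    assume "a \<bullet> b > 0"
    then have "cartan a b > 0"
      using in_\<Phi> root_norm_pos [of b] by (simp add: cartan_def)
    moreover have "0 \<le> 1 * (- cartan a b)"
      using reflect_root [OF in_\<Phi>(2,1)] by (intro same_sign) simp
    ultimately show False by simp
  qed
  moreover have "a \<bullet> b \<noteq> 0"
  proof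
    assume orth: "a \<bullet> b = 0"
    have pure: "\<phi> \<in> {a, - a, b, - b}" if "\<phi> \<in> \<Phi>" for \<phi>
    proof -
      obtain x y where xy: "\<phi> = x *\<^sub>R a + y *\<^sub>R b"
        using coords [OF \<open>\<phi> \<in> \<Phi>\<close>] by (metis (no_types) minus_add_distrib scaleR_minus_left)
      have "cartan b a = 0"
        using orth by (simp add: cartan_def inner_commute)
      then have "cartan \<phi> a = 2 * x"
        by (simp add: xy cartan_root_self in_\<Phi>)
      moreover have "\<phi> - (2 * x) *\<^sub>R a = (x - 2 * x) *\<^sub>R a + y *\<^sub>R b"
        unfolding xy scaleR_diff_left by (simp only: diff_add_eq)
      ultimately have "\<phi> - cartan \<phi> a *\<^sub>R a = (- x) *\<^sub>R a + y *\<^sub>R b"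
        by simp
      then have "0 \<le> - x * y" "0 \<le> x * y"
        using same_sign reflect_root [OF in_\<Phi>(1) that] that xy by metis+
      then have "x = 0 \<or> y = 0"
        by (simp add: mult_less_0_iff not_less [symmetric])
      then show ?thesis
        using xy that root_multiple [OF in_\<Phi>(1), of x] root_multiple [OF in_\<Phi>(2), of y] by auto
    qed
    have "{a, - a} = \<Phi>"
    proof (rule irreducible_closed_eq)
      fix \<psi> \<xi> assume "\<psi> \<in> {a, - a}" "\<xi> \<in> \<Phi>" "\<psi> \<bullet> \<xi> \<noteq> 0"
      then show "\<xi> \<in> {a, - a}"
        using pure [of \<xi>] orth by auto
    qed (use in_\<Phi> minus_root in auto)
    then show False
      using in_\<Phi> ab ne by auto
  qed
  ultimately have "a \<bullet> b < 0" by linarith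
  then have "(cartan a b, cartan b a) \<in> {(-1,-1), (-1,-2), (-2,-1), (-1,-3), (-3,-1)}"
    using cartan_pair_cases [of b a] in_\<Phi> ne by blast
  then consider (A) "cartan a b = -1 \<and> cartan b a = -1"
    | (B) "cartan a b = -2 \<and> cartan b a = -1 \<or> cartan b a = -2 \<and> cartan a b = -1"
    | (G) "cartan a b = -3 \<and> cartan b a = -1 \<or> cartan b a = -3 \<and> cartan a b = -1"
    by auto
  then show ?thesis
  proof cases
    case B
    then have "type_B2 \<Phi>"
      unfolding type_B2_def using base ab by (metis insert_commute)
    then show ?thesis by blast
  next
    case G
    then have "type_G2 \<Phi>"
      unfolding type_G2_def using base ab by (metis insert_commute)
    then show ?thesis by blast
  next
    case A
    have bb: "b \<bullet> b = a \<bullet> a"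
      using cartan_norms [OF in_\<Phi>] A by simp
    have t: "a \<bullet> b = - (a \<bullet> a) / 2" "b \<bullet> a = - (a \<bullet> a) / 2"
      using cartan_inner [OF in_\<Phi>(1), of b] A by (simp_all add: inner_commute)
    have s: "a + b \<in> \<Phi>"
      using reflect_root [OF in_\<Phi>] A by (simp add: add.commute)
    have pos: "real m *\<^sub>R a + real n *\<^sub>R b \<in> {a, b, a + b}" if r: "real m *\<^sub>R a + real n *\<^sub>R b \<in> \<Phi>" for m n
    proof -
      let ?\<phi> = "real m *\<^sub>R a + real n *\<^sub>R b"
      have "cartan ?\<phi> a = 2 * real m - real n" "cartan ?\<phi> b = 2 * real n - real m"
        by (simp_all add: A cartan_root_self in_\<Phi>)
      moreover have "?\<phi> - (2 * real m - real n) *\<^sub>R a = (real m - (2 * real m - real n)) *\<^sub>R a + real n *\<^sub>R b"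
        "?\<phi> - (2 * real n - real m) *\<^sub>R b = real m *\<^sub>R a + (real n - (2 * real n - real m)) *\<^sub>R b"
        by (simp_all only: scaleR_diff_left diff_add_eq add_diff_eq)
      ultimately have "?\<phi> - cartan ?\<phi> a *\<^sub>R a = (real n - real m) *\<^sub>R a + real n *\<^sub>R b"
        "?\<phi> - cartan ?\<phi> b *\<^sub>R b = real m *\<^sub>R a + (real m - real n) *\<^sub>R b"
        by simp_all
      then have "0 \<le> (real n - real m) * real n" "0 \<le> real m * (real m - real n)"
        using same_sign reflect_root [OF in_\<Phi>(1) r] reflect_root [OF in_\<Phi>(2) r] by metis+
      then consider "m = 0" | "n = 0" | "m = n"
        by (cases "m = 0 \<or> n = 0") (auto simp: zero_le_mult_iff)
      then show ?thesis
      proof cases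
        case 1
        then show ?thesis using r root_multiple [OF in_\<Phi>(2), of "real n"] by auto
      next
        case 2
        then show ?thesis using r root_multiple [OF in_\<Phi>(1), of "real m"] by auto
      next
        case 3
        then have "?\<phi> = real n *\<^sub>R (a + b)" by (simp add: scaleR_add_right)
        then show ?thesis using r root_multiple [OF s, of "real n"] by auto
      qed
    qed
    have "\<phi> \<bullet> \<phi> = a \<bullet> a" if "\<phi> \<in> \<Phi>" for \<phi>
    proof -
      obtain m n :: nat where "\<phi> = real m *\<^sub>R a + real n *\<^sub>R b \<or> - \<phi> = real m *\<^sub>R a + real n *\<^sub>R b"
        using coords [OF \<open>\<phi> \<in> \<Phi>\<close>] by (metis add.inverse_inverse)
      then have "\<phi> \<in> {a, b, a + b} \<or> - \<phi> \<in> {a, b, a + b}"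
        using pos [of m n] that minus_root [OF that] by metis
      then have "\<phi> \<in> {a, b, a + b, - a, - b, - (a + b)}"
        by (metis add.inverse_inverse insert_iff empty_iff)
      then show ?thesis
        using bb t by (auto simp: inner_add_left inner_add_right inner_diff_left inner_diff_right)
    qed
    then show ?thesis using A in_\<Phi> by blast
  qed
qed

end

text \<open>The coordinates of the roots of \<open>G\<^sub>2\<close> with respect to a short and a long simple root.\<close>

definition G2_coords :: "(int \<times> int) set" where
  "G2_coords = {(1,0), (0,1), (1,1), (2,1), (3,1), (3,2), (-1,0), (0,-1), (-1,-1), (-2,-1), (-3,-1), (-3,-2)}"

locale G2_pair = irreducible_root_system_facts \<Phi> for \<Phi> :: "'v::euclidean_space set" +
  fixes \<alpha> \<beta> :: 'v
  assumes \<alpha>: "\<alpha> \<in> \<Phi>" and \<beta>: "\<beta> \<in> \<Phi>" and cartan_\<beta>\<alpha>: "cartan \<beta> \<alpha> = -3" and cartan_\<alpha>\<beta>: "cartan \<alpha> \<beta> = -1"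
begin

definition root_of :: "int \<Rightarrow> int \<Rightarrow> 'v" where
  "root_of i j = of_int i *\<^sub>R \<alpha> + of_int j *\<^sub>R \<beta>"

lemma norm_\<beta>: "\<beta> \<bullet> \<beta> = 3 * (\<alpha> \<bullet> \<alpha>)"
  using cartan_norms [OF \<alpha> \<beta>] cartan_\<alpha>\<beta> cartan_\<beta>\<alpha> by simp

lemma inner_\<alpha>\<beta>: "\<alpha> \<bullet> \<beta> = - 3 / 2 * (\<alpha> \<bullet> \<alpha>)" "\<beta> \<bullet> \<alpha> = - 3 / 2 * (\<alpha> \<bullet> \<alpha>)"
  using cartan_inner [OF \<alpha>, of \<beta>] cartan_\<beta>\<alpha> by (simp_all add: inner_commute)

lemma cartan_root_of:
  "cartan (root_of i j) \<alpha> = of_int (2 * i - 3 * j)" "cartan (root_of i j) \<beta> = of_int (2 * j - i)"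
  by (simp_all add: root_of_def cartan_\<alpha>\<beta> cartan_\<beta>\<alpha> cartan_root_self \<alpha> \<beta>)

lemma root_of_eq_iff: "root_of i j = root_of i' j' \<longleftrightarrow> i = i' \<and> j = j'"
proof
  assume "root_of i j = root_of i' j'"
  then have "(of_int (2 * i - 3 * j) :: real) = of_int (2 * i' - 3 * j')" "(of_int (2 * j - i) :: real) = of_int (2 * j' - i')"
    by (metis cartan_root_of)+
  then have "2 * i - 3 * j = 2 * i' - 3 * j'" "2 * j - i = 2 * j' - i'"
    unfolding of_int_eq_iff by blast+
  then show "i = i' \<and> j = j'" by linarith
qed simp

lemma root_of_add: "root_of i j + root_of i' j' = root_of (i + i') (j + j')"
  and root_of_minus: "- root_of i j = root_of (- i) (- j)"
  by (simp_all add: root_of_def algebra_simps)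

lemma root_of_simple: "root_of 1 0 = \<alpha>" "root_of 0 1 = \<beta>"
  by (simp_all add: root_of_def)

lemma root_of_in_roots:
  assumes "(i, j) \<in> G2_coords"
  shows "root_of i j \<in> \<Phi>"
proof -
  have r\<alpha>: "root_of (3 * y - x) y \<in> \<Phi>" if "root_of x y \<in> \<Phi>" for x y
  proof -
    have "root_of x y - of_int (2 * x - 3 * y) *\<^sub>R \<alpha> = root_of (3 * y - x) y"
      by (simp add: root_of_def add_diff_eq [symmetric] add.commute flip: scaleR_diff_left)
    then show ?thesis
      using reflect_root [OF \<alpha> that] unfolding cartan_root_of by simp
  qed
  have r\<beta>: "root_of x (x - y) \<in> \<Phi>" if "root_of x y \<in> \<Phi>" for x y
  proof -
    have "root_of x y - of_int (2 * y - x) *\<^sub>R \<beta> = root_of x (x - y)"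
      by (simp add: root_of_def add_diff_eq [symmetric] flip: scaleR_diff_left)
    then show ?thesis
      using reflect_root [OF \<beta> that] unfolding cartan_root_of by simp
  qed
  have 1: "root_of 1 0 \<in> \<Phi>" "root_of 0 1 \<in> \<Phi>" by (simp_all add: root_of_simple \<alpha> \<beta>)
  have 2: "root_of 1 1 \<in> \<Phi>" "root_of 3 1 \<in> \<Phi>" using r\<beta> [OF 1(1)] r\<alpha> [OF 1(2)] by simp_all
  have 3: "root_of 2 1 \<in> \<Phi>" "root_of 3 2 \<in> \<Phi>" using r\<alpha> [OF 2(1)] r\<beta> [OF 2(2)] by simp_all
  have "root_of (- x) (- y) \<in> \<Phi>" if "root_of x y \<in> \<Phi>" for x y
    using minus_root [OF that] by (simp add: root_of_minus)
  from this [OF 1(1)] this [OF 1(2)] this [OF 2(1)] this [OF 2(2)] this [OF 3(1)] this [OF 3(2)] 1 2 3 assms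
  show ?thesis by (auto simp: G2_coords_def)
qed

text \<open>
  Every root \<open>\<gamma>\<close> that is not orthogonal to the plane lies in it: with \<open>m = \<langle>\<gamma>, \<alpha>\<^sup>\<or>\<rangle>\<close> and
  \<open>n = \<langle>\<gamma>, \<beta>\<^sup>\<or>\<rangle>\<close>, the projection of \<open>\<gamma>\<close> to the plane is \<open>(2m + 3n)\<alpha> + (m + 2n)\<beta>\<close> and has squared
  length \<open>m\<^sup>2 + 3mn + 3n\<^sup>2\<close> in units of \<open>\<alpha> \<bullet> \<alpha>\<close>. It cannot be shorter than \<open>\<gamma>\<close>, as the Cartan
  integers \<open>\<langle>\<alpha>, \<gamma>\<^sup>\<or>\<rangle>\<close>, \<open>\<langle>\<beta>, \<gamma>\<^sup>\<or>\<rangle>\<close> bound the length of \<open>\<gamma>\<close> from above.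
\<close>

lemma root_in_plane:
  assumes \<gamma>: "\<gamma> \<in> \<Phi>" and nonorth: "\<gamma> \<bullet> \<alpha> \<noteq> 0 \<or> \<gamma> \<bullet> \<beta> \<noteq> 0"
  shows "\<exists>i j. (i, j) \<in> G2_coords \<and> \<gamma> = root_of i j"
proof -
  obtain m n k l :: int where cart: "cartan \<gamma> \<alpha> = of_int m" "cartan \<gamma> \<beta> = of_int n"
      "cartan \<alpha> \<gamma> = of_int k" "cartan \<beta> \<gamma> = of_int l"
    using cartan_integer \<alpha> \<beta> \<gamma> by metis
  define s g where "s = \<alpha> \<bullet> \<alpha>" and "g = (\<gamma> \<bullet> \<gamma>) / s"
  have s: "s > 0" using root_norm_pos [OF \<alpha>] by (simp add: s_def)
  have g: "g > 0" "\<gamma> \<bullet> \<gamma> = g * s" using root_norm_pos [OF \<gamma>] s by (simp_all add: g_def)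
  have \<gamma>\<alpha>: "\<gamma> \<bullet> \<alpha> = of_int m * s / 2" and \<gamma>\<beta>: "\<gamma> \<bullet> \<beta> = 3 * of_int n * s / 2"
    using cartan_inner [OF \<alpha>, of \<gamma>] cartan_inner [OF \<beta>, of \<gamma>] cart norm_\<beta> by (simp_all add: s_def)
  have "of_int m * s = of_int k * (g * s)" "of_int n * (3 * s) = of_int l * (g * s)"
    using cartan_norms [OF \<alpha> \<gamma>] cartan_norms [OF \<beta> \<gamma>] unfolding norm_\<beta> cart g(2) s_def [symmetric] by blast+
  then have kg: "of_int k * g = of_int m" and lg: "of_int l * g = 3 * of_int n"
    using s by auto
  have mn: "\<bar>m\<bar> \<le> 3" "\<bar>n\<bar> \<le> 3"
    using cartan_abs_le_3 [OF \<alpha> \<gamma>] cartan_abs_le_3 [OF \<beta> \<gamma>] cart by simp_all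
  have nz: "m \<noteq> 0 \<or> n \<noteq> 0"
    using nonorth \<gamma>\<alpha> \<gamma>\<beta> by auto
  define f where "f = m * m + 3 * m * n + 3 * n * n"
  let ?\<delta> = "\<gamma> - root_of (2 * m + 3 * n) (m + 2 * n)"
  have expand: "(\<gamma> - (x *\<^sub>R \<alpha> + y *\<^sub>R \<beta>)) \<bullet> (\<gamma> - (x *\<^sub>R \<alpha> + y *\<^sub>R \<beta>)) =
      \<gamma> \<bullet> \<gamma> - 2 * (x * (\<gamma> \<bullet> \<alpha>) + y * (\<gamma> \<bullet> \<beta>)) + x * x * (\<alpha> \<bullet> \<alpha>) + 2 * x * y * (\<alpha> \<bullet> \<beta>) + y * y * (\<beta> \<bullet> \<beta>)" for x y
    by (simp add: inner_diff_left inner_diff_right inner_add_left inner_add_right inner_commute algebra_simps)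
  have \<delta>: "?\<delta> \<bullet> ?\<delta> = (g - of_int f) * s"
    unfolding root_of_def expand \<gamma>\<alpha> \<gamma>\<beta> g(2) inner_\<alpha>\<beta>(1) norm_\<beta> s_def [symmetric]
    by (simp add: f_def field_simps)
  then have fg: "of_int f \<le> g"
    using s inner_ge_zero [of ?\<delta>] by (simp add: zero_le_mult_iff)
  have gm: "g \<le> \<bar>of_int m\<bar>" if "m \<noteq> 0"
  proof -
    have "k \<noteq> 0" using kg that by auto
    then have "1 \<le> \<bar>real_of_int k\<bar>" by linarith
    then have "g \<le> \<bar>of_int k\<bar> * g" using g by simp
    then show ?thesis using kg g by (metis abs_mult abs_of_pos)
  qed
  have gn: "g \<le> 3 * \<bar>of_int n\<bar>" if "n \<noteq> 0"
  proof -
    have "l \<noteq> 0" using lg that by auto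
    then have "1 \<le> \<bar>real_of_int l\<bar>" by linarith
    then have "g \<le> \<bar>of_int l\<bar> * g" using g by simp
    also have "\<dots> = \<bar>of_int l * g\<bar>" using g by (simp add: abs_mult)
    finally show ?thesis unfolding lg by (simp add: abs_mult)
  qed
  have fm: "f \<le> \<bar>m\<bar>" if "m \<noteq> 0"
    using gm [OF that] fg by linarith
  have fn: "f \<le> 3 * \<bar>n\<bar>" if "n \<noteq> 0"
    using gn [OF that] fg by linarith
  have "m = -3 \<or> m = -2 \<or> m = -1 \<or> m = 0 \<or> m = 1 \<or> m = 2 \<or> m = 3"
    "n = -3 \<or> n = -2 \<or> n = -1 \<or> n = 0 \<or> n = 1 \<or> n = 2 \<or> n = 3"
    using mn by linarith+
  then have "(m, n) \<in> {(0,1), (0,-1), (1,0), (-1,0), (1,-1), (-1,1), (3,-1), (-3,1), (3,-2), (-3,2)} \<or>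
      (m, n) \<in> {(2,-1), (-2,1)}"
    by (elim disjE) (use fm fn nz in \<open>simp_all add: f_def\<close>)
  then have "g = of_int f \<and> (2 * m + 3 * n, m + 2 * n) \<in> G2_coords"
  proof
    assume mn': "(m, n) \<in> {(0,1), (0,-1), (1,0), (-1,0), (1,-1), (-1,1), (3,-1), (-3,1), (3,-2), (-3,2)}"
    then have "g \<le> of_int f"
      using gm gn by (auto simp: f_def)
    then have "g = of_int f"
      using fg by linarith
    moreover have "(2 * m + 3 * n, m + 2 * n) \<in> G2_coords"
      using mn' unfolding insert_iff empty_iff prod.inject by (elim disjE) (simp_all add: G2_coords_def)
    ultimately show ?thesis by blast
  next
    assume mn': "(m, n) \<in> {(2,-1), (-2,1)}"
    then have "f = 1" by (auto simp: f_def)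
    then have "1 \<le> g" using fg by simp
    have "of_int (2 * l) * g = of_int (- 3 * k) * g"
      using kg lg mn' by auto
    then have "2 * l = - 3 * k"
      using g by (simp only: mult_cancel_right of_int_eq_iff) simp
    then have "even k" by presburger
    then obtain k' where k': "k = 2 * k'" by blast
    then have "k' \<noteq> 0" using kg mn' by auto
    have "2 * (of_int k' * g) = of_int m"
      using kg k' by simp
    moreover have "\<bar>of_int m\<bar> = (2::real)"
      using mn' by auto
    ultimately have "\<bar>of_int k' * g\<bar> = 1"
      by linarith
    then have "\<bar>of_int k'\<bar> * g = 1"
      using g by (simp add: abs_mult)
    moreover have "1 \<le> \<bar>real_of_int k'\<bar>" using \<open>k' \<noteq> 0\<close> by linarith
    then have "1 * g \<le> \<bar>of_int k'\<bar> * g"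
      using g(1) by (intro mult_right_mono) simp_all
    ultimately have "g \<le> 1" by simp
    then have "g = of_int f"
      using \<open>1 \<le> g\<close> \<open>f = 1\<close> by simp
    moreover have "(2 * m + 3 * n, m + 2 * n) \<in> G2_coords"
      using mn' unfolding insert_iff empty_iff prod.inject by (elim disjE) (simp_all add: G2_coords_def)
    ultimately show ?thesis by blast
  qed
  moreover from this have "?\<delta> \<bullet> ?\<delta> = 0" unfolding \<delta> by simp
  then have "\<gamma> = root_of (2 * m + 3 * n) (m + 2 * n)" by simp
  ultimately show ?thesis by blast
qed

lemma roots_eq_G2: "\<Phi> = (\<lambda>(i, j). root_of i j) ` G2_coords"
proof -
  have "(\<lambda>(i, j). root_of i j) ` G2_coords = \<Phi>"
  proof (rule irreducible_closed_eq)
    show "(\<lambda>(i, j). root_of i j) ` G2_coords \<subseteq> \<Phi>"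
      using root_of_in_roots by auto
    show "(\<lambda>(i, j). root_of i j) ` G2_coords \<noteq> {}"
      by (simp add: G2_coords_def)
    fix \<psi> \<xi> assume *: "\<psi> \<in> (\<lambda>(i, j). root_of i j) ` G2_coords" "\<xi> \<in> \<Phi>" "\<psi> \<bullet> \<xi> \<noteq> 0"
    then obtain i j where "\<psi> = root_of i j" by auto
    then have "\<psi> \<bullet> \<xi> = of_int i * (\<xi> \<bullet> \<alpha>) + of_int j * (\<xi> \<bullet> \<beta>)"
      by (simp add: root_of_def inner_add_left inner_add_right inner_commute)
    then have "\<xi> \<bullet> \<alpha> \<noteq> 0 \<or> \<xi> \<bullet> \<beta> \<noteq> 0"
      using *(3) by auto
    then show "\<xi> \<in> (\<lambda>(i, j). root_of i j) ` G2_coords"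
      using root_in_plane [OF *(2)] by fast
  qed
  then show ?thesis by simp
qed

lemma root_of_iff: "root_of i j \<in> \<Phi> \<longleftrightarrow> (i, j) \<in> G2_coords"
  by (subst roots_eq_G2) (auto simp: root_of_eq_iff)

lemma DIM_le_2: "DIM('v) \<le> 2"
proof -
  have "\<Phi> \<subseteq> span {\<alpha>, \<beta>}"
  proof -
    have "root_of i j \<in> span {\<alpha>, \<beta>}" for i j
      unfolding root_of_def by (intro span_add span_scale span_base) simp_all
    then show ?thesis
      by (subst roots_eq_G2) auto
  qed
  then have "span \<Phi> \<subseteq> span {\<alpha>, \<beta>}"
    by (rule span_minimal) simp
  then have "UNIV \<subseteq> span {\<alpha>, \<beta>}"
    using root_sys by (simp add: root_system_def)
  then have "DIM('v) \<le> card {\<alpha>, \<beta>}"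
    by (metis dim_UNIV dim_le_card finite.emptyI finite.insertI)
  also have "\<dots> \<le> 2"
    by (simp add: card_insert_if)
  finally show ?thesis .
qed

end

section \<open>Matrices over commutative rings\<close>

lemma smult_mat_nth [simp]: "smult_mat c A $ i $ j = c * A $ i $ j"
  by (simp add: smult_mat_def)

lemma smult_mat_simps [simp]:
  fixes A :: "'a::comm_ring_1^'n^'m"
  shows "smult_mat 0 A = 0" "smult_mat 1 A = A" "smult_mat c 0 = (0::'a^'n^'m)"
    "smult_mat c (smult_mat d A) = smult_mat (c * d) A"
    "smult_mat (- c) A = - smult_mat c A" "smult_mat c (- A) = - smult_mat c A"
  by (simp_all add: vec_eq_iff mult.assoc)

lemma smult_mat_distribs:
  fixes A B :: "'a::comm_ring_1^'n^'m"
  shows "smult_mat c (A + B) = smult_mat c A + smult_mat c B"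
    "smult_mat c (A - B) = smult_mat c A - smult_mat c B"
    "smult_mat (c + d) A = smult_mat c A + smult_mat d A"
    "smult_mat (c - d) A = smult_mat c A - smult_mat d A"
  by (simp_all add: vec_eq_iff algebra_simps)

lemma smult_mat_mult [simp]:
  fixes A :: "'a::comm_ring_1^'n^'m"
  shows "smult_mat c A ** B = smult_mat c (A ** B)" "A ** smult_mat c B = smult_mat c (A ** B)"
  by (simp_all add: vec_eq_iff matrix_matrix_mult_def sum_distrib_left mult_ac)

lemma matrix_mult_distribs:
  fixes A B :: "'a::comm_ring_1^'n^'m" and C D :: "'a^'p^'n"
  shows "(A + B) ** C = A ** C + B ** C" "(A - B) ** C = A ** C - B ** C"
    "A ** (C + D) = A ** C + A ** D" "A ** (C - D) = A ** C - A ** D"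
    "(- A) ** C = - (A ** C)" "A ** (- C) = - (A ** C)" 
  by (simp_all add: vec_eq_iff matrix_matrix_mult_def algebra_simps sum.distrib sum_subtractf sum_negf)

lemma matrix_mult_zero [simp]:
  fixes A :: "'a::comm_ring_1^'n^'m" and C :: "'a^'p^'n"
  shows "0 ** C = (0::'a^'p^'m)" "A ** 0 = (0::'a^'p^'m)"
  by (simp_all add: vec_eq_iff matrix_matrix_mult_def)

lemma matrix_mult_sums:
  fixes A :: "'a::comm_ring_1^'n^'m"
  shows "sum f I ** B = (\<Sum>i\<in>I. f i ** B)" "A ** sum g I = (\<Sum>i\<in>I. A ** g i)"
  by (simp_all add: vec_eq_iff matrix_matrix_mult_def sum_distrib_left sum_distrib_right sum.swap [of _ I])

lemma smult_mat_sum: "smult_mat c (sum f I) = (\<Sum>i\<in>I. smult_mat (c::'a::comm_ring_1) (f i))"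
  by (induction I rule: infinite_finite_induct; simp add: smult_mat_distribs)

lemma smult_int_cancel: "c \<noteq> 0 \<Longrightarrow> smult_mat c A = smult_mat c B \<Longrightarrow> A = B"
  for A B :: "int^'n^'n"
  by (simp add: vec_eq_iff)

lemma mat_power_0 [simp]: "mat_power A 0 = mat 1"
  by (simp add: mat_power_def)

lemma mat_power_Suc: "mat_power A (Suc k) = A ** mat_power A k"
  by (simp add: mat_power_def)

lemma mat_power_add: "mat_power A (j + k) = mat_power A j ** mat_power A k"
  for A :: "'a::comm_ring_1^'n^'n"
  by (induction j) (simp_all add: mat_power_Suc matrix_mul_assoc)

text \<open>
  Identities between root elements are proved over polynomial rings over the integers and carried to
  other rings along homomorphisms.
\<close>

locale unital_ring_hom =
  fixes h :: "'a::comm_ring_1 \<Rightarrow> 'b::comm_ring_1"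
  assumes hom_1 [simp]: "h 1 = 1"
    and hom_add [simp]: "h (x + y) = h x + h y"
    and hom_mult [simp]: "h (x * y) = h x * h y"
begin

lemma hom_0 [simp]: "h 0 = 0"
  using hom_add [of 0 0] by simp

lemma hom_uminus [simp]: "h (- x) = - h x"
  using hom_add [of x "- x"] by (simp add: add_eq_0_iff)

lemma hom_diff [simp]: "h (x - y) = h x - h y"
  using hom_add [of x "- y"] by simp

lemma hom_of_nat [simp]: "h (of_nat n) = of_nat n"
  by (induction n) auto

lemma hom_of_int [simp]: "h (of_int z) = of_int z"
  by (cases z) auto

lemma hom_sum [simp]: "h (sum f I) = (\<Sum>i\<in>I. h (f i))"
  by (induction I rule: infinite_finite_induct) auto

lemma hom_power [simp]: "h (x ^ k) = h x ^ k"
  by (induction k) auto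

lemma map_matrix_hom:
  "map_matrix h (A ** B) = map_matrix h A ** map_matrix h B"
  "map_matrix h (A + B) = map_matrix h A + map_matrix h B"
  "map_matrix h (A - B) = map_matrix h A - map_matrix h B"
  "map_matrix h (- A) = - map_matrix h A"
  "map_matrix h (smult_mat c A) = smult_mat (h c) (map_matrix h A)"
  "map_matrix h (mat 1) = mat 1"
  "map_matrix h 0 = 0"
  "map_matrix h (sum F I) = (\<Sum>i\<in>I. map_matrix h (F i))"
  by (simp_all add: vec_eq_iff matrix_matrix_mult_def mat_def)

lemma map_matrix_of_int [simp]: "map_matrix h (map_matrix of_int M) = map_matrix of_int M"
  by (simp add: vec_eq_iff)

lemma map_matrix_root_elt [simp]: "map_matrix h (root_elt E \<phi> x) = root_elt E \<phi> (h x)"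
  by (simp add: vec_eq_iff root_elt_def)

end

lemma unital_ring_hom_of_int: "unital_ring_hom (of_int :: int \<Rightarrow> 'a::comm_ring_1)"
  by unfold_locales simp_all

lemma unital_ring_hom_const_poly: "unital_ring_hom (\<lambda>c::'a::comm_ring_1. [:c:])"
  by unfold_locales (simp_all add: one_pCons)

lemma unital_ring_hom_poly: "unital_ring_hom (\<lambda>p::'a::comm_ring_1 poly. poly p x)"
  by unfold_locales simp_all

interpretation of_int_hom: unital_ring_hom "of_int :: int \<Rightarrow> 'a::comm_ring_1"
  by (rule unital_ring_hom_of_int)

interpretation const_poly_hom: unital_ring_hom "\<lambda>c::'a::comm_ring_1. [:c:]"
  by (rule unital_ring_hom_const_poly)

interpretation poly_hom: unital_ring_hom "\<lambda>p::'a::comm_ring_1 poly. poly p x" for x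
  by (rule unital_ring_hom_poly)

text \<open>The extension of \<open>h\<close> to polynomials that sends the variable to \<open>y\<close>, by Horner's rule.\<close>

definition poly_lift :: "('a::comm_ring_1 \<Rightarrow> 'b::comm_ring_1) \<Rightarrow> 'b \<Rightarrow> 'a poly \<Rightarrow> 'b" where
  "poly_lift h y p = fold_coeffs (\<lambda>c v. h c + y * v) p 0"

context unital_ring_hom
begin

lemma poly_lift_0 [simp]: "poly_lift h y 0 = 0"
  by (simp add: poly_lift_def)

lemma poly_lift_pCons [simp]: "poly_lift h y (pCons c p) = h c + y * poly_lift h y p"
  by (cases "p = 0 \<and> c = 0") (auto simp: poly_lift_def)

lemma poly_lift_add: "poly_lift h y (p + q) = poly_lift h y p + poly_lift h y q"
proof (induction p arbitrary: q)
  case (pCons a p)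
  then show ?case by (cases q) (simp add: algebra_simps)
qed simp

lemma poly_lift_smult: "poly_lift h y (Polynomial.smult c p) = h c * poly_lift h y p"
  by (induction p) (simp_all add: algebra_simps)

lemma poly_lift_mult: "poly_lift h y (p * q) = poly_lift h y p * poly_lift h y q"
  by (induction p) (simp_all add: poly_lift_add poly_lift_smult algebra_simps)

lemma unital_ring_hom_poly_lift: "unital_ring_hom (poly_lift h y)"
proof
  show "poly_lift h y 1 = 1"
    using poly_lift_pCons [of y 1 0] by simp
qed (simp_all only: poly_lift_add poly_lift_mult)

end

abbreviation int_matrix :: "int^'n^'n \<Rightarrow> 'a::comm_ring_1^'n^'n" where
  "int_matrix M \<equiv> map_matrix of_int M"

text \<open>
  A solution of a linear differential equation \<open>A' = Z A\<close> with constant \<open>Z\<close> over polynomials in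
  characteristic \<open>0\<close> is determined by its constant term, because the equation expresses
  \<open>(k + 1) A\<^sub>k\<^sub>+\<^sub>1\<close> in terms of \<open>A\<^sub>k\<close>. Identities between exponentials become the comparison of
  two logarithmic derivatives.
\<close>

lemma linear_ode_unique:
  fixes A B :: "'k::{idom,ring_char_0} poly^'n^'n" and Z :: "'k^'n^'n"
  assumes A: "map_matrix Polynomial.pderiv A = map_matrix (\<lambda>c. [:c:]) Z ** A"
    and B: "map_matrix Polynomial.pderiv B = map_matrix (\<lambda>c. [:c:]) Z ** B"
    and init: "map_matrix (\<lambda>p. poly p 0) A = map_matrix (\<lambda>p. poly p 0) B"
  shows "A = B"
proof -
  define C where "C = A - B"
  have C': "map_matrix Polynomial.pderiv C = map_matrix (\<lambda>c. [:c:]) Z ** C"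
    using A B by (simp add: C_def matrix_mult_distribs) (simp add: vec_eq_iff pderiv_diff)
  have C0: "poly (C $ i $ j) 0 = 0" for i j
    using init by (simp add: C_def vec_eq_iff)
  have "Polynomial.coeff (C $ i $ j) k = 0" for k i j
  proof (induction k arbitrary: i j)
    case 0
    then show ?case using C0 by (simp add: poly_0_coeff_0)
  next
    case (Suc k)
    have "Polynomial.coeff (Polynomial.pderiv (C $ i $ j)) k = Polynomial.coeff (\<Sum>l\<in>UNIV. [:Z $ i $ l:] * C $ l $ j) k"
      using C' by (simp add: vec_eq_iff matrix_matrix_mult_def)
    also have "\<dots> = 0"
      by (simp add: coeff_sum Suc.IH)
    finally show ?case
      by (simp add: coeff_pderiv del: of_nat_Suc)
  qed
  then have "C = 0"
    by (simp add: vec_eq_iff poly_eq_iff)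
  then show ?thesis by (simp add: C_def)
qed

lemma pderiv_sum: "Polynomial.pderiv (sum f I) = (\<Sum>i\<in>I. Polynomial.pderiv (f i :: 'a::idom poly))"
  by (induction I rule: infinite_finite_induct) (simp_all add: pderiv_add)

lemma pderiv_matrix_mult:
  fixes A B :: "'a::idom poly^'n^'n"
  shows
  "map_matrix Polynomial.pderiv (A ** B) = map_matrix Polynomial.pderiv A ** B + A ** map_matrix Polynomial.pderiv B"
  by (simp add: vec_eq_iff matrix_matrix_mult_def pderiv_sum pderiv_mult sum.distrib algebra_simps)

lemma pderiv_of_int [simp]: "Polynomial.pderiv (of_int m :: 'a::idom poly) = 0"
  unfolding of_int_poly by (rule pderiv_singleton)

lemma pderiv_matrix_linear:
  fixes A B :: "'a::idom poly^'n^'n"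
  shows "map_matrix Polynomial.pderiv (A + B) = map_matrix Polynomial.pderiv A + map_matrix Polynomial.pderiv B"
    "map_matrix Polynomial.pderiv (sum F I) = (\<Sum>i\<in>I. map_matrix Polynomial.pderiv (F i :: 'a poly^'n^'n))"
    "map_matrix Polynomial.pderiv (smult_mat c A) =
       smult_mat (Polynomial.pderiv c) A + smult_mat c (map_matrix Polynomial.pderiv A)"
    "map_matrix Polynomial.pderiv (int_matrix M) = (0 :: 'a poly^'n^'n)"
    "map_matrix Polynomial.pderiv (map_matrix (\<lambda>c. [:c:]) N) = (0 :: 'a poly^'n^'n)"
  by (simp_all add: vec_eq_iff pderiv_add pderiv_mult pderiv_sum)

section \<open>Divided powers\<close>

text \<open>
  The exponential of a matrix with integral divided powers makes sense over every commutative ring, where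
  factorials need not be invertible.
\<close>

locale divided_powers =
  fixes M :: "int^'n^'n"
  assumes fact_dvd: "fact k dvd mat_power M k $ i $ j"
    and nilpotent: "mat_power M CARD('n) = 0"
begin

definition divpow :: "nat \<Rightarrow> int^'n^'n" where
  "divpow k = (\<chi> i j. mat_power M k $ i $ j div fact k)"

lemma fact_divpow: "smult_mat (fact k) (divpow k) = mat_power M k"
  using fact_dvd by (simp add: vec_eq_iff divpow_def)

lemma divpow_Suc: "M ** divpow k = smult_mat (of_nat (Suc k)) (divpow (Suc k))"
proof (rule smult_int_cancel [of "fact k"])
  have "smult_mat (fact k) (M ** divpow k) = M ** smult_mat (fact k) (divpow k)"
    by simp
  also have "\<dots> = mat_power M (Suc k)"
    by (simp only: fact_divpow mat_power_Suc)
  also have "\<dots> = smult_mat (fact (Suc k)) (divpow (Suc k))"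
    by (simp only: fact_divpow)
  finally show "smult_mat (fact k) (M ** divpow k) = smult_mat (fact k) (smult_mat (of_nat (Suc k)) (divpow (Suc k)))"
    by (simp add: algebra_simps)
qed simp

lemma divpow_eq_0: "CARD('n) \<le> k \<Longrightarrow> divpow k = 0"
  using mat_power_add [of M "CARD('n)" "k - CARD('n)"] nilpotent
  by (simp add: vec_eq_iff divpow_def)

lemma divpow_0: "divpow 0 = mat 1"
  by (simp add: divpow_def vec_eq_iff)

lemma divpow_1: "divpow 1 = M"
  using divpow_Suc [of 0] by (simp add: divpow_0)

definition dexp :: "'a::comm_ring_1 \<Rightarrow> 'a^'n^'n" where
  "dexp x = (\<Sum>k<CARD('n). smult_mat (x ^ k) (int_matrix (divpow k)))"

text \<open>
  The truncated exponential satisfies the differential equation of the exponential exactly, since the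
  divided power that is cut off vanishes.
\<close>

lemma pderiv_dexp:
  fixes u :: "'k::idom poly"
  shows "map_matrix Polynomial.pderiv (dexp u) = smult_mat (Polynomial.pderiv u) (int_matrix M ** dexp u)"
proof -
  obtain m where m: "CARD('n) = Suc m"
    using not0_implies_Suc by force
  have "map_matrix Polynomial.pderiv (dexp u) = (\<Sum>k<Suc m. smult_mat (Polynomial.pderiv (u ^ k)) (int_matrix (divpow k)))"
    unfolding dexp_def m by (simp only: pderiv_matrix_linear smult_mat_simps add_0_right)
  also have "\<dots> = (\<Sum>k<m. smult_mat (Polynomial.pderiv (u ^ Suc k)) (int_matrix (divpow (Suc k))))"
    by (subst sum.lessThan_Suc_shift) simp
  also have "\<dots> = (\<Sum>k<m. smult_mat (Polynomial.pderiv u * u ^ k) (int_matrix (M ** divpow k)))"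
  proof (intro sum.cong refl)
    fix k
    have "Polynomial.smult (of_nat n) q = of_nat n * q" for n and q :: "'k poly"
      by (induction n) (simp_all add: smult_add_left algebra_simps)
    then have "Polynomial.pderiv (u ^ Suc k) = Polynomial.pderiv u * u ^ k * of_int (of_nat (Suc k))"
      by (simp only: pderiv_power_Suc of_int_of_nat_eq mult_ac)
    then show "smult_mat (Polynomial.pderiv (u ^ Suc k)) (int_matrix (divpow (Suc k))) =
        smult_mat (Polynomial.pderiv u * u ^ k) (int_matrix (M ** divpow k))"
      by (simp only: divpow_Suc of_int_hom.map_matrix_hom smult_mat_simps)
  qed
  also have "\<dots> = (\<Sum>k<Suc m. smult_mat (Polynomial.pderiv u * u ^ k) (int_matrix (M ** divpow k)))"
    using divpow_Suc [of m] divpow_eq_0 [of "Suc m"] m by (simp add: of_int_hom.map_matrix_hom(7))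
  also have "\<dots> = smult_mat (Polynomial.pderiv u) (int_matrix M ** dexp u)"
    unfolding dexp_def m
    by (simp only: matrix_mult_sums smult_mat_mult smult_mat_sum smult_mat_simps of_int_hom.map_matrix_hom)
  finally show ?thesis .
qed

lemma dexp_0 [simp]: "dexp 0 = mat 1"
proof -
  obtain m where m: "CARD('n) = Suc m"
    using not0_implies_Suc by force
  show ?thesis
    unfolding dexp_def m
    by (subst sum.lessThan_Suc_shift) (simp add: divpow_0 of_int_hom.map_matrix_hom)
qed

end

lemma root_elt_eq_dexp:
  assumes "divided_powers (E \<phi>)"
  shows "root_elt E \<phi> x = divided_powers.dexp (E \<phi>) x"
  using assms by (simp add: divided_powers.dexp_def root_elt_def divided_powers.divpow_def vec_eq_iff)

section \<open>Nilpotency of root vectors\<close>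

lemma independent_family_le_DIM:
  fixes f :: "nat \<Rightarrow> 'a::euclidean_space"
  assumes indep: "\<And>c i. (\<Sum>i<m. c i *\<^sub>R f i) = 0 \<Longrightarrow> i < m \<Longrightarrow> c i = 0"
  shows "m \<le> DIM('a)"
proof -
  have inj: "inj_on f {..<m}"
  proof (rule inj_onI, rule ccontr)
    fix i j assume ij: "i \<in> {..<m}" "j \<in> {..<m}" "f i = f j" "i \<noteq> j"
    define c :: "nat \<Rightarrow> real" where "c = (\<lambda>k. (if k = i then 1 else 0) - (if k = j then 1 else 0))"
    have "(\<Sum>k<m. c k *\<^sub>R f k) = (\<Sum>k<m. if k = i then f k else 0) - (\<Sum>k<m. if k = j then f k else 0)"
      unfolding sum_subtractf [symmetric] by (rule sum.cong) (auto simp: c_def)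
    also have "\<dots> = 0"
      using ij by simp
    finally have "c i = 0"
      using indep ij by blast
    then show False
      using ij by (simp add: c_def)
  qed
  have "independent (f ` {..<m})"
  proof (rule independent_if_scalars_zero)
    fix c x assume c: "(\<Sum>x\<in>f ` {..<m}. c x *\<^sub>R x) = 0" and x: "x \<in> f ` {..<m}"
    then show "c x = 0"
      using indep [of "\<lambda>i. c (f i)"] inj by (auto simp: sum.reindex)
  qed simp
  then have "card (f ` {..<m}) \<le> DIM('a)"
    using independent_bound by blast
  then show ?thesis
    using inj by (simp add: card_image)
qed

text \<open>
  If \<open>[H, M] = 2M\<close>, then \<open>M\<^sup>k\<close> is an eigenvector of \<open>ad H\<close> for the eigenvalue \<open>2k\<close>. Nonzero
  eigenvectors for distinct eigenvalues are independent, so some power of \<open>M\<close> vanishes.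
\<close>

lemma bracket_mat_power:
  fixes H M :: "int^'n^'n"
  assumes "mat_bracket H M = smult_mat 2 M"
  shows "mat_bracket H (mat_power M k) = smult_mat (2 * of_nat k) (mat_power M k)"
proof (induction k)
  case 0
  then show ?case by (simp add: mat_bracket_def)
next
  case (Suc k)
  have HM: "H ** M = M ** H + smult_mat 2 M"
    using assms by (simp add: mat_bracket_def algebra_simps)
  have HMk: "H ** mat_power M k = mat_power M k ** H + smult_mat (2 * of_nat k) (mat_power M k)"
    using Suc by (simp add: mat_bracket_def algebra_simps)
  have "H ** (M ** mat_power M k) = (M ** H + smult_mat 2 M) ** mat_power M k"
    by (simp add: matrix_mul_assoc HM)
  also have "\<dots> = M ** (H ** mat_power M k) + smult_mat 2 (M ** mat_power M k)"
    by (simp add: matrix_mult_distribs matrix_mul_assoc)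
  also have "\<dots> = M ** mat_power M k ** H + smult_mat (2 * of_nat (Suc k)) (M ** mat_power M k)"
    unfolding HMk by (simp add: matrix_mult_distribs matrix_mul_assoc smult_mat_distribs algebra_simps)
  finally show ?case
    by (simp add: mat_bracket_def mat_power_Suc)
qed

lemma mat_power_eq_0_of_bracket:
  fixes H M :: "int^'n^'n"
  assumes "mat_bracket H M = smult_mat 2 M"
  shows "\<exists>m. mat_power M m = 0"
proof (rule ccontr)
  assume nz: "\<nexists>m. mat_power M m = 0"
  define P :: "nat \<Rightarrow> real^'n^'n" where "P k = int_matrix (mat_power M k)" for k
  define H' :: "real^'n^'n" where "H' = int_matrix H"
  have P_nz: "P k \<noteq> 0" for k
    using nz by (auto simp: P_def vec_eq_iff)
  have HP: "H' ** P k - P k ** H' = (2 * real k) *\<^sub>R P k" for k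
  proof -
    have "int_matrix (mat_bracket H (mat_power M k)) = (int_matrix (smult_mat (2 * of_nat k) (mat_power M k)) :: real^'n^'n)"
      using bracket_mat_power [OF assms] by simp
    then show ?thesis
      unfolding mat_bracket_def of_int_hom.map_matrix_hom P_def H'_def by (simp add: vec_eq_iff)
  qed
  have indep: "\<forall>k\<in>I. c k = 0" if "finite I" "(\<Sum>k\<in>I. c k *\<^sub>R P k) = 0" for I and c :: "nat \<Rightarrow> real"
    using that
  proof (induction I arbitrary: c rule: finite_induct)
    case (insert j I)
    let ?S = "\<Sum>k\<in>insert j I. c k *\<^sub>R P k"
    have "0 = H' ** ?S - ?S ** H' - (2 * real j) *\<^sub>R ?S"
      unfolding insert.prems by simp
    also have "\<dots> = (\<Sum>k\<in>insert j I. H' ** (c k *\<^sub>R P k) - (c k *\<^sub>R P k) ** H' - (2 * real j) *\<^sub>R (c k *\<^sub>R P k))"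
      by (simp only: matrix_mult_sums scaleR_sum_right sum_subtractf)
    also have "\<dots> = (\<Sum>k\<in>insert j I. (c k * 2 * (real k - real j)) *\<^sub>R P k)"
    proof (rule sum.cong, rule refl)
      fix k
      have "H' ** (c k *\<^sub>R P k) - (c k *\<^sub>R P k) ** H' = c k *\<^sub>R (H' ** P k - P k ** H')"
        by (simp add: vec_eq_iff matrix_matrix_mult_def sum_distrib_left right_diff_distrib mult_ac)
      then show "H' ** (c k *\<^sub>R P k) - (c k *\<^sub>R P k) ** H' - (2 * real j) *\<^sub>R (c k *\<^sub>R P k) =
          (c k * 2 * (real k - real j)) *\<^sub>R P k"
        by (simp add: HP algebra_simps)
    qed
    also have "\<dots> = (\<Sum>k\<in>I. (c k * 2 * (real k - real j)) *\<^sub>R P k)"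
      using insert.hyps by simp
    finally have "\<forall>k\<in>I. c k * 2 * (real k - real j) = 0"
      using insert.IH [of "\<lambda>k. c k * 2 * (real k - real j)"] by simp
    then have cI: "\<forall>k\<in>I. c k = 0"
      using insert.hyps by auto
    then have "c j *\<^sub>R P j = 0"
      using insert.prems insert.hyps by simp
    then show ?case
      using cI P_nz by simp
  qed simp
  have "Suc DIM(real^'n^'n) \<le> DIM(real^'n^'n)"
    by (rule independent_family_le_DIM [where f = P]) (use indep in blast)
  then show False by simp
qed

text \<open>
  If \<open>M\<^sup>l v \<noteq> 0\<close> for the last nonvanishing power \<open>M\<^sup>l\<close>, the vectors \<open>v, Mv, \<dots>, M\<^sup>lv\<close> are independent, so
  that \<open>l\<close> is less than the size of \<open>M\<close>.
\<close>

lemma mat_power_CARD_eq_0: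
  fixes M :: "int^'n^'n"
  assumes "mat_power M m = 0"
  shows "mat_power M CARD('n) = 0"
proof -
  define m' where "m' = (LEAST m. mat_power M m = 0)"
  have m': "mat_power M m' = 0"
    unfolding m'_def using assms by (rule LeastI)
  have zero: "mat_power M k = 0" if "m' \<le> k" for k
    using mat_power_add [of M m' "k - m'"] m' that by simp
  have "m' \<le> CARD('n)"
  proof (cases m')
    case (Suc l)
    have "mat_power M l \<noteq> 0"
      using not_less_Least [of l "\<lambda>m. mat_power M m = 0"] Suc by (simp add: m'_def)
    define P :: "nat \<Rightarrow> real^'n^'n" where "P k = int_matrix (mat_power M k)" for k
    have "P l \<noteq> 0"
      using \<open>mat_power M l \<noteq> 0\<close> by (auto simp: P_def vec_eq_iff)
    then obtain v where v: "P l *v v \<noteq> 0"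
      using matrix_eq [of "P l" 0] by auto
    have add: "P i *v (P j *v v) = P (i + j) *v v" for i j
      by (simp add: P_def matrix_vector_mul_assoc mat_power_add of_int_hom.map_matrix_hom)
    have "c i = 0" if sum0: "(\<Sum>i<m'. c i *\<^sub>R (P i *v v)) = 0" and "i < m'" for c i
      using \<open>i < m'\<close>
    proof (induction i rule: less_induct)
      case (less j)
      have "0 = P (l - j) *v (\<Sum>i<m'. c i *\<^sub>R (P i *v v))"
        by (simp add: sum0)
      also have "\<dots> = (\<Sum>i<m'. c i *\<^sub>R (P (l - j + i) *v v))"
        by (simp add: linear_sum [OF matrix_vector_mul_linear] matrix_vector_mult_scaleR add)
      also have "\<dots> = (\<Sum>i<m'. if i = j then c j *\<^sub>R (P l *v v) else 0)"
      proof (rule sum.cong, rule refl)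
        fix i assume "i \<in> {..<m'}"
        show "c i *\<^sub>R (P (l - j + i) *v v) = (if i = j then c j *\<^sub>R (P l *v v) else 0)"
        proof (cases i j rule: linorder_cases)
          case less
          with \<open>i \<in> {..<m'}\<close> show ?thesis by (simp add: less.IH)
        next
          case equal
          then show ?thesis using less.prems Suc by simp
        next
          case greater
          then have "m' \<le> l - j + i" using Suc less.prems by simp
          then have "P (l - j + i) = 0" by (simp add: P_def zero of_int_hom.map_matrix_hom(7))
          then show ?thesis using greater by simp
        qed
      qed
      also have "\<dots> = c j *\<^sub>R (P l *v v)"
        using less.prems by simp
      finally show ?case using v by simp
    qed
    then have "m' \<le> DIM(real^'n)"
      by (rule independent_family_le_DIM [where f = "\<lambda>i. P i *v v"])
    then show ?thesis by simp
  qed simp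
  then show ?thesis by (rule zero)
qed

section \<open>Integral Chevalley relations\<close>

lemma mat_bracket_int_matrix:
  "mat_bracket (int_matrix A) (int_matrix B) = (int_matrix (mat_bracket A B) :: 'a::comm_ring_1^'n^'n)"
  by (simp add: mat_bracket_def of_int_hom.map_matrix_hom)

lemma int_matrix_smult:
  "int_matrix (smult_mat c A) = (smult_mat (of_int c) (int_matrix A) :: 'a::comm_ring_1^'n^'n)"
  by (rule of_int_hom.map_matrix_hom)

lemma int_matrix_inject: "(int_matrix A :: 'a::{comm_ring_1,ring_char_0}^'n^'n) = int_matrix B \<longleftrightarrow> A = B"
  by (simp add: vec_eq_iff)

text \<open>The part of a Chevalley realization that the relations between root elements depend on.\<close>

locale chevalley_system = root_system_facts \<Phi> for \<Phi> :: "'v::euclidean_space set" +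
  fixes E H :: "'v \<Rightarrow> int^'n^'n"
  assumes E_nonzero: "\<alpha> \<in> \<Phi> \<Longrightarrow> E \<alpha> \<noteq> 0"
    and bracket_HE: "\<alpha> \<in> \<Phi> \<Longrightarrow> \<beta> \<in> \<Phi> \<Longrightarrow> cartan \<beta> \<alpha> = of_int c \<Longrightarrow>
      mat_bracket (H \<alpha>) (E \<beta>) = smult_mat c (E \<beta>)"
    and bracket_EE_neg: "\<alpha> \<in> \<Phi> \<Longrightarrow> mat_bracket (E \<alpha>) (E (- \<alpha>)) = H \<alpha>"
    and bracket_EE_zero: "\<alpha> \<in> \<Phi> \<Longrightarrow> \<beta> \<in> \<Phi> \<Longrightarrow> \<alpha> + \<beta> \<noteq> 0 \<Longrightarrow> \<alpha> + \<beta> \<notin> \<Phi> \<Longrightarrow>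
      mat_bracket (E \<alpha>) (E \<beta>) = 0"
    and bracket_EE: "\<alpha> \<in> \<Phi> \<Longrightarrow> \<beta> \<in> \<Phi> \<Longrightarrow> \<alpha> + \<beta> \<in> \<Phi> \<Longrightarrow>
      \<exists>c. \<bar>c\<bar> = int (root_string \<Phi> \<alpha> \<beta>) + 1 \<and> mat_bracket (E \<alpha>) (E \<beta>) = smult_mat c (E (\<alpha> + \<beta>))"
    and fact_dvd_E: "\<alpha> \<in> \<Phi> \<Longrightarrow> fact k dvd mat_power (E \<alpha>) k $ i $ j"

lemma chevalley_system_realization:
  fixes E H :: "'v::euclidean_space \<Rightarrow> int^'n^'n"
  assumes "irreducible_root_system \<Phi>" and "simply_connected_realization \<Phi> \<Delta> E H"
  shows "chevalley_system \<Phi> E H"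
proof -
  let ?E = "\<lambda>\<phi>. int_matrix (E \<phi>) :: complex^'n^'n" and ?H = "\<lambda>\<phi>. int_matrix (H \<phi>) :: complex^'n^'n"
  have rs: "root_system \<Phi>" using assms(1) by (simp add: irreducible_root_system_def)
  then have fin: "finite \<Phi>" by (simp add: root_system_def)
  have cb: "chevalley_basis \<Phi> \<Delta> ?E ?H"
    and dvd: "\<forall>\<phi>\<in>\<Phi>. \<forall>k i j. fact k dvd mat_power (E \<phi>) k $ i $ j"
    using assms(2) by (simp_all add: simply_connected_realization_def)
  note cb = cb [unfolded chevalley_basis_def]
  show ?thesis
  proof
    show "root_system \<Phi>" by fact
    show "E \<alpha> \<noteq> 0" if "\<alpha> \<in> \<Phi>" for \<alpha>
    proof
      assume "E \<alpha> = 0"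
      let ?a = "\<lambda>\<phi>. if \<phi> = \<alpha> then 1 else 0 :: complex"
      have "(\<Sum>\<phi>\<in>\<Phi>. smult_mat (?a \<phi>) (?E \<phi>)) + (\<Sum>\<delta>\<in>\<Delta>. smult_mat 0 (?H \<delta>)) = 0"
        using \<open>E \<alpha> = 0\<close> by (auto intro!: sum.neutral simp: of_int_hom.map_matrix_hom(7))
      then have "?a \<alpha> = 0"
        using cb that by (elim conjE) (drule spec [of _ ?a], drule spec [of _ "\<lambda>_. 0"], blast)
      then show False by simp
    qed
    show "mat_bracket (H \<alpha>) (E \<beta>) = smult_mat c (E \<beta>)"
      if "\<alpha> \<in> \<Phi>" "\<beta> \<in> \<Phi>" "cartan \<beta> \<alpha> = of_int c" for \<alpha> \<beta> c
    proof -
      have "mat_bracket (?H \<alpha>) (?E \<beta>) = smult_mat (of_real (cartan \<beta> \<alpha>)) (?E \<beta>)"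
        using cb that by blast
      then show ?thesis
        unfolding that(3) mat_bracket_int_matrix of_real_of_int_eq int_matrix_smult [symmetric] int_matrix_inject .
    qed
    show "mat_bracket (E \<alpha>) (E (- \<alpha>)) = H \<alpha>" if "\<alpha> \<in> \<Phi>" for \<alpha>
    proof -
      have "mat_bracket (?E \<alpha>) (?E (- \<alpha>)) = ?H \<alpha>"
        using cb that by blast
      then show ?thesis
        unfolding mat_bracket_int_matrix int_matrix_inject .
    qed
    show "mat_bracket (E \<alpha>) (E \<beta>) = 0"
      if "\<alpha> \<in> \<Phi>" "\<beta> \<in> \<Phi>" "\<alpha> + \<beta> \<noteq> 0" "\<alpha> + \<beta> \<notin> \<Phi>" for \<alpha> \<beta>
    proof -
      have "mat_bracket (?E \<alpha>) (?E \<beta>) = int_matrix 0"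
        using cb that unfolding of_int_hom.map_matrix_hom(7) by blast
      then show ?thesis
        unfolding mat_bracket_int_matrix int_matrix_inject .
    qed
    show "\<exists>c. \<bar>c\<bar> = int (root_string \<Phi> \<alpha> \<beta>) + 1 \<and> mat_bracket (E \<alpha>) (E \<beta>) = smult_mat c (E (\<alpha> + \<beta>))"
      if "\<alpha> \<in> \<Phi>" "\<beta> \<in> \<Phi>" "\<alpha> + \<beta> \<in> \<Phi>" for \<alpha> \<beta>
    proof -
      let ?p = "int (root_string \<Phi> \<alpha> \<beta>) + 1"
      have p: "complex_of_int ?p = of_nat (root_string \<Phi> \<alpha> \<beta> + 1)"
          "complex_of_int (- ?p) = - of_nat (root_string \<Phi> \<alpha> \<beta> + 1)"
        by simp_all
      have "mat_bracket (?E \<alpha>) (?E \<beta>) = smult_mat (of_int ?p) (?E (\<alpha> + \<beta>)) \<or>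
          mat_bracket (?E \<alpha>) (?E \<beta>) = smult_mat (of_int (- ?p)) (?E (\<alpha> + \<beta>))"
        unfolding p using cb that by blast
      then have "mat_bracket (E \<alpha>) (E \<beta>) = smult_mat ?p (E (\<alpha> + \<beta>)) \<or>
          mat_bracket (E \<alpha>) (E \<beta>) = smult_mat (- ?p) (E (\<alpha> + \<beta>))"
        unfolding mat_bracket_int_matrix int_matrix_smult [symmetric] int_matrix_inject .
      moreover have "\<bar>?p\<bar> = ?p" "\<bar>- ?p\<bar> = ?p" by linarith+
      ultimately show ?thesis by blast
    qed
    show "fact k dvd mat_power (E \<alpha>) k $ i $ j" if "\<alpha> \<in> \<Phi>" for \<alpha> k i j
      using dvd that by blast
  qed
qed

lemma map_matrix_const_poly_int [simp]:
  "map_matrix (\<lambda>c. [:c:]) M = (int_matrix M :: int poly^'n^'n)"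
  by (simp add: vec_eq_iff of_int_poly)

lemma bracket_int_matrix_eqD:
  "mat_bracket A B = C \<Longrightarrow>
    (int_matrix A ** int_matrix B :: 'a::comm_ring_1^'n^'n) = int_matrix B ** int_matrix A + int_matrix C"
  by (auto simp: mat_bracket_def of_int_hom.map_matrix_hom)

text \<open>The generic parameters \<open>var_x\<close> and \<open>var_y\<close> specialize to any two elements of any commutative ring.\<close>

definition eval2 :: "'a::comm_ring_1 \<Rightarrow> 'a \<Rightarrow> int poly poly \<Rightarrow> 'a" where
  "eval2 x y = poly_lift (poly_lift of_int x) y"

lemma unital_ring_hom_eval2: "unital_ring_hom (eval2 x y)"
  unfolding eval2_def
  by (intro unital_ring_hom.unital_ring_hom_poly_lift unital_ring_hom_of_int)

interpretation eval2_hom: unital_ring_hom "eval2 x y" for x y :: "'a::comm_ring_1"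
  by (rule unital_ring_hom_eval2)

abbreviation var_x :: "int poly" where "var_x \<equiv> [:0, 1:]"
abbreviation var_y :: "int poly poly" where "var_y \<equiv> [:0, 1:]"

lemma eval2_vars [simp]: "eval2 x y [:[:0, 1:]:] = x" "eval2 x y [:0, 1:] = y"
proof -
  interpret a: unital_ring_hom "poly_lift of_int x"
    by (intro unital_ring_hom.unital_ring_hom_poly_lift unital_ring_hom_of_int)
  interpret b: unital_ring_hom "poly_lift (poly_lift of_int x) y"
    by (rule a.unital_ring_hom_poly_lift)
  show "eval2 x y [:[:0, 1:]:] = x" "eval2 x y [:0, 1:] = y"
    by (simp_all add: eval2_def)
qed

context chevalley_system
begin

lemma divided_powers_E:
  assumes "\<alpha> \<in> \<Phi>"
  shows "divided_powers (E \<alpha>)"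
proof
  show "fact k dvd mat_power (E \<alpha>) k $ i $ j" for k i j
    using assms by (rule fact_dvd_E)
  have "mat_bracket (H \<alpha>) (E \<alpha>) = smult_mat 2 (E \<alpha>)"
    using assms by (intro bracket_HE) (simp_all add: cartan_root_self)
  then show "mat_power (E \<alpha>) CARD('n) = 0"
    using mat_power_eq_0_of_bracket mat_power_CARD_eq_0 by blast
qed

lemma root_elt_0 [simp]: "\<alpha> \<in> \<Phi> \<Longrightarrow> root_elt E \<alpha> 0 = mat 1"
  by (simp add: root_elt_eq_dexp divided_powers_E divided_powers.dexp_0)

lemma pderiv_root_elt:
  "\<alpha> \<in> \<Phi> \<Longrightarrow> map_matrix Polynomial.pderiv (root_elt E \<alpha> (u :: 'k::idom poly)) =
    smult_mat (Polynomial.pderiv u) (int_matrix (E \<alpha>) ** root_elt E \<alpha> u)"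
  by (simp add: root_elt_eq_dexp divided_powers_E divided_powers.pderiv_dexp)

lemma root_elt_commute:
  assumes "\<alpha> \<in> \<Phi>" "mat_bracket (E \<alpha>) M = 0"
  shows "root_elt E \<alpha> x ** int_matrix M = int_matrix M ** root_elt E \<alpha> (x :: 'r::comm_ring_1)"
proof -
  interpret divided_powers "E \<alpha>" by (intro divided_powers_E assms)
  have comm: "E \<alpha> ** M = M ** E \<alpha>"
    using assms(2) by (simp add: mat_bracket_def)
  have pow: "mat_power (E \<alpha>) k ** M = M ** mat_power (E \<alpha>) k" for k
  proof (induction k)
    case (Suc k)
    then show ?case
      unfolding mat_power_Suc by (metis comm matrix_mul_assoc)
  qed simp
  have "divpow k ** M = M ** divpow k" for k
  proof (rule smult_int_cancel [of "fact k"])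
    have "smult_mat (fact k) (divpow k) ** M = M ** smult_mat (fact k) (divpow k)"
      unfolding fact_divpow by (rule pow)
    then show "smult_mat (fact k) (divpow k ** M) = smult_mat (fact k) (M ** divpow k)"
      by simp
  qed simp
  then show ?thesis
    by (simp add: root_elt_eq_dexp divided_powers_E assms dexp_def matrix_mult_sums of_int_hom.map_matrix_hom(1) [symmetric])
qed

lemma bracket_EE_self [simp]: "mat_bracket (E \<alpha>) (E \<alpha>) = 0"
  by (simp add: mat_bracket_def)

lemma root_elt_add:
  assumes \<alpha>: "\<alpha> \<in> \<Phi>"
  shows "root_elt E \<alpha> x ** root_elt E \<alpha> y = root_elt E \<alpha> (x + y :: 'r::comm_ring_1)"
proof -
  let ?x = "[:var_x:] :: int poly poly"
  have "root_elt E \<alpha> ?x ** root_elt E \<alpha> var_y = root_elt E \<alpha> (?x + var_y)"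
  proof (rule linear_ode_unique [where Z = "int_matrix (E \<alpha>)"])
    show "map_matrix Polynomial.pderiv (root_elt E \<alpha> ?x ** root_elt E \<alpha> var_y) =
        map_matrix (\<lambda>c. [:c:]) (int_matrix (E \<alpha>)) ** (root_elt E \<alpha> ?x ** root_elt E \<alpha> var_y)"
      using root_elt_commute [OF \<alpha> bracket_EE_self, of ?x]
      by (simp add: pderiv_matrix_mult pderiv_root_elt \<alpha> pderiv_pCons matrix_mul_assoc)
  qed (simp_all add: pderiv_root_elt \<alpha> poly_hom.map_matrix_hom pderiv_add pderiv_pCons)
  then have "map_matrix (eval2 x y) (root_elt E \<alpha> ?x ** root_elt E \<alpha> var_y) =
      map_matrix (eval2 x y) (root_elt E \<alpha> (?x + var_y))"
    by simp
  then show ?thesis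
    by (simp only: eval2_hom.map_matrix_hom eval2_hom.map_matrix_root_elt eval2_hom.hom_add eval2_vars)
qed

lemma root_elt_inverse:
  assumes \<alpha>: "\<alpha> \<in> \<Phi>"
  shows "root_elt E \<alpha> x ** root_elt E \<alpha> (- x) = mat 1"
    "root_elt E \<alpha> (- x) ** root_elt E \<alpha> (x :: 'r::comm_ring_1) = mat 1"
  using assms by (simp_all add: root_elt_add)

text \<open>
  Conjugation by a root element is \<open>exp (x ad E\<^sub>\<alpha>)\<close> on matrices. The strings that occur here have
  at most three terms.
\<close>

lemma root_elt_conj:
  assumes \<alpha>: "\<alpha> \<in> \<Phi>"
    and D: "mat_bracket (E \<alpha>) D0 = D1" "mat_bracket (E \<alpha>) D1 = smult_mat 2 D2" "mat_bracket (E \<alpha>) D2 = 0"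
  shows "root_elt E \<alpha> x ** int_matrix D0 =
    (int_matrix D0 + smult_mat x (int_matrix D1) + smult_mat (x * x) (int_matrix D2)) **
      root_elt E \<alpha> (x :: 'r::comm_ring_1)"
proof -
  let ?e = "root_elt E \<alpha> var_x"
  let ?M = "\<lambda>M. int_matrix M :: int poly^'n^'n"
  let ?T = "?M D0 + smult_mat var_x (?M D1) + smult_mat (var_x * var_x) (?M D2)"
  note br = D [THEN bracket_int_matrix_eqD, where 'a = "int poly"]
  have "?e ** ?M D0 = ?T ** ?e"
  proof (rule linear_ode_unique [where Z = "E \<alpha>"])
    show "map_matrix Polynomial.pderiv (?e ** ?M D0) = map_matrix (\<lambda>c. [:c:]) (E \<alpha>) ** (?e ** ?M D0)"
      by (simp add: pderiv_matrix_mult pderiv_matrix_linear pderiv_root_elt \<alpha> pderiv_pCons matrix_mul_assoc)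
    have T': "map_matrix Polynomial.pderiv ?T = ?M D1 + smult_mat (2 * var_x) (?M D2)"
      by (simp add: pderiv_matrix_linear pderiv_mult pderiv_pCons)
    have ET: "?M (E \<alpha>) ** ?T = ?T ** ?M (E \<alpha>) + map_matrix Polynomial.pderiv ?T"
      unfolding T' matrix_mult_distribs smult_mat_mult br
      by (simp add: smult_mat_distribs int_matrix_smult of_int_hom.map_matrix_hom(7) mult.commute)
    show "map_matrix Polynomial.pderiv (?T ** ?e) = map_matrix (\<lambda>c. [:c:]) (E \<alpha>) ** (?T ** ?e)"
      by (simp only: pderiv_matrix_mult pderiv_root_elt [OF \<alpha>] map_matrix_const_poly_int matrix_mul_assoc ET)
        (simp add: matrix_mult_distribs matrix_mul_assoc pderiv_pCons)
  qed (simp_all add: poly_hom.map_matrix_hom \<alpha>)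
  then have "map_matrix (poly_lift of_int x) (?e ** ?M D0) = map_matrix (poly_lift of_int x) (?T ** ?e)"
    by simp
  moreover interpret l: unital_ring_hom "poly_lift of_int x"
    by (intro unital_ring_hom.unital_ring_hom_poly_lift unital_ring_hom_of_int)
  have "poly_lift of_int x var_x = x"
    by simp
  ultimately show ?thesis
    by (simp only: l.map_matrix_hom l.map_matrix_root_elt l.map_matrix_of_int l.hom_mult)
qed

end

section \<open>Relations between root elements\<close>

lemma mat_bracket_right_simps [simp]:
  fixes A B :: "'a::comm_ring_1^'n^'n"
  shows "mat_bracket A (smult_mat c B) = smult_mat c (mat_bracket A B)"
    "mat_bracket A (- B) = - mat_bracket A B" "mat_bracket A 0 = 0"
  by (simp_all add: mat_bracket_def smult_mat_distribs matrix_mult_distribs)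

context chevalley_system
begin

text \<open>
  Conjugation by \<open>g\<close> turns the logarithmic derivative \<open>E \<beta>\<close> of \<open>\<epsilon>\<^sub>\<beta>\<close> into \<open>Z\<close>. So it suffices to find a
  product \<open>B\<close> of root elements with logarithmic derivative \<open>Z\<close>.
\<close>

lemma conj_root_elt_eq:
  fixes g Z :: "'k::{idom,ring_char_0}^'n^'n" and B :: "'k poly^'n^'n"
  assumes \<beta>: "\<beta> \<in> \<Phi>" and g: "g ** int_matrix (E \<beta>) = Z ** g"
    and B': "map_matrix Polynomial.pderiv B = map_matrix (\<lambda>c. [:c:]) Z ** B"
    and B0: "map_matrix (\<lambda>p. poly p 0) B = mat 1"
  shows "map_matrix (\<lambda>c. [:c:]) g ** root_elt E \<beta> [:0, 1:] = B ** map_matrix (\<lambda>c. [:c:]) g"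
proof (rule linear_ode_unique [where Z = Z])
  let ?c = "map_matrix (\<lambda>c::'k. [:c:])"
  have "?c g ** int_matrix (E \<beta>) = ?c Z ** ?c g"
    using arg_cong [OF g, of ?c] by (simp add: const_poly_hom.map_matrix_hom)
  then show "map_matrix Polynomial.pderiv (?c g ** root_elt E \<beta> [:0, 1:]) = ?c Z ** (?c g ** root_elt E \<beta> [:0, 1:])"
    by (simp add: pderiv_matrix_mult pderiv_matrix_linear pderiv_root_elt \<beta> pderiv_pCons matrix_mul_assoc)
  show "map_matrix Polynomial.pderiv (B ** ?c g) = ?c Z ** (B ** ?c g)"
    by (simp add: pderiv_matrix_mult pderiv_matrix_linear B' matrix_mul_assoc)
  have "map_matrix (\<lambda>p. poly p 0) (?c g) = g"
    by (simp add: vec_eq_iff)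
  then show "map_matrix (\<lambda>p. poly p 0) (?c g ** root_elt E \<beta> [:0, 1:]) =
      map_matrix (\<lambda>p. poly p 0) (B ** ?c g)"
    by (simp add: poly_hom.map_matrix_hom B0 \<beta>)
qed

text \<open>
  The commutator formula for a string \<open>\<gamma>\<^sub>0, \<gamma>\<^sub>1, \<gamma>\<^sub>2\<close> whose root vectors commute, except that
  \<open>[E \<gamma>\<^sub>0, E \<gamma>\<^sub>1]\<close> may be a multiple of a vector \<open>E \<delta>\<close> that commutes with the others; this
  contributes the factor \<open>\<epsilon>\<^sub>\<delta>(dxy\<^sup>2)\<close>, as in \<open>exp (A + B) = exp A exp B exp (- [A, B] / 2)\<close>. In all cases
  except \<open>G\<^sub>2\<close> the coefficient \<open>d\<close> is \<open>0\<close>.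
\<close>

lemma commutator_formula:
  assumes roots: "\<alpha> \<in> \<Phi>" "\<gamma>0 \<in> \<Phi>" "\<gamma>1 \<in> \<Phi>" "\<gamma>2 \<in> \<Phi>" "\<delta> \<in> \<Phi>"
    and string: "mat_bracket (E \<alpha>) (E \<gamma>0) = smult_mat c1 (E \<gamma>1)"
      "smult_mat c1 (mat_bracket (E \<alpha>) (E \<gamma>1)) = smult_mat (2 * c2) (E \<gamma>2)"
      "smult_mat c2 (mat_bracket (E \<alpha>) (E \<gamma>2)) = 0"
    and comm: "smult_mat c1 (mat_bracket (E \<gamma>0) (E \<gamma>1)) = smult_mat (- (2 * d)) (E \<delta>)"
      "mat_bracket (E \<gamma>0) (E \<gamma>2) = 0" "mat_bracket (E \<gamma>1) (E \<gamma>2) = 0" "mat_bracket (E \<gamma>0) (E \<delta>) = 0"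
      "mat_bracket (E \<gamma>1) (E \<delta>) = 0" "mat_bracket (E \<gamma>2) (E \<delta>) = 0"
  shows "root_elt E \<alpha> x ** root_elt E \<gamma>0 y =
    root_elt E \<gamma>0 y ** (root_elt E \<gamma>1 (of_int c1 * x * y) ** (root_elt E \<gamma>2 (of_int c2 * x * x * y) **
      root_elt E \<delta> (of_int d * x * y * y))) ** root_elt E \<alpha> (x :: 'r::comm_ring_1)"
proof -
  let ?M = "\<lambda>M. int_matrix M :: int poly poly^'n^'n"
  let ?x = "[:var_x:] :: int poly poly"
  let ?e0 = "root_elt E \<gamma>0 var_y" and ?e1 = "root_elt E \<gamma>1 (of_int c1 * ?x * var_y)"
    and ?e2 = "root_elt E \<gamma>2 (of_int c2 * ?x * ?x * var_y)" and ?ed = "root_elt E \<delta> (of_int d * ?x * var_y * var_y)"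
  let ?Z = "int_matrix (E \<gamma>0) + smult_mat var_x (smult_mat (of_int c1) (int_matrix (E \<gamma>1))) +
      smult_mat (var_x * var_x) (smult_mat (of_int c2) (int_matrix (E \<gamma>2))) :: int poly^'n^'n"
  let ?B = "?e0 ** (?e1 ** (?e2 ** ?ed))"
  have "map_matrix (\<lambda>c. [:c:]) (root_elt E \<alpha> var_x) ** root_elt E \<gamma>0 var_y =
      ?B ** map_matrix (\<lambda>c. [:c:]) (root_elt E \<alpha> var_x)"
  proof (rule conj_root_elt_eq [where Z = ?Z])
    show "\<gamma>0 \<in> \<Phi>" by fact
    have "root_elt E \<alpha> var_x ** int_matrix (E \<gamma>0) =
      (int_matrix (E \<gamma>0) + smult_mat var_x (int_matrix (smult_mat c1 (E \<gamma>1))) +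
        smult_mat (var_x * var_x) (int_matrix (smult_mat c2 (E \<gamma>2)))) ** root_elt E \<alpha> var_x"
      by (rule root_elt_conj) (simp_all add: roots string)
    then show "root_elt E \<alpha> var_x ** int_matrix (E \<gamma>0) = ?Z ** root_elt E \<alpha> var_x"
      by (simp only: int_matrix_smult)
    show "map_matrix (\<lambda>p. poly p 0) ?B = mat 1"
      by (simp add: poly_hom.map_matrix_hom roots)
    have br0: "mat_bracket (E \<gamma>0) (smult_mat c1 (E \<gamma>1)) = smult_mat (- (2 * d)) (E \<delta>)"
      by (simp only: mat_bracket_right_simps comm)
    have "?e0 ** int_matrix (smult_mat c1 (E \<gamma>1)) =
      (int_matrix (smult_mat c1 (E \<gamma>1)) + smult_mat var_y (int_matrix (smult_mat (- (2 * d)) (E \<delta>))) +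
        smult_mat (var_y * var_y) (int_matrix 0)) ** ?e0"
      by (rule root_elt_conj) (use roots br0 in \<open>simp_all add: comm\<close>)
    then have e0E1: "?e0 ** smult_mat (of_int c1) (?M (E \<gamma>1)) =
      (smult_mat (of_int c1) (?M (E \<gamma>1)) - smult_mat (2 * of_int d * var_y) (?M (E \<delta>))) ** ?e0"
      unfolding int_matrix_smult of_int_hom.map_matrix_hom(7) by (simp add: mult_ac)
    note cE = root_elt_commute [where 'r = "int poly poly"]
    have cZ: "map_matrix (\<lambda>c. [:c:]) ?Z = ?M (E \<gamma>0) + smult_mat ?x (smult_mat (of_int c1) (?M (E \<gamma>1))) +
      smult_mat (?x * ?x) (smult_mat (of_int c2) (?M (E \<gamma>2)))"
      by (simp add: const_poly_hom.map_matrix_hom of_int_poly del: smult_mat_simps)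
    show "map_matrix Polynomial.pderiv ?B = map_matrix (\<lambda>c. [:c:]) ?Z ** ?B"
    proof -
      let ?F0 = "?M (E \<gamma>0)" and ?F1 = "?M (E \<gamma>1)" and ?F2 = "?M (E \<gamma>2)" and ?Fd = "?M (E \<delta>)"
      let ?Q = "?e2 ** ?ed" let ?P = "?e1 ** ?Q"
      let ?u1 = "of_int c1 * ?x" and ?u2 = "of_int c2 * ?x * ?x" and ?ud = "2 * of_int d * ?x * var_y"
      have pd: "Polynomial.pderiv var_y = 1" "Polynomial.pderiv ?x = 0"
        by (simp_all add: pderiv_pCons)
      have d0: "map_matrix Polynomial.pderiv ?e0 = ?F0 ** ?e0"
        and d1: "map_matrix Polynomial.pderiv ?e1 = smult_mat ?u1 (?F1 ** ?e1)"
        and d2: "map_matrix Polynomial.pderiv ?e2 = smult_mat ?u2 (?F2 ** ?e2)"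
        and dd: "map_matrix Polynomial.pderiv ?ed = smult_mat ?ud (?Fd ** ?ed)"
        unfolding pderiv_root_elt [OF roots(2)] pderiv_root_elt [OF roots(3)] pderiv_root_elt [OF roots(4)]
          pderiv_root_elt [OF roots(5)] pderiv_mult pd pderiv_of_int
        by (simp_all add: algebra_simps)
      have c2d: "?e2 ** (?Fd ** A) = ?Fd ** (?e2 ** A)" and c12: "?e1 ** (?F2 ** A) = ?F2 ** (?e1 ** A)"
        and c1d: "?e1 ** (?Fd ** A) = ?Fd ** (?e1 ** A)"
        and c02: "?e0 ** (?F2 ** A) = ?F2 ** (?e0 ** A)" and c0d: "?e0 ** (?Fd ** A) = ?Fd ** (?e0 ** A)" for A
        unfolding matrix_mul_assoc
        by (simp_all only: cE [OF roots(2) comm(2)] cE [OF roots(2) comm(4)] cE [OF roots(3) comm(3)]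
          cE [OF roots(3) comm(5)] cE [OF roots(4) comm(6)])
      have c01: "?e0 ** (smult_mat ?u1 (?F1 ** A)) =
          smult_mat ?u1 (?F1 ** (?e0 ** A)) - smult_mat ?ud (?Fd ** (?e0 ** A))" for A
      proof -
        have "?e0 ** (smult_mat ?u1 (?F1 ** A)) = smult_mat ?x (?e0 ** smult_mat (of_int c1) ?F1 ** A)"
          by (simp add: matrix_mul_assoc mult_ac)
        also have "\<dots> = smult_mat ?u1 (?F1 ** (?e0 ** A)) - smult_mat ?ud (?Fd ** (?e0 ** A))"
          unfolding e0E1 by (simp add: matrix_mul_assoc matrix_mult_distribs smult_mat_distribs mult_ac)
        finally show ?thesis .
      qed
      have "map_matrix Polynomial.pderiv ?Q = smult_mat ?u2 (?F2 ** ?Q) + smult_mat ?ud (?Fd ** ?Q)"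
        unfolding pderiv_matrix_mult d2 dd smult_mat_mult c2d by (simp only: matrix_mul_assoc)
      then have "map_matrix Polynomial.pderiv ?P =
          smult_mat ?u1 (?F1 ** ?P) + (smult_mat ?u2 (?F2 ** ?P) + smult_mat ?ud (?Fd ** ?P))"
        unfolding pderiv_matrix_mult [of ?e1] d1 smult_mat_mult
        by (simp only: matrix_mult_distribs smult_mat_mult c12 c1d) (simp only: matrix_mul_assoc)
      then have "map_matrix Polynomial.pderiv ?B = ?F0 ** ?B +
          ((smult_mat ?u1 (?F1 ** ?B) - smult_mat ?ud (?Fd ** ?B)) + (smult_mat ?u2 (?F2 ** ?B) + smult_mat ?ud (?Fd ** ?B)))"
        unfolding pderiv_matrix_mult [of ?e0] d0
        by (simp only: matrix_mult_distribs(3) c01) (simp only: matrix_mul_assoc [symmetric] smult_mat_mult c02 c0d)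
      also have "\<dots> = map_matrix (\<lambda>c. [:c:]) ?Z ** ?B"
      proof -
        have "?F0 ** A + ((smult_mat ?u1 (?F1 ** A) - N) + (smult_mat ?u2 (?F2 ** A) + N)) =
            (?F0 + smult_mat ?x (smult_mat (of_int c1) ?F1) + smult_mat (?x * ?x) (smult_mat (of_int c2) ?F2)) ** A"
          for A N :: "int poly poly^'n^'n"
          by (simp add: matrix_mult_distribs mult_ac)
        then show ?thesis unfolding cZ .
      qed
      finally show ?thesis .
    qed
  qed
  then have "map_matrix (eval2 x y) (root_elt E \<alpha> ?x ** root_elt E \<gamma>0 var_y) =
      map_matrix (eval2 x y) (?B ** root_elt E \<alpha> ?x)"
    by simp
  then show ?thesis
    by (simp only: eval2_hom.map_matrix_hom eval2_hom.map_matrix_root_elt eval2_hom.hom_mult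
      eval2_hom.hom_of_int eval2_vars)
qed

text \<open>A representative of the reflection \<open>s\<^sub>\<alpha>\<close> in the extended Weyl group.\<close>

definition weyl_elt :: "'v \<Rightarrow> 'r::comm_ring_1^'n^'n" where
  "weyl_elt \<alpha> = root_elt E \<alpha> 1 ** (root_elt E (- \<alpha>) (- 1) ** root_elt E \<alpha> 1)"

lemma weyl_elt_root_elt:
  fixes y :: "'r::comm_ring_1"
  assumes \<alpha>: "\<alpha> \<in> \<Phi>" and \<beta>: "\<beta> \<in> \<Phi>" and \<gamma>: "\<gamma> \<in> \<Phi>"
    and w: "weyl_elt \<alpha> ** E \<beta> = smult_mat s (E \<gamma>) ** weyl_elt \<alpha>"
  shows "weyl_elt \<alpha> ** root_elt E \<beta> y = root_elt E \<gamma> (of_int s * y) ** weyl_elt \<alpha>"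
proof -
  interpret l: unital_ring_hom "poly_lift of_int y"
    by (intro unital_ring_hom.unital_ring_hom_poly_lift unital_ring_hom_of_int)
  have w_nat: "map_matrix h (weyl_elt \<alpha>) = weyl_elt \<alpha>" if "unital_ring_hom h" for h :: "'a::comm_ring_1 \<Rightarrow> 'b::comm_ring_1"
  proof -
    interpret unital_ring_hom h by fact
    show ?thesis by (simp add: weyl_elt_def map_matrix_hom)
  qed
  have "map_matrix (\<lambda>c. [:c:]) (weyl_elt \<alpha>) ** root_elt E \<beta> var_x =
      root_elt E \<gamma> (of_int s * var_x) ** map_matrix (\<lambda>c. [:c:]) (weyl_elt \<alpha>)"
  proof (rule conj_root_elt_eq [where Z = "smult_mat s (E \<gamma>)"])
    show "weyl_elt \<alpha> ** int_matrix (E \<beta>) = smult_mat s (E \<gamma>) ** weyl_elt \<alpha>"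
      using w by (simp add: map_matrix_def)
    show "map_matrix Polynomial.pderiv (root_elt E \<gamma> (of_int s * var_x)) =
        map_matrix (\<lambda>c. [:c:]) (smult_mat s (E \<gamma>)) ** root_elt E \<gamma> (of_int s * var_x)"
      by (simp add: pderiv_root_elt \<gamma> pderiv_mult pderiv_pCons int_matrix_smult)
  qed (simp_all add: \<beta> \<gamma> poly_hom.map_matrix_hom)
  then have "map_matrix (poly_lift of_int y) (weyl_elt \<alpha> ** root_elt E \<beta> var_x) =
      map_matrix (poly_lift of_int y) (root_elt E \<gamma> (of_int s * var_x) ** weyl_elt \<alpha>)"
    by (simp only: w_nat [OF unital_ring_hom_const_poly])
  moreover have "poly_lift of_int y var_x = y" by simp
  ultimately show ?thesis
    by (simp only: l.map_matrix_hom l.map_matrix_root_elt l.hom_mult l.hom_of_int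
      w_nat [OF l.unital_ring_hom_axioms])
qed

text \<open>
  The element \<open>w\<^sub>\<alpha>\<close> maps the lowest vector of a string to the highest one, up to sign. Strings of two and
  of three vectors suffice here, so that these are computations in the representations of \<open>sl\<^sub>2\<close> of
  dimension two and three.
\<close>

lemma weyl_elt_string2:
  assumes \<alpha>: "\<alpha> \<in> \<Phi>"
    and up: "mat_bracket (E \<alpha>) V0 = smult_mat a V1" "mat_bracket (E \<alpha>) V1 = 0"
    and down: "mat_bracket (E (- \<alpha>)) V0 = 0" "mat_bracket (E (- \<alpha>)) V1 = smult_mat c V0"
    and ac: "a * c = 1"
  shows "weyl_elt \<alpha> ** V0 = smult_mat a V1 ** weyl_elt \<alpha>"
proof -
  have id: "map_matrix of_int M = M" for M :: "int^'n^'n" by (simp add: vec_eq_iff)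
  let ?e = "root_elt E \<alpha> (1::int)" and ?f = "root_elt E (- \<alpha>) (- 1::int)"
  note cj = root_elt_conj [where 'r = int, unfolded id]
  have e0: "?e ** V0 = (V0 + smult_mat a V1) ** ?e"
    using cj [OF \<alpha>, of V0 "smult_mat a V1" 0 1] by (simp add: up)
  have e1: "?e ** V1 = V1 ** ?e"
    using cj [OF \<alpha>, of V1 0 0 1] by (simp add: up)
  have f0: "?f ** V0 = V0 ** ?f"
    using cj [OF minus_root [OF \<alpha>], of V0 0 0 "-1"] by (simp add: down)
  have f1: "?f ** V1 = (V1 - smult_mat c V0) ** ?f"
    using cj [OF minus_root [OF \<alpha>], of V1 "smult_mat c V0" 0 "-1"] by (simp add: down)
  have fs: "?f ** (V0 + smult_mat a V1) = smult_mat a V1 ** ?f"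
    by (simp add: matrix_mult_distribs f0 f1 smult_mat_distribs ac)
  have "?e ** (?f ** ?e) ** V0 = ?e ** (?f ** (V0 + smult_mat a V1)) ** ?e"
    by (simp add: matrix_mul_assoc [symmetric] e0)
  also have "\<dots> = smult_mat a V1 ** (?e ** (?f ** ?e))"
    by (simp add: fs matrix_mul_assoc e1)
  finally show ?thesis
    unfolding weyl_elt_def .
qed

lemma weyl_elt_string3:
  assumes \<alpha>: "\<alpha> \<in> \<Phi>"
    and up: "mat_bracket (E \<alpha>) V0 = smult_mat a V1" "mat_bracket (E \<alpha>) V1 = smult_mat b V2"
      "mat_bracket (E \<alpha>) V2 = 0"
    and down: "mat_bracket (E (- \<alpha>)) V0 = 0" "mat_bracket (E (- \<alpha>)) V1 = smult_mat c V0"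
      "mat_bracket (E (- \<alpha>)) V2 = smult_mat d V1"
    and coeffs: "a * c = 2" "b * d = 2" "a * b = 2 * s" "s * s = 1"
  shows "weyl_elt \<alpha> ** V0 = smult_mat s V2 ** weyl_elt \<alpha>"
proof -
  have id: "map_matrix of_int M = M" for M :: "int^'n^'n" by (simp add: vec_eq_iff)
  have sd: "s * d = a" and dc: "d * c = 2 * s"
  proof -
    have "2 * (s * d) = a * (b * d)" using coeffs(3) by (simp add: algebra_simps)
    then show "s * d = a" using coeffs(2) by simp
    then have "d = s * a" using coeffs(4) by (metis mult.assoc mult_1)
    then show "d * c = 2 * s" using coeffs(1) by simp
  qed
  let ?e = "root_elt E \<alpha> (1::int)" and ?f = "root_elt E (- \<alpha>) (- 1::int)"
  note cj = root_elt_conj [where 'r = int, unfolded id]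
  have e0: "?e ** V0 = (V0 + smult_mat a V1 + smult_mat s V2) ** ?e"
    using cj [OF \<alpha>, of V0 "smult_mat a V1" "smult_mat s V2" 1] by (simp add: up coeffs)
  have e2: "?e ** V2 = V2 ** ?e"
    using cj [OF \<alpha>, of V2 0 0 1] by (simp add: up)
  have f0: "?f ** V0 = V0 ** ?f"
    using cj [OF minus_root [OF \<alpha>], of V0 0 0 "-1"] by (simp add: down)
  have f1: "?f ** V1 = (V1 - smult_mat c V0) ** ?f"
    using cj [OF minus_root [OF \<alpha>], of V1 "smult_mat c V0" 0 "-1"] by (simp add: down)
  have f2: "?f ** V2 = (V2 - smult_mat d V1 + smult_mat s V0) ** ?f"
    using cj [OF minus_root [OF \<alpha>], of V2 "smult_mat d V1" "smult_mat s V0" "-1"]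
    by (simp add: down dc)
  have "V0 + smult_mat a (V1 - smult_mat c V0) + smult_mat s (V2 - smult_mat d V1 + smult_mat s V0) = smult_mat s V2"
  proof -
    have "i + a * (j - c * i) + s * (k - d * j + s * i) = s * k" for i j k :: int
    proof -
      have "i + a * (j - c * i) + s * (k - d * j + s * i) = i + a * j - (a * c) * i + s * k - (s * d) * j + (s * s) * i"
        by (simp add: algebra_simps)
      then show ?thesis by (simp add: coeffs sd)
    qed
    then show ?thesis by (simp add: vec_eq_iff)
  qed
  then have fs: "?f ** (V0 + smult_mat a V1 + smult_mat s V2) = smult_mat s V2 ** ?f"
    by (simp only: matrix_mult_distribs(3) smult_mat_mult f0 f1 f2)
      (simp only: matrix_mult_distribs(1) [symmetric] smult_mat_mult [symmetric])
  have "?e ** (?f ** ?e) ** V0 = ?e ** (?f ** (V0 + smult_mat a V1 + smult_mat s V2)) ** ?e"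
    by (simp add: matrix_mul_assoc [symmetric] e0)
  also have "\<dots> = smult_mat s V2 ** (?e ** (?f ** ?e))"
    by (simp add: fs matrix_mul_assoc e2)
  finally show ?thesis
    unfolding weyl_elt_def .
qed

end

section \<open>Subgroups normalized by the root elements\<close>

lemma mat_bracket_flip: "mat_bracket A B = - mat_bracket B A"
  by (simp add: mat_bracket_def)

lemma mat_bracket_jacobi:
  fixes A B C :: "'a::comm_ring_1^'n^'n"
  shows "mat_bracket A (mat_bracket B C) = mat_bracket B (mat_bracket A C) - mat_bracket (mat_bracket B A) C"
  by (simp add: mat_bracket_def matrix_mult_distribs matrix_mul_assoc)

lemma smult_mat_cancel_int:
  fixes A :: "int^'n^'n"
  assumes "smult_mat c A = smult_mat d A" "A \<noteq> 0"
  shows "c = d"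
  using assms by (auto simp: vec_eq_iff)

locale irreducible_chevalley_system = chevalley_system \<Phi> E H + irreducible_root_system_facts \<Phi>
  for \<Phi> :: "'v::euclidean_space set" and E H :: "'v \<Rightarrow> int^'n^'n"
begin

text \<open>
  The relation \<open>[E \<alpha>, E (- \<alpha>)] = H \<alpha>\<close> determines the product of the structure constants for going up and
  down in a string.
\<close>

lemma lower_raise:
  assumes "\<alpha> \<in> \<Phi>" "\<beta> \<in> \<Phi>" "cartan \<beta> \<alpha> = of_int c"
  shows "mat_bracket (E (- \<alpha>)) (mat_bracket (E \<alpha>) (E \<beta>)) =
    mat_bracket (E \<alpha>) (mat_bracket (E (- \<alpha>)) (E \<beta>)) - smult_mat c (E \<beta>)"
  by (subst mat_bracket_jacobi) (simp add: bracket_EE_neg bracket_HE assms)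

text \<open>The string \<open>E (- \<alpha>), H \<alpha>, E \<alpha>\<close> is the adjoint representation of \<open>sl\<^sub>2\<close>.\<close>

lemma weyl_elt_negate:
  assumes "\<alpha> \<in> \<Phi>"
  shows "weyl_elt \<alpha> ** E (- \<alpha>) = smult_mat (-1) (E \<alpha>) ** weyl_elt \<alpha>"
proof (rule weyl_elt_string3 [where ?V1.0 = "H \<alpha>" and a = 1 and b = "-2" and c = 2 and d = "-1"])
  have "mat_bracket (H \<alpha>) (E \<alpha>) = smult_mat 2 (E \<alpha>)" "mat_bracket (H \<alpha>) (E (- \<alpha>)) = smult_mat (- 2) (E (- \<alpha>))"
    using assms minus_root by (auto intro!: bracket_HE simp: cartan_root_self simp del: smult_mat_simps)
  then show "mat_bracket (E \<alpha>) (H \<alpha>) = smult_mat (- 2) (E \<alpha>)"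
    "mat_bracket (E (- \<alpha>)) (H \<alpha>) = smult_mat 2 (E (- \<alpha>))"
    using mat_bracket_flip [of "E \<alpha>" "H \<alpha>"] mat_bracket_flip [of "E (- \<alpha>)" "H \<alpha>"] by simp_all
  show "mat_bracket (E (- \<alpha>)) (E \<alpha>) = smult_mat (- 1) (H \<alpha>)"
    using mat_bracket_flip [of "E (- \<alpha>)" "E \<alpha>"] bracket_EE_neg [OF assms] by simp
qed (simp_all add: assms bracket_EE_neg)

lemma weyl_elt_reflect1:
  assumes \<alpha>: "\<alpha> \<in> \<Phi>" and \<beta>: "\<beta> \<in> \<Phi>" and sum: "\<alpha> + \<beta> \<in> \<Phi>"
    and c: "cartan \<beta> \<alpha> = -1" and nolow: "\<beta> - \<alpha> \<notin> \<Phi>" and nohigh: "\<beta> + 2 *\<^sub>R \<alpha> \<notin> \<Phi>"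
  shows "\<exists>s. s * s = 1 \<and> weyl_elt \<alpha> ** E \<beta> = smult_mat s (E (\<alpha> + \<beta>)) ** weyl_elt \<alpha>"
proof -
  have "\<beta> \<noteq> \<alpha>" using c cartan_root_self [OF \<alpha>] by auto
  then have low: "mat_bracket (E (- \<alpha>)) (E \<beta>) = 0"
    using nolow \<alpha> \<beta> minus_root by (intro bracket_EE_zero) auto
  have eq: "\<alpha> + (\<alpha> + \<beta>) = \<beta> + 2 *\<^sub>R \<alpha>" by (simp add: scaleR_2)
  have "\<beta> + 2 *\<^sub>R \<alpha> \<noteq> 0"
  proof
    assume "\<beta> + 2 *\<^sub>R \<alpha> = 0"
    then have "cartan (\<beta> + 2 *\<^sub>R \<alpha>) \<alpha> = 0" by (simp add: cartan_def)
    then show False using c cartan_root_self [OF \<alpha>] by simp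
  qed
  then have high: "mat_bracket (E \<alpha>) (E (\<alpha> + \<beta>)) = 0"
    using nohigh \<alpha> sum unfolding eq [symmetric] by (intro bracket_EE_zero)
  obtain a where a: "mat_bracket (E \<alpha>) (E \<beta>) = smult_mat a (E (\<alpha> + \<beta>))"
    using bracket_EE [OF \<alpha> \<beta> sum] by blast
  obtain c' where c': "mat_bracket (E (- \<alpha>)) (E (\<alpha> + \<beta>)) = smult_mat c' (E \<beta>)"
    using bracket_EE [OF minus_root [OF \<alpha>] sum] \<beta> by auto
  have "smult_mat (a * c') (E \<beta>) = smult_mat 1 (E \<beta>)"
    using lower_raise [OF \<alpha> \<beta>, of "-1"] c by (simp add: a c' low)
  then have ac: "a * c' = 1"
    using smult_mat_cancel_int E_nonzero [OF \<beta>] by blast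
  then have "a * a = 1"
    by (auto simp: zmult_eq_1_iff)
  then show ?thesis
    using weyl_elt_string2 [OF \<alpha> a high low c' ac] by blast
qed

end

text \<open>
  Without pairs of type \<open>G\<^sub>2\<close>, Cartan integers are at most \<open>2\<close> in absolute value. This bounds the root
  strings, and with them the structure constants.
\<close>

locale no_triple_bond = irreducible_chevalley_system \<Phi> E H
  for \<Phi> :: "'v::euclidean_space set" and E H :: "'v \<Rightarrow> int^'n^'n" +
  assumes no_triple: "\<alpha> \<in> \<Phi> \<Longrightarrow> \<beta> \<in> \<Phi> \<Longrightarrow> cartan \<beta> \<alpha> \<noteq> -3"
begin

lemma cartan_abs_le_2: "\<alpha> \<in> \<Phi> \<Longrightarrow> \<beta> \<in> \<Phi> \<Longrightarrow> \<bar>cartan \<beta> \<alpha>\<bar> \<le> 2"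
proof -
  assume *: "\<alpha> \<in> \<Phi>" "\<beta> \<in> \<Phi>"
  then obtain c :: int where c: "cartan \<beta> \<alpha> = of_int c" using cartan_integer by blast
  have "\<bar>c\<bar> \<le> 3" "c \<noteq> -3" "c \<noteq> 3"
    using cartan_abs_le_3 [OF *] no_triple [OF *] no_triple [OF *(1) minus_root [OF *(2)]] c by auto
  then show ?thesis using c by linarith
qed

lemma not_root_if: "\<alpha> \<in> \<Phi> \<Longrightarrow> 2 < \<bar>cartan \<beta> \<alpha>\<bar> \<Longrightarrow> \<beta> \<notin> \<Phi>"
  using cartan_abs_le_2 by fastforce

lemma root_string_negative:
  assumes "\<alpha> \<in> \<Phi>" "\<beta> \<in> \<Phi>" "cartan \<beta> \<alpha> < 0"
  shows "root_string \<Phi> \<alpha> \<beta> = 0"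
proof -
  obtain c :: int where c: "cartan \<beta> \<alpha> = of_int c" using cartan_integer assms by blast
  then have "c \<le> -1" using assms(3) by simp
  have "p = 0" if "\<beta> - real p *\<^sub>R \<alpha> \<in> \<Phi>" for p
  proof (rule ccontr)
    assume "p \<noteq> 0"
    then have "2 < \<bar>cartan (\<beta> - real p *\<^sub>R \<alpha>) \<alpha>\<bar>"
      using \<open>c \<le> -1\<close> assms(1) c by (simp add: cartan_root_self)
    then show False using not_root_if assms(1) that by blast
  qed
  then have "{p. \<beta> - real p *\<^sub>R \<alpha> \<in> \<Phi>} = {0}"
    using assms(2) by auto
  then show ?thesis by (simp add: root_string_def)
qed

lemma root_string_orthogonal:
  assumes "\<alpha> \<in> \<Phi>" "\<beta> \<in> \<Phi>" "cartan \<beta> \<alpha> = 0" "\<beta> - \<alpha> \<in> \<Phi>"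
  shows "root_string \<Phi> \<alpha> \<beta> = 1"
proof -
  have "p = 0 \<or> p = 1" if "\<beta> - real p *\<^sub>R \<alpha> \<in> \<Phi>" for p
  proof (rule ccontr)
    assume "\<not> (p = 0 \<or> p = 1)"
    then have "2 < \<bar>cartan (\<beta> - real p *\<^sub>R \<alpha>) \<alpha>\<bar>"
      using assms by (simp add: cartan_root_self)
    then show False using not_root_if assms(1) that by blast
  qed
  then have "{p. \<beta> - real p *\<^sub>R \<alpha> \<in> \<Phi>} = {0, 1}"
    using assms(2,4) by auto
  then show ?thesis by (simp add: root_string_def)
qed

end

text \<open>A short root \<open>\<alpha>\<close> and a long root \<open>\<beta>\<close> that generate a subsystem of type \<open>B\<^sub>2\<close>.\<close>

locale B2_pair = no_triple_bond \<Phi> E H for \<Phi> :: "'v::euclidean_space set" and E H :: "'v \<Rightarrow> int^'n^'n" +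
  fixes \<alpha> \<beta> :: 'v
  assumes \<alpha>: "\<alpha> \<in> \<Phi>" and \<beta>: "\<beta> \<in> \<Phi>" and cartan_\<beta>\<alpha>: "cartan \<beta> \<alpha> = -2" and cartan_\<alpha>\<beta>: "cartan \<alpha> \<beta> = -1"
begin

lemma roots: "\<alpha> + \<beta> \<in> \<Phi>" "\<alpha> + (\<alpha> + \<beta>) \<in> \<Phi>"
proof -
  have eq: "\<alpha> + (\<alpha> + \<beta>) = \<beta> + 2 *\<^sub>R \<alpha>" by (simp add: scaleR_2)
  show "\<alpha> + \<beta> \<in> \<Phi>"
    using reflect_root [OF \<beta> \<alpha>] cartan_\<alpha>\<beta> by simp
  show "\<alpha> + (\<alpha> + \<beta>) \<in> \<Phi>"
    unfolding eq using reflect_root [OF \<alpha> \<beta>] cartan_\<beta>\<alpha> by simp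
qed

lemma sums_nonzero: "\<alpha> + (\<alpha> + (\<alpha> + \<beta>)) \<noteq> 0" "\<beta> + (\<alpha> + \<beta>) \<noteq> 0" "\<beta> + (\<alpha> + (\<alpha> + \<beta>)) \<noteq> 0"
    "(\<alpha> + \<beta>) + (\<alpha> + (\<alpha> + \<beta>)) \<noteq> 0"
proof -
  have *: "x \<noteq> 0" if "cartan x \<gamma> \<noteq> 0" for x \<gamma> using that by (auto simp: cartan_def)
  show "\<alpha> + (\<alpha> + (\<alpha> + \<beta>)) \<noteq> 0" "\<beta> + (\<alpha> + \<beta>) \<noteq> 0" "\<beta> + (\<alpha> + (\<alpha> + \<beta>)) \<noteq> 0"
    "(\<alpha> + \<beta>) + (\<alpha> + (\<alpha> + \<beta>)) \<noteq> 0"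
    by (rule * [of _ \<alpha>] * [of _ \<beta>], simp add: cartan_\<beta>\<alpha> cartan_\<alpha>\<beta> cartan_root_self \<alpha> \<beta>)+
qed

lemma brackets_zero:
  "mat_bracket (E \<alpha>) (E (\<alpha> + (\<alpha> + \<beta>))) = 0" "mat_bracket (E \<beta>) (E (\<alpha> + \<beta>)) = 0"
  "mat_bracket (E \<beta>) (E (\<alpha> + (\<alpha> + \<beta>))) = 0" "mat_bracket (E (\<alpha> + \<beta>)) (E (\<alpha> + (\<alpha> + \<beta>))) = 0"
proof -
  have "\<alpha> + (\<alpha> + (\<alpha> + \<beta>)) \<notin> \<Phi>"
    by (rule not_root_if [OF \<alpha>]) (simp add: cartan_\<beta>\<alpha> cartan_root_self \<alpha>)
  moreover have "\<beta> + (\<alpha> + \<beta>) \<notin> \<Phi>"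
    by (rule not_root_if [OF \<beta>]) (simp add: cartan_\<alpha>\<beta> cartan_root_self \<beta>)
  moreover have "\<beta> + (\<alpha> + (\<alpha> + \<beta>)) \<notin> \<Phi>"
  proof -
    have "\<beta> + (\<alpha> + (\<alpha> + \<beta>)) = 2 *\<^sub>R (\<alpha> + \<beta>)" by (simp add: scaleR_2 ac_simps)
    then show ?thesis using root_multiple [OF roots(1), of 2] by auto
  qed
  moreover have "(\<alpha> + \<beta>) + (\<alpha> + (\<alpha> + \<beta>)) \<notin> \<Phi>"
  proof (rule not_root_if [OF roots(2)])
    have "cartan \<alpha> (\<alpha> + (\<alpha> + \<beta>)) = 1 \<and> cartan \<beta> (\<alpha> + (\<alpha> + \<beta>)) = 0"
    proof -
      let ?s = "\<alpha> \<bullet> \<alpha>"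
      have "\<alpha> \<bullet> \<beta> = - ?s" "\<beta> \<bullet> \<alpha> = - ?s" "\<beta> \<bullet> \<beta> = 2 * ?s" "?s > 0"
        using cartan_inner [OF \<alpha>, of \<beta>] cartan_norms [OF \<alpha> \<beta>] cartan_\<beta>\<alpha> cartan_\<alpha>\<beta> root_norm_pos [OF \<alpha>]
        by (simp_all add: inner_commute)
      then show ?thesis by (simp add: cartan_def inner_add_left inner_add_right)
    qed
    then show "2 < \<bar>cartan ((\<alpha> + \<beta>) + (\<alpha> + (\<alpha> + \<beta>))) (\<alpha> + (\<alpha> + \<beta>))\<bar>"
      by simp
  qed
  ultimately show "mat_bracket (E \<alpha>) (E (\<alpha> + (\<alpha> + \<beta>))) = 0" "mat_bracket (E \<beta>) (E (\<alpha> + \<beta>)) = 0"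
    "mat_bracket (E \<beta>) (E (\<alpha> + (\<alpha> + \<beta>))) = 0" "mat_bracket (E (\<alpha> + \<beta>)) (E (\<alpha> + (\<alpha> + \<beta>))) = 0"
    using \<alpha> \<beta> roots sums_nonzero by (simp_all add: bracket_EE_zero)
qed

lemma bracket_long: "\<exists>a. \<bar>a\<bar> = 1 \<and> mat_bracket (E \<alpha>) (E \<beta>) = smult_mat a (E (\<alpha> + \<beta>))"
  using bracket_EE [OF \<alpha> \<beta> roots(1)] root_string_negative [OF \<alpha> \<beta>] cartan_\<beta>\<alpha> by simp

lemma bracket_short: "\<exists>b. \<bar>b\<bar> = 2 \<and> mat_bracket (E \<alpha>) (E (\<alpha> + \<beta>)) = smult_mat b (E (\<alpha> + (\<alpha> + \<beta>)))"
  using bracket_EE [OF \<alpha> roots(1,2)] root_string_orthogonal [OF \<alpha> roots(1)] cartan_\<beta>\<alpha> \<beta>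
  by (simp add: cartan_root_self \<alpha>)

lemma commutator_long:
  "\<exists>a c :: int. \<bar>a\<bar> = 1 \<and> \<bar>c\<bar> = 1 \<and> (\<forall>x y :: 'r::comm_ring_1. root_elt E \<alpha> x ** root_elt E \<beta> y =
    root_elt E \<beta> y ** (root_elt E (\<alpha> + \<beta>) (of_int a * x * y) **
      root_elt E (\<alpha> + (\<alpha> + \<beta>)) (of_int c * x * x * y)) ** root_elt E \<alpha> x)"
proof -
  obtain a b where a: "\<bar>a\<bar> = 1" "mat_bracket (E \<alpha>) (E \<beta>) = smult_mat a (E (\<alpha> + \<beta>))"
    and b: "\<bar>b\<bar> = 2" "mat_bracket (E \<alpha>) (E (\<alpha> + \<beta>)) = smult_mat b (E (\<alpha> + (\<alpha> + \<beta>)))"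
    using bracket_long bracket_short by metis
  have "a \<in> {1, -1}" "b \<in> {2, -2}" using a b by auto
  then obtain c where c: "a * b = 2 * c" "\<bar>c\<bar> = 1"
    by (cases "a * b = 2") (auto intro: that [of 1] that [of "-1"])
  have "root_elt E \<alpha> x ** root_elt E \<beta> y =
    root_elt E \<beta> y ** (root_elt E (\<alpha> + \<beta>) (of_int a * x * y) **
      root_elt E (\<alpha> + (\<alpha> + \<beta>)) (of_int c * x * x * y)) ** root_elt E \<alpha> x" for x y :: 'r
    using commutator_formula [OF \<alpha> \<beta> roots(1,2) \<beta>, of a c 0 x y]
    by (simp add: a b c brackets_zero \<beta> mat_bracket_flip [of "E (\<alpha> + \<beta>)" "E \<beta>"] mat_bracket_flip [of "E (\<alpha> + (\<alpha> + \<beta>))" "E \<beta>"])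
  then show ?thesis using a c by blast
qed

lemma commutator_short:
  "\<exists>b :: int. \<bar>b\<bar> = 2 \<and> (\<forall>x y :: 'r::comm_ring_1. root_elt E \<alpha> x ** root_elt E (\<alpha> + \<beta>) y =
    root_elt E (\<alpha> + \<beta>) y ** root_elt E (\<alpha> + (\<alpha> + \<beta>)) (of_int b * x * y) ** root_elt E \<alpha> x)"
proof -
  obtain b where b: "\<bar>b\<bar> = 2" "mat_bracket (E \<alpha>) (E (\<alpha> + \<beta>)) = smult_mat b (E (\<alpha> + (\<alpha> + \<beta>)))"
    using bracket_short by metis
  have "root_elt E \<alpha> x ** root_elt E (\<alpha> + \<beta>) y =
    root_elt E (\<alpha> + \<beta>) y ** root_elt E (\<alpha> + (\<alpha> + \<beta>)) (of_int b * x * y) ** root_elt E \<alpha> x" for x y :: 'r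
    using commutator_formula [OF \<alpha> roots(1,2,2,2), of b 0 0 x y]
    by (simp add: b brackets_zero roots)
  then show ?thesis using b by blast
qed

lemma weyl_elt_short: "\<exists>s. s * s = 1 \<and> weyl_elt \<alpha> ** E \<beta> = smult_mat s (E (\<alpha> + (\<alpha> + \<beta>))) ** weyl_elt \<alpha>"
proof -
  obtain a b where a: "\<bar>a\<bar> = 1" "mat_bracket (E \<alpha>) (E \<beta>) = smult_mat a (E (\<alpha> + \<beta>))"
    and b: "\<bar>b\<bar> = 2" "mat_bracket (E \<alpha>) (E (\<alpha> + \<beta>)) = smult_mat b (E (\<alpha> + (\<alpha> + \<beta>)))"
    using bracket_long bracket_short by metis
  have "a \<in> {1, -1}" "b \<in> {2, -2}" using a b by auto
  then obtain s where s: "a * b = 2 * s" "s * s = 1"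
    by (cases "a * b = 2") (auto intro: that [of 1] that [of "-1"])
  have "\<beta> - \<alpha> \<notin> \<Phi>"
    by (rule not_root_if [OF \<alpha>]) (simp add: cartan_\<beta>\<alpha> cartan_root_self \<alpha>)
  moreover have "\<beta> \<noteq> \<alpha>" using cartan_\<beta>\<alpha> cartan_root_self [OF \<alpha>] by auto
  ultimately have low: "mat_bracket (E (- \<alpha>)) (E \<beta>) = 0"
    using \<alpha> \<beta> minus_root by (intro bracket_EE_zero) auto
  obtain c where c: "mat_bracket (E (- \<alpha>)) (E (\<alpha> + \<beta>)) = smult_mat c (E \<beta>)"
    using bracket_EE [OF minus_root [OF \<alpha>] roots(1)] \<beta> by auto
  obtain d where d: "mat_bracket (E (- \<alpha>)) (E (\<alpha> + (\<alpha> + \<beta>))) = smult_mat d (E (\<alpha> + \<beta>))"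
    using bracket_EE [OF minus_root [OF \<alpha>] roots(2)] roots(1) by auto
  have "smult_mat (a * c) (E \<beta>) = smult_mat 2 (E \<beta>)"
    using lower_raise [OF \<alpha> \<beta>, of "-2"] by (simp add: a c low cartan_\<beta>\<alpha>)
  then have ac: "a * c = 2"
    using smult_mat_cancel_int E_nonzero [OF \<beta>] by blast
  have "smult_mat (b * d) (E (\<alpha> + \<beta>)) = smult_mat 2 (E (\<alpha> + \<beta>))"
    using lower_raise [OF \<alpha> roots(1), of "0"] ac by (simp add: a b c d cartan_\<beta>\<alpha> cartan_root_self \<alpha> mult.commute)
  then have bd: "b * d = 2"
    using smult_mat_cancel_int E_nonzero [OF roots(1)] by blast
  show ?thesis
    using weyl_elt_string3 [OF \<alpha> a(2) b(2) brackets_zero(1) low c d ac bd s] s(2) by blast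
qed

end

text \<open>
  Normality of \<open>N\<close> is used only for conjugation by root elements. In this form it needs no ambient group.
\<close>

locale root_normalized = irreducible_chevalley_system \<Phi> E H
  for \<Phi> :: "'v::euclidean_space set" and E H :: "'v \<Rightarrow> int^'n^'n" +
  fixes N :: "('r::comm_ring_1^'n^'n) set"
  assumes N_one: "mat 1 \<in> N"
    and N_mult: "A \<in> N \<Longrightarrow> B \<in> N \<Longrightarrow> A ** B \<in> N"
    and N_conj: "\<phi> \<in> \<Phi> \<Longrightarrow> A \<in> N \<Longrightarrow> root_elt E \<phi> x ** A ** root_elt E \<phi> (- x) \<in> N"
    and N_inv: "A \<in> N \<Longrightarrow> A ** B = mat 1 \<Longrightarrow> B \<in> N"
begin

definition full_roots :: "'v set" where
  "full_roots = {\<psi> \<in> \<Phi>. \<forall>x. root_elt E \<psi> x \<in> N}"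

lemma full_rootD: "\<psi> \<in> full_roots \<Longrightarrow> root_elt E \<psi> x \<in> N" "\<psi> \<in> full_roots \<Longrightarrow> \<psi> \<in> \<Phi>"
  by (simp_all add: full_roots_def)

lemma inv_cancel:
  assumes "\<phi> \<in> \<Phi>"
  shows "root_elt E \<phi> x ** (root_elt E \<phi> (- x) ** A) = A" "root_elt E \<phi> (- x) ** (root_elt E \<phi> x ** A) = (A :: 'r^'n^'n)"
  using root_elt_inverse [OF assms, of x] by (simp_all add: matrix_mul_assoc)

lemma N_conj':
  assumes "\<phi> \<in> \<Phi>" "root_elt E \<phi> x ** A ** root_elt E \<phi> (- x) \<in> N"
  shows "A \<in> N"
  using N_conj [OF assms, of "- x"] by (simp add: matrix_mul_assoc [symmetric] inv_cancel root_elt_inverse assms(1))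

lemma root_elt_in_N_minus: "\<phi> \<in> \<Phi> \<Longrightarrow> root_elt E \<phi> x \<in> N \<Longrightarrow> root_elt E \<phi> (- x) \<in> N"
  using N_inv root_elt_inverse by blast

lemma root_elt_in_N_sum:
  assumes "\<phi> \<in> \<Phi>" "finite I" "\<And>i. i \<in> I \<Longrightarrow> root_elt E \<phi> (f i) \<in> N"
  shows "root_elt E \<phi> (sum f I) \<in> N"
  using assms(2,3)
proof (induction I rule: finite_induct)
  case (insert i I)
  then show ?case
    using N_mult [of "root_elt E \<phi> (f i)" "root_elt E \<phi> (sum f I)"] by (simp add: root_elt_add assms(1))
qed (simp add: N_one assms(1))

lemma full_root_if_multiples:
  assumes "\<gamma> \<in> \<Phi>" "finite I" "(\<Sum>i\<in>I. r i) = 1" "\<And>i x. i \<in> I \<Longrightarrow> root_elt E \<gamma> (r i * x) \<in> N"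
  shows "\<gamma> \<in> full_roots"
proof -
  have "root_elt E \<gamma> x \<in> N" for x
  proof -
    have "root_elt E \<gamma> (\<Sum>i\<in>I. r i * x) \<in> N"
      using assms by (intro root_elt_in_N_sum)
    then show ?thesis by (simp add: sum_distrib_right [symmetric] assms(3))
  qed
  then show ?thesis using assms(1) by (simp add: full_roots_def)
qed

text \<open>The commutator \<open>P\<close> is the product of an element of \<open>N\<close> and a conjugate of its inverse.\<close>

lemma commutator_in_N:
  assumes "\<alpha> \<in> \<Phi>" "\<beta> \<in> \<Phi>" and comm: "root_elt E \<alpha> x ** root_elt E \<beta> y = root_elt E \<beta> y ** P ** root_elt E \<alpha> x"
    and N: "root_elt E \<alpha> x \<in> N \<or> root_elt E \<beta> y \<in> N"
  shows "P \<in> N"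
proof -
  have "root_elt E \<beta> (- y) ** (root_elt E \<alpha> x ** root_elt E \<beta> y) ** root_elt E \<alpha> (- x) = P"
    unfolding comm by (simp add: matrix_mul_assoc [symmetric] inv_cancel root_elt_inverse assms)
  moreover have "root_elt E \<beta> (- y) ** (root_elt E \<alpha> x ** root_elt E \<beta> y) ** root_elt E \<alpha> (- x) \<in> N"
    using N
  proof
    assume *: "root_elt E \<alpha> x \<in> N"
    then have "(root_elt E \<beta> (- y) ** root_elt E \<alpha> x ** root_elt E \<beta> (- (- y))) ** root_elt E \<alpha> (- x) \<in> N"
      using assms by (intro N_mult N_conj root_elt_in_N_minus)
    then show ?thesis by (simp add: matrix_mul_assoc)
  next
    assume *: "root_elt E \<beta> y \<in> N"
    then have "root_elt E \<beta> (- y) ** (root_elt E \<alpha> x ** root_elt E \<beta> y ** root_elt E \<alpha> (- x)) \<in> N"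
      using assms by (intro N_mult N_conj root_elt_in_N_minus)
    then show ?thesis by (simp add: matrix_mul_assoc)
  qed
  ultimately show ?thesis by simp
qed

definition weyl_inv :: "'v \<Rightarrow> 'r^'n^'n" where
  "weyl_inv \<alpha> = root_elt E \<alpha> (- 1) ** (root_elt E (- \<alpha>) 1 ** root_elt E \<alpha> (- 1))"

lemma weyl_elt_inv:
  assumes "\<alpha> \<in> \<Phi>"
  shows "weyl_elt \<alpha> ** weyl_inv \<alpha> = mat 1"
proof -
  have *: "root_elt E (- \<alpha>) (- 1) ** (root_elt E (- \<alpha>) 1 ** A) = A" for A :: "'r^'n^'n"
    using inv_cancel(2) [of "- \<alpha>" 1 A] minus_root assms by simp
  show ?thesis
    unfolding weyl_elt_def weyl_inv_def
    by (simp add: matrix_mul_assoc [symmetric] inv_cancel * root_elt_inverse assms minus_root)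
qed

lemma weyl_conj_N:
  assumes "\<alpha> \<in> \<Phi>" "A \<in> N" "weyl_elt \<alpha> ** A = B ** weyl_elt \<alpha>"
  shows "B \<in> N"
proof -
  have "root_elt E \<alpha> 1 ** (root_elt E (- \<alpha>) (- 1) ** (root_elt E \<alpha> 1 ** A ** root_elt E \<alpha> (- 1)) **
      root_elt E (- \<alpha>) (- (- 1))) ** root_elt E \<alpha> (- 1) \<in> N"
    using assms minus_root by (intro N_conj)
  also have "root_elt E \<alpha> 1 ** (root_elt E (- \<alpha>) (- 1) ** (root_elt E \<alpha> 1 ** A ** root_elt E \<alpha> (- 1)) **
      root_elt E (- \<alpha>) (- (- 1))) ** root_elt E \<alpha> (- 1) = weyl_elt \<alpha> ** A ** weyl_inv \<alpha>"
    by (simp add: weyl_elt_def weyl_inv_def matrix_mul_assoc)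
  also have "\<dots> = B"
    by (simp add: assms(3) weyl_elt_inv assms(1) matrix_mul_assoc [symmetric])
  finally show ?thesis .
qed

lemma full_root_weyl:
  assumes \<alpha>: "\<alpha> \<in> \<Phi>" and \<beta>: "\<beta> \<in> full_roots" and \<gamma>: "\<gamma> \<in> \<Phi>"
    and s: "s * s = 1" and w: "weyl_elt \<alpha> ** E \<beta> = smult_mat s (E \<gamma>) ** weyl_elt \<alpha>"
  shows "\<gamma> \<in> full_roots"
proof -
  have "root_elt E \<gamma> x \<in> N" for x
  proof -
    have "root_elt E \<beta> (of_int s * x) \<in> N"
      using \<beta> by (rule full_rootD)
    moreover have "of_int s * (of_int s * x) = x"
      using s by (metis mult.assoc mult_1 of_int_1 of_int_mult)
    then have "weyl_elt \<alpha> ** root_elt E \<beta> (of_int s * x) = root_elt E \<gamma> x ** weyl_elt \<alpha>"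
      using weyl_elt_root_elt [OF \<alpha> full_rootD(2) [OF \<beta>] \<gamma> w, of "of_int s * x"] by simp
    ultimately show ?thesis
      using weyl_conj_N [OF \<alpha>] by blast
  qed
  then show ?thesis using \<gamma> by (simp add: full_roots_def)
qed

lemma full_root_minus:
  assumes "\<beta> \<in> full_roots"
  shows "- \<beta> \<in> full_roots"
proof (rule full_root_weyl [where \<alpha> = "- \<beta>" and \<beta> = \<beta> and s = "-1"])
  show "weyl_elt (- \<beta>) ** E \<beta> = smult_mat (- 1) (E (- \<beta>)) ** weyl_elt (- \<beta>)"
    using weyl_elt_negate [of "- \<beta>"] minus_root full_rootD(2) [OF assms] by simp
qed (use assms full_rootD minus_root in auto)

lemma full_root_reflect1:
  assumes "\<alpha> \<in> \<Phi>" "\<beta> \<in> full_roots" "\<alpha> + \<beta> \<in> \<Phi>" "cartan \<beta> \<alpha> = -1" "\<beta> - \<alpha> \<notin> \<Phi>" "\<beta> + 2 *\<^sub>R \<alpha> \<notin> \<Phi>"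
  shows "\<alpha> + \<beta> \<in> full_roots"
  using weyl_elt_reflect1 [OF assms(1) full_rootD(2) [OF assms(2)] assms(3-6)] full_root_weyl assms by metis

text \<open>In type \<open>A\<^sub>2\<close>, one commutator with \<open>\<epsilon>\<^sub>\<alpha>(r)\<close> yields the root elements of \<open>\<alpha> + \<beta>\<close> for all of \<open>rR\<close>.\<close>

lemma A2_multiples:
  assumes \<alpha>: "\<alpha> \<in> \<Phi>" and \<beta>: "\<beta> \<in> \<Phi>" and sum: "\<alpha> + \<beta> \<in> \<Phi>" and c: "cartan \<beta> \<alpha> = -1" "cartan \<alpha> \<beta> = -1"
    and nolow: "\<beta> - \<alpha> \<notin> \<Phi>" and nohigh: "\<beta> + 2 *\<^sub>R \<alpha> \<notin> \<Phi>" "\<alpha> + 2 *\<^sub>R \<beta> \<notin> \<Phi>"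
    and r: "root_elt E \<alpha> r \<in> N"
  shows "root_elt E (\<alpha> + \<beta>) (r * x) \<in> N"
proof -
  obtain a where a: "mat_bracket (E \<alpha>) (E \<beta>) = smult_mat a (E (\<alpha> + \<beta>))" "\<bar>a\<bar> = int (root_string \<Phi> \<alpha> \<beta>) + 1"
    using bracket_EE [OF \<alpha> \<beta> sum] by metis
  have "p = 0" if "\<beta> - real p *\<^sub>R \<alpha> \<in> \<Phi>" for p
  proof (rule ccontr)
    assume "p \<noteq> 0"
    have "\<bar>cartan (\<beta> - real p *\<^sub>R \<alpha>) \<alpha>\<bar> \<le> 3"
      using cartan_abs_le_3 \<alpha> that by blast
    then have "p \<le> 1" using c(1) \<alpha> by (simp add: cartan_root_self)
    then have "p = 1" using \<open>p \<noteq> 0\<close> by simp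
    then show False using that nolow by simp
  qed
  then have "{p. \<beta> - real p *\<^sub>R \<alpha> \<in> \<Phi>} = {0}"
    using \<beta> by auto
  then have "\<bar>a\<bar> = 1"
    using a(2) by (simp add: root_string_def)
  then have aa: "a * a = 1" by (auto simp: abs_if split: if_splits)
  have eq: "\<alpha> + (\<alpha> + \<beta>) = \<beta> + 2 *\<^sub>R \<alpha>" "\<beta> + (\<alpha> + \<beta>) = \<alpha> + 2 *\<^sub>R \<beta>"
    by (simp_all add: scaleR_2)
  have nz: "v \<noteq> 0" if "cartan v \<gamma> \<noteq> 0" for v \<gamma> using that by (auto simp: cartan_def)
  have "\<alpha> + (\<alpha> + \<beta>) \<noteq> 0"
    by (rule nz [of _ \<alpha>]) (simp add: c cartan_root_self \<alpha>)
  moreover have "\<beta> + (\<alpha> + \<beta>) \<noteq> 0"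
    by (rule nz [of _ \<beta>]) (simp add: c cartan_root_self \<beta>)
  ultimately have zero: "mat_bracket (E \<alpha>) (E (\<alpha> + \<beta>)) = 0" "mat_bracket (E \<beta>) (E (\<alpha> + \<beta>)) = 0"
    using \<alpha> \<beta> sum nohigh unfolding eq [symmetric] by (auto intro: bracket_EE_zero)
  have "root_elt E \<alpha> r ** root_elt E \<beta> y = root_elt E \<beta> y ** root_elt E (\<alpha> + \<beta>) (of_int a * r * y) ** root_elt E \<alpha> r" for y
    using commutator_formula [OF \<alpha> \<beta> sum sum sum, of a 0 0 r y] by (simp add: a zero sum)
  then have "root_elt E (\<alpha> + \<beta>) (of_int a * r * y) \<in> N" for y
    using commutator_in_N \<alpha> \<beta> r by blast
  from this [of "of_int a * x"] show ?thesis
    using aa by (simp add: mult_ac) (metis mult.assoc mult.right_neutral of_int_1 of_int_mult)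
qed

end

locale root_normalized_no_triple = root_normalized \<Phi> E H N + no_triple_bond \<Phi> E H
  for \<Phi> :: "'v::euclidean_space set" and E H :: "'v \<Rightarrow> int^'n^'n" and N :: "('r::comm_ring_1^'n^'n) set"
begin

lemma full_root_reflect:
  assumes \<alpha>: "\<alpha> \<in> \<Phi>" and \<beta>: "\<beta> \<in> full_roots"
  shows "\<beta> - cartan \<beta> \<alpha> *\<^sub>R \<alpha> \<in> full_roots"
proof -
  have neg: "\<beta> - cartan \<beta> \<alpha> *\<^sub>R \<alpha> \<in> full_roots" if \<beta>: "\<beta> \<in> full_roots" and lt: "\<beta> \<bullet> \<alpha> < 0" for \<beta>
  proof (cases "\<beta> = - \<alpha>")
    case True
    then show ?thesis using full_root_minus [OF \<beta>] by (simp add: cartan_root_self \<alpha> scaleR_2)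
  next
    case False
    note \<beta>' = full_rootD(2) [OF \<beta>]
    have pair: "(cartan \<beta> \<alpha>, cartan \<alpha> \<beta>) \<in> {(-1,-1), (-1,-2), (-2,-1), (-1,-3), (-3,-1)}"
      by (rule cartan_pair_cases) (use \<alpha> \<beta>' False lt in auto)
    then consider "cartan \<beta> \<alpha> = -1" | "cartan \<beta> \<alpha> = -2" "cartan \<alpha> \<beta> = -1"
      using no_triple [OF \<alpha> \<beta>'] by auto
    then show ?thesis
    proof cases
      case 1
      have "\<beta> - \<alpha> \<notin> \<Phi>" "\<beta> + 2 *\<^sub>R \<alpha> \<notin> \<Phi>"
        by (rule not_root_if [OF \<alpha>], simp add: 1 cartan_root_self \<alpha>)+
      moreover have "\<alpha> + \<beta> \<in> \<Phi>"
        using reflect_root [OF \<alpha> \<beta>'] 1 by (simp add: add.commute)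
      ultimately have "\<alpha> + \<beta> \<in> full_roots"
        using full_root_reflect1 \<alpha> \<beta> 1 by blast
      then show ?thesis using 1 by (simp add: add.commute)
    next
      case 2
      note full = \<beta>
      interpret B2_pair \<Phi> E H \<alpha> \<beta>
        by unfold_locales (use \<alpha> \<beta>' 2 in auto)
      have "\<alpha> + (\<alpha> + \<beta>) \<in> full_roots"
        using weyl_elt_short full_root_weyl [OF \<alpha> full roots(2)] by blast
      moreover have "\<alpha> + (\<alpha> + \<beta>) = \<beta> - cartan \<beta> \<alpha> *\<^sub>R \<alpha>"
        unfolding 2 by (simp add: scaleR_2)
      ultimately show ?thesis by simp
    qed
  qed
  consider "\<beta> \<bullet> \<alpha> < 0" | "\<beta> \<bullet> \<alpha> = 0" | "- \<beta> \<bullet> \<alpha> < 0" by fastforce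
  then show ?thesis
  proof cases
    case 2
    then show ?thesis using \<beta> cartan_eq_0_iff [OF \<alpha>, of \<beta>] by simp
  next
    case 3
    then show ?thesis using full_root_minus [OF neg [OF full_root_minus [OF \<beta>]]] by simp
  qed (rule neg [OF \<beta>])
qed

text \<open>In type \<open>B\<^sub>2\<close>, the commutator formula links the two root lengths.\<close>

lemma full_root_B2:
  assumes \<alpha>: "\<alpha> \<in> \<Phi>" and \<beta>: "\<beta> \<in> \<Phi>" and c: "cartan \<beta> \<alpha> = -2" "cartan \<alpha> \<beta> = -1"
  shows "\<alpha> \<in> full_roots \<longleftrightarrow> \<beta> \<in> full_roots"
proof -
  interpret B2_pair \<Phi> E H \<alpha> \<beta>
    by unfold_locales (use assms in auto)
  obtain a d :: int where ad: "\<bar>a\<bar> = 1" "\<bar>d\<bar> = 1" and comm: "\<And>x y :: 'r. root_elt E \<alpha> x ** root_elt E \<beta> y =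
    root_elt E \<beta> y ** (root_elt E (\<alpha> + \<beta>) (of_int a * x * y) **
      root_elt E (\<alpha> + (\<alpha> + \<beta>)) (of_int d * x * x * y)) ** root_elt E \<alpha> x"
    using commutator_long [where 'r = 'r] by blast
  have sq: "of_int a * (of_int a * z) = z" "of_int d * (of_int d * z) = z" for z :: 'r
    using ad by (auto simp: abs_if split: if_splits)
  have ab_iff: "\<alpha> + \<beta> \<in> full_roots \<longleftrightarrow> \<alpha> \<in> full_roots"
  proof
    have "(\<alpha> + \<beta>) - cartan (\<alpha> + \<beta>) \<beta> *\<^sub>R \<beta> = \<alpha>" "\<alpha> - cartan \<alpha> \<beta> *\<^sub>R \<beta> = \<alpha> + \<beta>"
      by (simp_all add: c cartan_root_self \<beta>)
    then show "\<alpha> + \<beta> \<in> full_roots \<Longrightarrow> \<alpha> \<in> full_roots" "\<alpha> \<in> full_roots \<Longrightarrow> \<alpha> + \<beta> \<in> full_roots"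
      using full_root_reflect [OF \<beta>] by metis+
  qed
  have aab_iff: "\<alpha> + (\<alpha> + \<beta>) \<in> full_roots \<longleftrightarrow> \<beta> \<in> full_roots"
  proof
    have "(\<alpha> + (\<alpha> + \<beta>)) - cartan (\<alpha> + (\<alpha> + \<beta>)) \<alpha> *\<^sub>R \<alpha> = \<beta>" "\<beta> - cartan \<beta> \<alpha> *\<^sub>R \<alpha> = \<alpha> + (\<alpha> + \<beta>)"
      by (simp_all add: c cartan_root_self \<alpha> scaleR_2)
    then show "\<alpha> + (\<alpha> + \<beta>) \<in> full_roots \<Longrightarrow> \<beta> \<in> full_roots" "\<beta> \<in> full_roots \<Longrightarrow> \<alpha> + (\<alpha> + \<beta>) \<in> full_roots"
      using full_root_reflect [OF \<alpha>] by metis+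
  qed
  show ?thesis
  proof
    assume full: "\<alpha> \<in> full_roots"
    \<comment> \<open>Put \<open>x = 1\<close> in the commutator formula; its factor for \<open>\<alpha> + \<beta>\<close> lies in \<open>N\<close> already.\<close>
    have "root_elt E (\<alpha> + (\<alpha> + \<beta>)) x \<in> N" for x
    proof -
      define u where "u = of_int a * (of_int d * x)"
      have "root_elt E (\<alpha> + \<beta>) u ** root_elt E (\<alpha> + (\<alpha> + \<beta>)) x \<in> N"
        using commutator_in_N [OF \<alpha> \<beta> comm [of 1 "of_int d * x"]] full_rootD(1) [OF full]
        by (simp add: u_def sq)
      moreover have "root_elt E (\<alpha> + \<beta>) (- u) \<in> N"
        using full ab_iff full_rootD(1) by blast
      ultimately have "root_elt E (\<alpha> + \<beta>) (- u) ** (root_elt E (\<alpha> + \<beta>) u ** root_elt E (\<alpha> + (\<alpha> + \<beta>)) x) \<in> N"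
        using N_mult by blast
      then show ?thesis by (simp only: inv_cancel(2) [OF roots(1)])
    qed
    then show "\<beta> \<in> full_roots"
      using aab_iff roots by (simp add: full_roots_def)
  next
    assume full: "\<beta> \<in> full_roots"
    have "root_elt E (\<alpha> + \<beta>) x \<in> N" for x
    proof -
      define u where "u = of_int d * (of_int a * x)"
      have "root_elt E (\<alpha> + \<beta>) x ** root_elt E (\<alpha> + (\<alpha> + \<beta>)) u \<in> N"
        using commutator_in_N [OF \<alpha> \<beta> comm [of 1 "of_int a * x"]] full_rootD(1) [OF full]
        by (simp add: u_def sq)
      moreover have "root_elt E (\<alpha> + (\<alpha> + \<beta>)) (- u) \<in> N"
        using full aab_iff full_rootD(1) by blast
      ultimately have "root_elt E (\<alpha> + \<beta>) x ** root_elt E (\<alpha> + (\<alpha> + \<beta>)) u ** root_elt E (\<alpha> + (\<alpha> + \<beta>)) (- u) \<in> N"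
        using N_mult by blast
      then show ?thesis by (simp only: matrix_mul_assoc [symmetric] root_elt_inverse [OF roots(2)] matrix_mul_rid)
    qed
    then show "\<alpha> \<in> full_roots"
      using ab_iff roots by (simp add: full_roots_def)
  qed
qed

text \<open>
  Up to sign, two nonorthogonal roots are exchanged by reflections if they have the same length, and
  otherwise form a pair of type \<open>B\<^sub>2\<close>. So the full roots exhaust an irreducible system.
\<close>

lemma full_roots_eq:
  assumes "full_roots \<noteq> {}"
  shows "full_roots = \<Phi>"
proof (rule irreducible_closed_eq)
  have neg: "\<xi> \<in> full_roots" if \<psi>: "\<psi> \<in> full_roots" and \<xi>: "\<xi> \<in> \<Phi>" and lt: "\<psi> \<bullet> \<xi> < 0" for \<psi> \<xi>
  proof (cases "\<psi> = - \<xi>")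
    case True
    then show ?thesis using full_root_minus [OF \<psi>] by simp
  next
    case False
    note \<psi>' = full_rootD(2) [OF \<psi>]
    have pair: "(cartan \<psi> \<xi>, cartan \<xi> \<psi>) \<in> {(-1,-1), (-1,-2), (-2,-1), (-1,-3), (-3,-1)}"
      by (rule cartan_pair_cases) (use \<xi> \<psi>' False lt in auto)
    then consider "cartan \<psi> \<xi> = -1" "cartan \<xi> \<psi> = -1" | "cartan \<psi> \<xi> = -1" "cartan \<xi> \<psi> = -2"
      | "cartan \<psi> \<xi> = -2" "cartan \<xi> \<psi> = -1"
      using no_triple [OF \<xi> \<psi>'] no_triple [OF \<psi>' \<xi>] by auto
    then show ?thesis
    proof cases
      case 1
      have "\<psi> + \<xi> \<in> full_roots"
        using full_root_reflect [OF \<xi> \<psi>] 1 by simp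
      from full_root_reflect [OF \<psi>' this] show ?thesis
        using 1 by (simp add: cartan_root_self \<psi>')
    next
      case 2
      then show ?thesis using full_root_B2 [OF \<psi>' \<xi>] \<psi> by simp
    next
      case 3
      then show ?thesis using full_root_B2 [OF \<xi> \<psi>'] \<psi> by simp
    qed
  qed
  fix \<psi> \<xi> assume \<psi>: "\<psi> \<in> full_roots" and \<xi>: "\<xi> \<in> \<Phi>" and "\<psi> \<bullet> \<xi> \<noteq> 0"
  then consider "\<psi> \<bullet> \<xi> < 0" | "(- \<psi>) \<bullet> \<xi> < 0" by fastforce
  then show "\<xi> \<in> full_roots"
    using neg [OF \<psi> \<xi>] neg [OF full_root_minus [OF \<psi>] \<xi>] by cases auto
qed (use assms full_rootD in auto)

end

locale root_normalized_G2 = root_normalized \<Phi> E H N + G2_pair \<Phi> \<alpha> \<beta>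
  for \<Phi> :: "'v::euclidean_space set" and E H :: "'v \<Rightarrow> int^'n^'n" and N :: "('r::comm_ring_1^'n^'n) set"
    and \<alpha> \<beta> :: 'v
begin

lemma cartan_root_of_31: "cartan (root_of i j) (root_of 3 1) = of_int (i - j)"
proof -
  let ?s = "\<alpha> \<bullet> \<alpha>"
  have *: "root_of i j \<bullet> root_of 3 1 = 3 / 2 * of_int (i - j) * ?s" "root_of 3 1 \<bullet> root_of 3 1 = 3 * ?s"
    unfolding root_of_def using inner_\<alpha>\<beta> norm_\<beta>
    by (simp_all add: inner_add_left inner_add_right algebra_simps)
  show ?thesis
    unfolding cartan_def * using root_norm_pos [OF \<alpha>] by (simp add: field_simps)
qed

lemma scaleR_2_root_of: "2 *\<^sub>R root_of i j = root_of (2 * i) (2 * j)"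
  by (simp add: root_of_def scaleR_add_right)

lemma diff_root_of: "root_of i j - root_of i' j' = root_of (i - i') (j - j')"
  by (simp add: root_of_def algebra_simps)

lemma full_root_reflect_root_of:
  assumes full: "root_of i j \<in> full_roots" and "(i', j') \<in> G2_coords" "(i' + i, j' + j) \<in> G2_coords"
    "(i - i', j - j') \<notin> G2_coords" "(i + 2 * i', j + 2 * j') \<notin> G2_coords"
    "cartan (root_of i j) (root_of i' j') = -1"
  shows "root_of (i' + i) (j' + j) \<in> full_roots"
  using full_root_reflect1 [of "root_of i' j'" "root_of i j"] assms
  by (simp add: root_of_iff root_of_add diff_root_of scaleR_2_root_of)

lemma full_root_minus_root_of: "root_of i j \<in> full_roots \<Longrightarrow> root_of (- i) (- j) \<in> full_roots"
  using full_root_minus by (simp add: root_of_minus [symmetric])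

lemma cartan_root_of_m31: "cartan (root_of i j) (root_of (- 3) (- 1)) = of_int (j - i)"
  using cartan_root_of_31 [of i j] by (simp add: root_of_minus [symmetric])

lemma cartan_root_of_m01: "cartan (root_of i j) (root_of 0 (- 1)) = of_int (i - 2 * j)"
proof -
  have "root_of 0 (- 1) = - \<beta>" by (simp add: root_of_def)
  then show ?thesis by (simp add: cartan_root_of)
qed

text \<open>The long roots form a system of type \<open>A\<^sub>2\<close>.\<close>

lemma full_long_roots:
  assumes "root_of 3 2 \<in> full_roots"
  shows "root_of 3 1 \<in> full_roots" "root_of 0 1 \<in> full_roots"
proof -
  show "root_of 3 1 \<in> full_roots"
    using full_root_reflect_root_of [OF assms, of 0 "-1"] by (simp add: G2_coords_def cartan_root_of_m01)
  show "root_of 0 1 \<in> full_roots"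
    using full_root_reflect_root_of [OF assms, of "-3" "-1"] by (simp add: G2_coords_def cartan_root_of_m31)
qed

text \<open>
  If \<open>N\<close> contains all long root elements, it contains \<open>w\<^sub>\<beta>\<close>, so that modulo \<open>N\<close> the root elements of
  \<open>\<alpha>\<close> and of \<open>\<alpha> + \<beta>\<close> coincide up to sign and therefore commute. Up to long roots, their commutator
  is \<open>\<epsilon>\<close> of \<open>2\<alpha> + \<beta>\<close> at \<open>2xy\<close>, up to sign.
\<close>

lemma full_short_root:
  assumes long: "root_of 3 2 \<in> full_roots" and two: "(2::'r) dvd 1"
  shows "root_of 2 1 \<in> full_roots"
proof -
  have roots: "root_of 1 0 \<in> \<Phi>" "root_of 1 1 \<in> \<Phi>" "root_of 2 1 \<in> \<Phi>" "root_of 3 1 \<in> \<Phi>" "root_of 3 2 \<in> \<Phi>"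
      "root_of 0 1 \<in> \<Phi>" "root_of 0 (- 1) \<in> \<Phi>"
    by (simp_all add: root_of_iff G2_coords_def)
  have zero: "mat_bracket (E (root_of i j)) (E (root_of i' j')) = 0"
    if "(i, j) \<in> G2_coords" "(i', j') \<in> G2_coords" "(i + i', j + j') \<notin> G2_coords" "(i + i', j + j') \<noteq> (0, 0)" for i j i' j'
  proof -
    have "root_of (i + i') (j + j') \<noteq> 0"
      using root_of_eq_iff [of "i + i'" "j + j'" 0 0] that by (auto simp: root_of_def)
    then show ?thesis
      using that by (intro bracket_EE_zero) (simp_all add: root_of_iff root_of_add)
  qed
  have nonzero: "\<exists>c. mat_bracket (E (root_of i j)) (E (root_of i' j')) = smult_mat c (E (root_of (i + i') (j + j'))) \<and>
      \<bar>c\<bar> = int (root_string \<Phi> (root_of i j) (root_of i' j')) + 1"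
    if "(i, j) \<in> G2_coords" "(i', j') \<in> G2_coords" "(i + i', j + j') \<in> G2_coords" for i j i' j'
    using bracket_EE [of "root_of i j" "root_of i' j'"] that by (auto simp: root_of_iff root_of_add)
  have "{p. root_of 1 1 - real p *\<^sub>R root_of 1 0 \<in> \<Phi>} = {0, 1}"
  proof -
    have "root_of 1 1 - real p *\<^sub>R root_of 1 0 = root_of (1 - int p) 1" for p
      by (simp add: root_of_def algebra_simps)
    then show ?thesis by (auto simp: root_of_iff G2_coords_def)
  qed
  then have "root_string \<Phi> (root_of 1 0) (root_of 1 1) = 1"
    by (simp add: root_string_def)
  then obtain c1 where c1: "mat_bracket (E (root_of 1 0)) (E (root_of 1 1)) = smult_mat c1 (E (root_of 2 1))" "\<bar>c1\<bar> = 2"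
    using nonzero [of 1 0 1 1] by (auto simp: G2_coords_def)
  obtain b where b: "mat_bracket (E (root_of 1 0)) (E (root_of 2 1)) = smult_mat b (E (root_of 3 1))"
    using nonzero [of 1 0 2 1] by (auto simp: G2_coords_def)
  obtain e where e: "mat_bracket (E (root_of 1 1)) (E (root_of 2 1)) = smult_mat e (E (root_of 3 2))"
    using nonzero [of 1 1 2 1] by (auto simp: G2_coords_def)
  obtain t where t: "c1 = 2 * t" "t * t = 1"
    using c1(2) by (cases "c1 = 2") (auto intro: that [of 1] that [of "-1"])
  have comm: "root_elt E (root_of 1 0) x ** root_elt E (root_of 1 1) y = root_elt E (root_of 1 1) y **
     (root_elt E (root_of 2 1) (of_int c1 * x * y) ** (root_elt E (root_of 3 1) (of_int (t * b) * x * x * y) **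
      root_elt E (root_of 3 2) (of_int (- (t * e)) * x * y * y))) ** root_elt E (root_of 1 0) x" for x y :: 'r
  proof (rule commutator_formula)
    show "mat_bracket (E (root_of 1 0)) (E (root_of 1 1)) = smult_mat c1 (E (root_of 2 1))" by (rule c1)
    show "smult_mat c1 (mat_bracket (E (root_of 1 0)) (E (root_of 2 1))) = smult_mat (2 * (t * b)) (E (root_of 3 1))"
      by (simp add: b t mult_ac)
    show "smult_mat c1 (mat_bracket (E (root_of 1 1)) (E (root_of 2 1))) = smult_mat (- (2 * - (t * e))) (E (root_of 3 2))"
      by (simp add: e t mult_ac)
  qed (simp_all add: roots zero G2_coords_def)
  obtain s where s: "s * s = 1" and w: "weyl_elt \<beta> ** E \<alpha> = smult_mat s (E (root_of 1 1)) ** weyl_elt \<beta>"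
  proof -
    have "\<beta> + \<alpha> = root_of 1 1" "\<alpha> - \<beta> = root_of 1 (- 1)" "\<alpha> + 2 *\<^sub>R \<beta> = root_of 1 2"
      by (simp_all add: root_of_def)
    moreover have "root_of 1 1 \<in> \<Phi>" "root_of 1 (- 1) \<notin> \<Phi>" "root_of 1 2 \<notin> \<Phi>"
      by (simp_all add: root_of_iff G2_coords_def)
    ultimately show ?thesis
      using weyl_elt_reflect1 [OF \<beta> \<alpha>] cartan_\<alpha>\<beta> that by metis
  qed
  have \<beta>_full: "\<beta> \<in> full_roots" "- \<beta> \<in> full_roots"
    using full_long_roots(2) [OF long] full_root_minus by (simp_all add: root_of_simple)
  have wN: "weyl_elt \<beta> \<in> N"
    unfolding weyl_elt_def using \<beta>_full by (intro N_mult full_rootD(1))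
  then have winvN: "weyl_inv \<beta> \<in> N"
    using N_inv weyl_elt_inv [OF \<beta>] by blast
  have congr: "root_elt E (root_of 1 1) (of_int s * y) ** root_elt E \<alpha> (- y) \<in> N" for y
  proof -
    have "root_elt E (root_of 1 1) (of_int s * y) = root_elt E (root_of 1 1) (of_int s * y) ** weyl_elt \<beta> ** weyl_inv \<beta>"
      by (simp add: weyl_elt_inv \<beta> matrix_mul_assoc [symmetric])
    also have "\<dots> = weyl_elt \<beta> ** root_elt E \<alpha> y ** weyl_inv \<beta>"
      by (simp only: weyl_elt_root_elt [OF \<beta> \<alpha> roots(2) w])
    finally have "root_elt E (root_of 1 1) (of_int s * y) ** root_elt E \<alpha> (- y) =
        weyl_elt \<beta> ** (root_elt E \<alpha> y ** weyl_inv \<beta> ** root_elt E \<alpha> (- y))"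
      by (simp add: matrix_mul_assoc)
    also have "\<dots> \<in> N"
      using wN winvN \<alpha> by (intro N_mult N_conj)
    finally show ?thesis .
  qed
  have "root_elt E (root_of 2 1) (of_int c1 * x * z) \<in> N" for x z :: 'r
  proof -
    define y where "y = of_int s * z"
    have z: "z = of_int s * y"
      using s by (simp add: y_def) (metis mult.assoc mult_1 of_int_1 of_int_mult)
    define P where "P = root_elt E (root_of 2 1) (of_int c1 * x * z) **
      (root_elt E (root_of 3 1) (of_int (t * b) * x * x * z) ** root_elt E (root_of 3 2) (of_int (- (t * e)) * x * z * z))"
    define n where "n = root_elt E (root_of 1 1) z ** root_elt E \<alpha> (- y)"
    have n: "n \<in> N" unfolding n_def z by (rule congr)
    have "root_elt E \<alpha> y ** root_elt E (root_of 1 1) (- z) \<in> N"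
    proof (rule N_inv [OF n])
      show "n ** (root_elt E \<alpha> y ** root_elt E (root_of 1 1) (- z)) = mat 1"
        unfolding n_def by (simp add: matrix_mul_assoc [symmetric] inv_cancel \<alpha> root_elt_inverse roots)
    qed
    then have "(root_elt E \<alpha> x ** n ** root_elt E \<alpha> (- x)) ** (root_elt E \<alpha> y ** root_elt E (root_of 1 1) (- z)) \<in> N"
      by (rule N_mult [OF N_conj [OF \<alpha> n]])
    also have "(root_elt E \<alpha> x ** n ** root_elt E \<alpha> (- x)) ** (root_elt E \<alpha> y ** root_elt E (root_of 1 1) (- z)) =
        root_elt E (root_of 1 1) z ** P ** root_elt E (root_of 1 1) (- z)"
    proof -
      have com\<alpha>: "root_elt E \<alpha> (- y) ** (root_elt E \<alpha> (- x) ** (root_elt E \<alpha> y ** A)) = root_elt E \<alpha> (- x) ** A"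
        for A :: "'r^'n^'n"
        by (simp add: matrix_mul_assoc root_elt_add \<alpha>)
      have push: "root_elt E \<alpha> x ** (root_elt E (root_of 1 1) z ** A) =
          root_elt E (root_of 1 1) z ** (P ** (root_elt E \<alpha> x ** A))" for A :: "'r^'n^'n"
        using comm [of x z] by (simp add: P_def root_of_simple matrix_mul_assoc)
      show ?thesis
        unfolding n_def by (simp add: matrix_mul_assoc [symmetric] com\<alpha> inv_cancel \<alpha> push)
    qed
    finally have "P \<in> N"
      by (rule N_conj' [OF roots(2)])
    define A B where "A = root_elt E (root_of 3 1) (of_int (t * b) * x * x * z)"
      and "B = root_elt E (root_of 3 2) (of_int (- (t * e)) * x * z * z)"
    have "root_elt E (root_of 3 2) (- (of_int (- (t * e)) * x * z * z)) ** root_elt E (root_of 3 1) (- (of_int (t * b) * x * x * z)) \<in> N"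
      using long full_long_roots(1) [OF long] by (intro N_mult full_rootD(1))
    from N_mult [OF \<open>P \<in> N\<close> this] show ?thesis
      unfolding P_def by (simp only: matrix_mul_assoc [symmetric] inv_cancel [OF roots(5)] root_elt_inverse [OF roots(4)] matrix_mul_rid)
  qed
  note mult = this
  obtain h :: 'r where h: "2 * h = 1" using two by (metis dvdE)
  have "root_elt E (root_of 2 1) x \<in> N" for x :: 'r
  proof -
    have "of_int c1 * (of_int t * h) * x = (2 * h) * (of_int (t * t) * x)"
      unfolding t(1) by (simp add: mult_ac)
    then have "of_int c1 * (of_int t * h) * x = x" by (simp add: h t(2))
    then show ?thesis using mult [of "of_int t * h" x] by simp
  qed
  then show ?thesis using roots(3) by (simp add: full_roots_def)
qed

lemma full_roots_eq_G2:
  assumes long: "root_of 3 2 \<in> full_roots" and two: "(2::'r) dvd 1"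
  shows "full_roots = \<Phi>"
proof -
  note l = long full_long_roots [OF long]
  have s1: "root_of 2 1 \<in> full_roots" by (rule full_short_root [OF assms])
  have "root_of (- 1) 0 \<in> full_roots"
    using full_root_reflect_root_of [OF s1, of "-3" "-1"] by (simp add: G2_coords_def cartan_root_of_m31)
  from full_root_minus_root_of [OF this] have s2: "root_of 1 0 \<in> full_roots" by simp
  have s3: "root_of 1 1 \<in> full_roots"
    using full_root_reflect_root_of [OF s2, of 0 1]
    by (simp add: G2_coords_def root_of_simple cartan_\<alpha>\<beta>)
  have "root_of i j \<in> full_roots" if "(i, j) \<in> G2_coords" for i j
    using that l s1 s2 s3 full_root_minus_root_of [OF l(1)] full_root_minus_root_of [OF l(2)]
      full_root_minus_root_of [OF l(3)] full_root_minus_root_of [OF s1] full_root_minus_root_of [OF s2]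
      full_root_minus_root_of [OF s3]
    unfolding G2_coords_def by auto
  then have "\<Phi> \<subseteq> full_roots"
    by (subst roots_eq_G2) auto
  then show ?thesis using full_rootD(2) by blast
qed

end

section \<open>Normal generation by root elements of a single root\<close>

context irreducible_chevalley_system
begin

text \<open>
  Elements \<open>\<epsilon>\<^sub>\<alpha>(r\<^sub>i)\<close> with \<open>\<Sum> r\<^sub>i = 1\<close> normally generate the group generated by all root elements. This
  is stated for all such families at once, because the choice of \<open>\<alpha>\<close> must not depend on them.
\<close>

definition generating_root :: "'r::comm_ring_1 itself \<Rightarrow> 'v \<Rightarrow> bool" where
  "generating_root _ \<alpha> \<longleftrightarrow> \<alpha> \<in> \<Phi> \<and> (\<forall>(N :: ('r^'n^'n) set) I (r :: nat \<Rightarrow> 'r). root_normalized \<Phi> E H N \<longrightarrow> finite I \<longrightarrow> sum r I = 1 \<longrightarrow>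
    (\<forall>i\<in>I. root_elt E \<alpha> (r i) \<in> N) \<longrightarrow> (\<forall>\<phi>\<in>\<Phi>. \<forall>x. root_elt E \<phi> x \<in> N))"

text \<open>
  For such a root, \<open>\<epsilon>\<^sub>\<alpha>(1)\<close> is nontrivial modulo every proper ideal. In type \<open>B\<^sub>2\<close> only the long roots have
  this property, while the generating root is short.
\<close>

definition visible_root :: "'v \<Rightarrow> bool" where
  "visible_root \<alpha> \<longleftrightarrow> \<alpha> \<in> \<Phi> \<and> (\<exists>\<beta>\<in>\<Phi>. cartan \<beta> \<alpha> = -1)"

lemma exists_generating_root_G2:
  assumes pair: "\<alpha> \<in> \<Phi>" "\<beta> \<in> \<Phi>" "cartan \<beta> \<alpha> = -3" "cartan \<alpha> \<beta> = -1"
    and base: "root_base \<Phi> \<Delta>" and dim: "DIM('v) \<ge> 2"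
    and two: "type_B2 \<Phi> \<or> type_G2 \<Phi> \<Longrightarrow> (2::'r::comm_ring_1) dvd 1"
  shows "generating_root TYPE('r) \<beta> \<and> visible_root \<beta>"
proof -
  interpret G2_pair \<Phi> \<alpha> \<beta>
    by unfold_locales (use pair in auto)
  have "DIM('v) = 2" using dim DIM_le_2 by simp
  moreover have "\<not> (\<forall>\<phi>\<in>\<Phi>. \<phi> \<bullet> \<phi> = a \<bullet> a)" for a
  proof
    assume "\<forall>\<phi>\<in>\<Phi>. \<phi> \<bullet> \<phi> = a \<bullet> a"
    then have "\<alpha> \<bullet> \<alpha> = \<beta> \<bullet> \<beta>" using \<alpha> \<beta> by metis
    then show False using norm_\<beta> root_norm_pos [OF \<alpha>] by linarith
  qed
  ultimately have 2: "(2::'r) dvd 1"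
    using base_of_plane [OF base] two by metis
  have "root_elt E \<phi> x \<in> N"
    if N: "root_normalized \<Phi> E H N" and I: "finite I" "sum r I = 1" "\<forall>i\<in>I. root_elt E \<beta> (r i) \<in> N" and \<phi>: "\<phi> \<in> \<Phi>"
    for N :: "('r^'n^'n) set" and I and r :: "nat \<Rightarrow> 'r" and \<phi> x
  proof -
    interpret root_normalized \<Phi> E H N by fact
    interpret root_normalized_G2 \<Phi> E H N \<alpha> \<beta> ..
    have eq: "\<beta> + root_of 3 1 = root_of 3 2" "root_of 3 1 - \<beta> = root_of 3 0" "root_of 3 1 + 2 *\<^sub>R \<beta> = root_of 3 3"
        "\<beta> + 2 *\<^sub>R root_of 3 1 = root_of 6 3"
      using root_of_add [of 0 1 3 1] diff_root_of [of 3 1 0 1] root_of_add [of 3 1 0 2] root_of_add [of 0 1 6 2]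
        scaleR_2_root_of [of 0 1] scaleR_2_root_of [of 3 1] by (simp_all add: root_of_simple)
    have mult: "root_elt E (\<beta> + root_of 3 1) (r i * x) \<in> N" if "i \<in> I" for i x
    proof (rule A2_multiples)
      show "cartan \<beta> (root_of 3 1) = -1"
        using cartan_root_of_31 [of 0 1] by (simp add: root_of_simple)
    qed (use I that in \<open>auto simp: eq \<beta> root_of_iff G2_coords_def cartan_root_of\<close>)
    have "root_of 3 2 \<in> full_roots"
      using full_root_if_multiples [OF _ I(1,2) mult] unfolding eq by (simp add: root_of_iff G2_coords_def)
    then show ?thesis
      using full_roots_eq_G2 [OF _ 2] \<phi> full_rootD(1) by blast
  qed
  then show ?thesis
    using pair unfolding generating_root_def visible_root_def by blast
qed

end

context no_triple_bond
begin

lemma exists_generating_root_A2: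
  assumes pair: "\<alpha> \<in> \<Phi>" "\<beta> \<in> \<Phi>" "cartan \<beta> \<alpha> = -1" "cartan \<alpha> \<beta> = -1"
  shows "generating_root TYPE('r::comm_ring_1) \<alpha> \<and> visible_root \<alpha>"
proof -
  have sum: "\<alpha> + \<beta> \<in> \<Phi>"
    using reflect_root [OF pair(1,2)] pair by (simp add: add.commute)
  have no: "\<beta> - \<alpha> \<notin> \<Phi>" "\<beta> + 2 *\<^sub>R \<alpha> \<notin> \<Phi>" "\<alpha> + 2 *\<^sub>R \<beta> \<notin> \<Phi>"
    using not_root_if [OF pair(1), of "\<beta> - \<alpha>"] not_root_if [OF pair(1), of "\<beta> + 2 *\<^sub>R \<alpha>"]
      not_root_if [OF pair(2), of "\<alpha> + 2 *\<^sub>R \<beta>"] by (simp_all add: pair cartan_root_self)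
  have "root_elt E \<phi> x \<in> N"
    if N: "root_normalized \<Phi> E H N" and I: "finite I" "sum r I = 1" "\<forall>i\<in>I. root_elt E \<alpha> (r i) \<in> N" and \<phi>: "\<phi> \<in> \<Phi>"
    for N :: "('r^'n^'n) set" and I and r :: "nat \<Rightarrow> 'r" and \<phi> x
  proof -
    interpret root_normalized \<Phi> E H N by fact
    interpret root_normalized_no_triple \<Phi> E H N ..
    have "\<alpha> + \<beta> \<in> full_roots"
      using A2_multiples [OF pair(1,2) sum pair(3,4) no] I by (intro full_root_if_multiples [OF sum I(1,2)]) auto
    then show ?thesis
      using full_roots_eq \<phi> full_rootD(1) by blast
  qed
  then show ?thesis
    using pair unfolding generating_root_def visible_root_def by blast
qed

lemma exists_generating_root_B2:
  assumes pair: "\<alpha> \<in> \<Phi>" "\<beta> \<in> \<Phi>" "cartan \<beta> \<alpha> = -2" "cartan \<alpha> \<beta> = -1"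
    and two: "(2::'r::comm_ring_1) dvd 1"
  shows "generating_root TYPE('r) \<alpha> \<and> visible_root \<beta>"
proof -
  interpret B2_pair \<Phi> E H \<alpha> \<beta>
    by unfold_locales (use pair in auto)
  obtain b :: int where b: "\<bar>b\<bar> = 2" and comm: "\<And>x y :: 'r. root_elt E \<alpha> x ** root_elt E (\<alpha> + \<beta>) y =
    root_elt E (\<alpha> + \<beta>) y ** root_elt E (\<alpha> + (\<alpha> + \<beta>)) (of_int b * x * y) ** root_elt E \<alpha> x"
    using commutator_short [where 'r = 'r] by blast
  obtain h :: 'r where h: "2 * h = 1" using two by (metis dvdE)
  define h' where "h' = (if b = 2 then h else - h)"
  have h': "of_int b * h' = 1"
  proof -
    have "b = 2 \<or> b = -2" using b by auto
    then show ?thesis using h by (auto simp: h'_def)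
  qed
  have "root_elt E \<phi> x \<in> N"
    if N: "root_normalized \<Phi> E H N" and I: "finite I" "sum r I = 1" "\<forall>i\<in>I. root_elt E \<alpha> (r i) \<in> N" and \<phi>: "\<phi> \<in> \<Phi>"
    for N :: "('r^'n^'n) set" and I and r :: "nat \<Rightarrow> 'r" and \<phi> x
  proof -
    interpret root_normalized \<Phi> E H N by fact
    interpret root_normalized_no_triple \<Phi> E H N ..
    have "root_elt E (\<alpha> + (\<alpha> + \<beta>)) (r i * x) \<in> N" if "i \<in> I" for i x
    proof -
      have "root_elt E (\<alpha> + (\<alpha> + \<beta>)) (of_int b * r i * (h' * x)) \<in> N"
        using commutator_in_N [OF \<alpha> roots(1) comm [of "r i" "h' * x"]] I that by blast
      moreover have "of_int b * r i * (h' * x) = (of_int b * h') * (r i * x)"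
        by (simp only: mult_ac)
      ultimately show ?thesis by (simp add: h')
    qed
    then have "\<alpha> + (\<alpha> + \<beta>) \<in> full_roots"
      by (intro full_root_if_multiples [OF roots(2) I(1,2)]) auto
    then show ?thesis
      using full_roots_eq \<phi> full_rootD(1) by blast
  qed
  then show ?thesis
    using pair unfolding generating_root_def visible_root_def by blast
qed

end

context irreducible_chevalley_system
begin

text \<open>
  Without pairs of type \<open>G\<^sub>2\<close> and \<open>A\<^sub>2\<close>, all nonorthogonal pairs have type \<open>B\<^sub>2\<close>. This confines the root system
  to a plane, where the base identifies its type and \<open>2\<close> is a unit by assumption.
\<close>

theorem exists_generating_root:
  assumes base: "root_base \<Phi> \<Delta>" and dim: "DIM('v) \<ge> 2"
    and two: "type_B2 \<Phi> \<or> type_G2 \<Phi> \<Longrightarrow> (2::'r::comm_ring_1) dvd 1"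
  shows "\<exists>\<alpha> \<beta>. generating_root TYPE('r) \<alpha> \<and> visible_root \<beta>"
proof (cases "\<exists>\<alpha>\<in>\<Phi>. \<exists>\<beta>\<in>\<Phi>. cartan \<beta> \<alpha> = -3")
  case True
  then obtain \<alpha> \<beta> where *: "\<alpha> \<in> \<Phi>" "\<beta> \<in> \<Phi>" "cartan \<beta> \<alpha> = -3" by blast
  then have "\<beta> \<noteq> - \<alpha>" by (auto simp: cartan_root_self)
  moreover have "\<beta> \<bullet> \<alpha> < 0" using * cartan_less_0_iff by fastforce
  ultimately have "cartan \<alpha> \<beta> = -1"
    using cartan_pair_cases [OF *(1,2)] *(3) by auto
  then show ?thesis
    using exists_generating_root_G2 [OF * _ assms] by blast
next
  case False
  then interpret no_triple_bond \<Phi> E H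
    by unfold_locales auto
  show ?thesis
  proof (cases "\<exists>\<alpha>\<in>\<Phi>. \<exists>\<beta>\<in>\<Phi>. cartan \<beta> \<alpha> = -1 \<and> cartan \<alpha> \<beta> = -1")
    case True
    then show ?thesis using exists_generating_root_A2 [where 'r = 'r] by blast
  next
    case noA2: False
    have pairs: "cartan \<psi> \<phi> = -1 \<and> cartan \<phi> \<psi> = -2 \<or> cartan \<psi> \<phi> = -2 \<and> cartan \<phi> \<psi> = -1"
      if "\<phi> \<in> \<Phi>" "\<psi> \<in> \<Phi>" "\<psi> \<noteq> - \<phi>" "\<psi> \<bullet> \<phi> < 0" for \<phi> \<psi>
      using cartan_pair_cases [OF that] noA2 no_triple [OF that(1,2)] no_triple [OF that(2,1)] that(1,2) by auto
    obtain \<phi> \<psi> where "\<phi> \<in> \<Phi>" "\<psi> \<in> \<Phi>" "\<psi> \<noteq> - \<phi>" "\<psi> \<bullet> \<phi> < 0"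
      using exists_obtuse_pair [OF dim] by blast
    then obtain \<alpha> \<beta> where \<alpha>\<beta>: "\<alpha> \<in> \<Phi>" "\<beta> \<in> \<Phi>" "cartan \<beta> \<alpha> = -2" "cartan \<alpha> \<beta> = -1"
      using pairs by metis
    have "DIM('v) \<le> 2"
    proof (rule planar_if_all_ratio_2 [OF \<alpha>\<beta>])
      have neg: "\<psi> \<bullet> \<psi> = 2 * (\<phi> \<bullet> \<phi>) \<or> \<phi> \<bullet> \<phi> = 2 * (\<psi> \<bullet> \<psi>)"
        if "\<phi> \<in> \<Phi>" "\<psi> \<in> \<Phi>" "\<psi> \<noteq> - \<phi>" "\<psi> \<bullet> \<phi> < 0" for \<phi> \<psi>
        using pairs [OF that] cartan_norms [OF that(1,2)] by auto
      fix \<phi> \<psi> assume *: "\<phi> \<in> \<Phi>" "\<psi> \<in> \<Phi>" "\<psi> \<noteq> \<phi>" "\<psi> \<noteq> - \<phi>" "\<psi> \<bullet> \<phi> \<noteq> 0"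
      then consider "\<psi> \<bullet> \<phi> < 0" | "(- \<psi>) \<bullet> \<phi> < 0" by fastforce
      then show "\<psi> \<bullet> \<psi> = 2 * (\<phi> \<bullet> \<phi>) \<or> \<phi> \<bullet> \<phi> = 2 * (\<psi> \<bullet> \<psi>)"
        using neg [of \<phi> \<psi>] neg [of \<phi> "- \<psi>"] * minus_root by cases auto
    qed
    then have "DIM('v) = 2" using dim by simp
    then have "(2::'r) dvd 1"
      using base_of_plane [OF base] noA2 two by blast
    then show ?thesis
      using exists_generating_root_B2 [OF \<alpha>\<beta>] by blast
  qed
qed

end

section \<open>Root elements are nontrivial modulo every proper ideal\<close>

lemma int_divisible_by_all_powers:
  assumes "\<And>k. (q::int) ^ k dvd x" "q \<ge> 2"
  shows "x = 0"
proof (rule ccontr)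
  assume "x \<noteq> 0"
  let ?k = "nat \<bar>x\<bar>"
  have "\<bar>x\<bar> < 2 ^ ?k"
    using less_exp [of ?k] by (metis nat_less_iff of_nat_numeral of_nat_power abs_ge_zero nat_less_numeral_power_cancel_iff)
  also have "\<dots> \<le> q ^ ?k" using assms(2) by (intro power_mono) simp_all
  also have "\<dots> \<le> \<bar>q ^ ?k\<bar>" by simp
  also have "\<dots> \<le> \<bar>x\<bar>" using dvd_imp_le_int \<open>x \<noteq> 0\<close> assms(1) by blast
  finally show False by simp
qed

context chevalley_system
begin

lemma root_elt_taylor:
  assumes "\<alpha> \<in> \<Phi>"
  shows "\<exists>L. root_elt E \<alpha> (x::int) = mat 1 + smult_mat x (E \<alpha>) + smult_mat (x * x) L"
proof -
  interpret divided_powers "E \<alpha>" by (rule divided_powers_E [OF assms])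
  have "root_elt E \<alpha> x = (\<Sum>k<CARD('n). smult_mat (x ^ k) (divpow k))"
    by (simp add: root_elt_eq_dexp divided_powers_E assms dexp_def map_matrix_def)
  also have "\<dots> = (\<Sum>k<Suc (Suc CARD('n)). smult_mat (x ^ k) (divpow k))"
    by (intro sum.mono_neutral_left) (auto simp: divpow_eq_0)
  also have "\<dots> = mat 1 + (smult_mat x (E \<alpha>) + (\<Sum>k<CARD('n). smult_mat (x * x) (smult_mat (x ^ k) (divpow (Suc (Suc k))))))"
    by (simp only: sum.lessThan_Suc_shift) (simp add: divpow_0 divpow_1 [simplified] mult.assoc)
  finally have "root_elt E \<alpha> x = mat 1 + smult_mat x (E \<alpha>) +
      smult_mat (x * x) (\<Sum>k<CARD('n). smult_mat (x ^ k) (divpow (Suc (Suc k))))"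
    by (simp only: smult_mat_sum add.assoc)
  then show ?thesis by blast
qed

text \<open>
  If \<open>\<epsilon>\<^sub>\<alpha>(1) = 1 + qM\<close>, then \<open>\<epsilon>\<^sub>\<alpha>(q) = (1 + qM)\<^sup>q\<close> is congruent to \<open>1\<close> modulo \<open>q\<^sup>2\<close>, but also to
  \<open>1 + qE\<^sub>\<alpha>\<close>. So \<open>q\<close> divides \<open>E\<^sub>\<alpha>\<close>.
\<close>

lemma E_divisible:
  assumes \<alpha>: "\<alpha> \<in> \<Phi>" and one: "root_elt E \<alpha> 1 = mat 1 + smult_mat q M" and q: "q \<ge> 2"
  shows "\<exists>M'. E \<alpha> = smult_mat q M'"
proof -
  have pow: "\<exists>L. root_elt E \<alpha> (int k) = mat 1 + smult_mat (int k * q) M + smult_mat (q * q) L" for k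
  proof (induction k)
    case 0
    then show ?case using \<alpha> by (auto intro: exI [of _ 0])
  next
    case (Suc k)
    then obtain L where L: "root_elt E \<alpha> (int k) = mat 1 + smult_mat (int k * q) M + smult_mat (q * q) L" by blast
    have "root_elt E \<alpha> (int (Suc k)) = root_elt E \<alpha> (int k) ** root_elt E \<alpha> 1"
      by (simp add: root_elt_add \<alpha> add.commute)
    also have "\<dots> = mat 1 + smult_mat (int (Suc k) * q) M +
        smult_mat (q * q) (L + smult_mat (int k) (M ** M) + smult_mat q (L ** M))"
      unfolding L one
      by (simp add: matrix_mult_distribs smult_mat_distribs algebra_simps)
    finally show ?case by blast
  qed
  obtain L where "root_elt E \<alpha> q = mat 1 + smult_mat (q * q) M + smult_mat (q * q) L"
    using pow [of "nat q"] q by auto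
  moreover obtain L' where "root_elt E \<alpha> q = mat 1 + smult_mat q (E \<alpha>) + smult_mat (q * q) L'"
    using root_elt_taylor [OF \<alpha>] by blast
  ultimately have "smult_mat q (E \<alpha>) = smult_mat q (smult_mat q (M + L - L'))"
    by (simp add: smult_mat_distribs algebra_simps)
  then have "E \<alpha> = smult_mat q (M + L - L')"
    using q by (simp add: vec_eq_iff)
  then show ?thesis by blast
qed

text \<open>
  If \<open>q\<close> divided \<open>E\<^sub>\<alpha>\<close>, it would divide \<open>H\<^sub>\<alpha>\<close>, and \<open>[H\<^sub>\<alpha>, E\<^sub>\<beta>] = - E\<^sub>\<beta>\<close> would make \<open>E\<^sub>\<beta>\<close> divisible by all
  powers of \<open>q\<close>.
\<close>

lemma E_not_divisible:
  assumes \<alpha>: "\<alpha> \<in> \<Phi>" and \<beta>: "\<beta> \<in> \<Phi>" and c: "cartan \<beta> \<alpha> = -1" and q: "q \<ge> 2"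
  shows "E \<alpha> \<noteq> smult_mat q M"
proof
  assume "E \<alpha> = smult_mat q M"
  then have "H \<alpha> = smult_mat q (mat_bracket M (E (- \<alpha>)))"
    using bracket_EE_neg [OF \<alpha>] by (simp add: mat_bracket_def smult_mat_distribs)
  moreover have "mat_bracket (smult_mat q B) A = smult_mat q (mat_bracket B A)" for A B :: "int^'n^'n"
    by (simp add: mat_bracket_def smult_mat_distribs)
  ultimately have H: "mat_bracket (H \<alpha>) A = smult_mat q (mat_bracket (mat_bracket M (E (- \<alpha>))) A)" for A
    by simp
  have E\<beta>: "E \<beta> = smult_mat (- 1) (mat_bracket (H \<alpha>) (E \<beta>))"
    using bracket_HE [OF \<alpha> \<beta>, of "-1"] c by simp
  have "\<exists>L. E \<beta> = smult_mat (q ^ k) L" for k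
  proof (induction k)
    case (Suc k)
    then obtain L where L: "E \<beta> = smult_mat (q ^ k) L" by blast
    have "E \<beta> = smult_mat (- 1) (mat_bracket (H \<alpha>) (smult_mat (q ^ k) L))"
      by (subst E\<beta>, subst L) (rule refl)
    also have "\<dots> = smult_mat (q ^ Suc k) (- mat_bracket (mat_bracket M (E (- \<alpha>))) L)"
      by (simp add: H mult.commute)
    finally show ?case by blast
  qed (auto intro: exI [of _ "E \<beta>"])
  then have "q ^ k dvd E \<beta> $ i $ j" for k i j
    by (metis dvd_triv_left smult_mat_nth)
  then have "E \<beta> = 0"
    using int_divisible_by_all_powers [OF _ q] by (simp add: vec_eq_iff)
  then show False using E_nonzero [OF \<beta>] by simp
qed

text \<open>
  The integers in \<open>P\<close> are multiples of some \<open>q \<ge> 2\<close>, and the entries of \<open>\<epsilon>\<^sub>\<alpha>(1)\<close> are integers. So triviality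
  modulo \<open>P\<close> is a divisibility statement over the integers.
\<close>

lemma root_elt_one_not_congruent:
  fixes P :: "'r::comm_ring_1 set"
  assumes \<alpha>: "\<alpha> \<in> \<Phi>" and \<beta>: "\<beta> \<in> \<Phi>" and c: "cartan \<beta> \<alpha> = -1"
    and P: "0 \<in> P" "\<And>x y. x \<in> P \<Longrightarrow> y \<in> P \<Longrightarrow> x + y \<in> P" "\<And>x y. x \<in> P \<Longrightarrow> y * x \<in> P" "1 \<notin> P"
  shows "\<exists>i j. (root_elt E \<alpha> 1 - mat 1) $ i $ j \<notin> P"
proof (rule ccontr)
  assume "\<nexists>i j. (root_elt E \<alpha> 1 - mat 1 :: 'r^'n^'n) $ i $ j \<notin> P"
  then have cong: "(root_elt E \<alpha> 1 - mat 1 :: 'r^'n^'n) $ i $ j \<in> P" for i j by blast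
  have "\<exists>q\<ge>2. \<forall>m::int. of_int m \<in> P \<longrightarrow> q dvd m"
  proof (cases "\<exists>m::nat. m > 0 \<and> of_nat m \<in> P")
    case False
    have "m = 0" if "of_int m \<in> P" for m
    proof (rule ccontr)
      assume "m \<noteq> 0"
      have "of_nat (nat \<bar>m\<bar>) = (of_int m :: 'r) \<or> of_nat (nat \<bar>m\<bar>) = (- 1) * (of_int m :: 'r)"
        by (cases "m \<ge> 0") (auto simp: of_nat_nat)
      then have "(of_nat (nat \<bar>m\<bar>) :: 'r) \<in> P"
        using P(3) [OF that] that by metis
      moreover have "nat \<bar>m\<bar> > 0" using \<open>m \<noteq> 0\<close> by simp
      ultimately show False using False by blast
    qed
    \<comment> \<open>\<open>P\<close> contains no integer except \<open>0\<close>, so that every \<open>q\<close> works.\<close>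
    then show ?thesis by (intro exI [of _ 2]) auto
  next
    case True
    define q where "q = (LEAST m::nat. m > 0 \<and> of_nat m \<in> P)"
    have q: "q > 0" "of_nat q \<in> P"
      using LeastI_ex [OF True] unfolding q_def by auto
    have "q \<noteq> 1" using q P(4) by auto
    have "int q dvd m" if "of_int m \<in> P" for m
    proof -
      have "(of_int (m mod int q) :: 'r) = of_int m + of_int (- (m div int q)) * of_nat q"
        by (simp add: minus_div_mult_eq_mod [symmetric])
      then have "of_int (m mod int q) \<in> P"
        using P(2) [OF that P(3) [OF q(2), of "of_int (- (m div int q))"]] by metis
      then have "of_nat (nat (m mod int q)) \<in> P"
        using q(1) by (simp add: of_nat_nat)
      moreover have "nat (m mod int q) < q"
        using q(1) by (simp add: nat_less_iff)
      ultimately have "nat (m mod int q) = 0"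
        using not_less_Least [of "nat (m mod int q)" "\<lambda>m. m > 0 \<and> of_nat m \<in> P"] unfolding q_def [symmetric] by auto
      then have "m mod int q \<le> 0" by simp
      moreover have "0 \<le> m mod int q" using q(1) by simp
      ultimately have "m mod int q = 0" by (rule antisym)
      then show ?thesis by (simp add: dvd_eq_mod_eq_0)
    qed
    then show ?thesis using q \<open>q \<noteq> 1\<close> by (intro exI [of _ "int q"]) auto
  qed
  then obtain q :: int where q: "q \<ge> 2" and dvd: "\<And>m::int. of_int m \<in> P \<Longrightarrow> q dvd m" by blast
  have "(root_elt E \<alpha> 1 - mat 1 :: 'r^'n^'n) = int_matrix (root_elt E \<alpha> 1 - mat 1)"
    by (simp add: of_int_hom.map_matrix_hom)
  then have "q dvd (root_elt E \<alpha> 1 - mat 1) $ i $ j" for i j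
    using cong [of i j] by (intro dvd) simp
  then obtain M where "\<And>i j. (root_elt E \<alpha> 1 - mat 1) $ i $ j = q * M i j"
    unfolding dvd_def by metis
  then have "root_elt E \<alpha> 1 = mat 1 + smult_mat q (\<chi> i j. M i j)"
    by (simp add: vec_eq_iff algebra_simps)
  then show False
    using E_divisible [OF \<alpha> _ q] E_not_divisible [OF \<alpha> \<beta> c q] by blast
qed

end

section \<open>The group of points is generated by root elements\<close>

text \<open>
  Pairs of functions on complex matrices and on matrices over \<open>R\<close> that are given by the same
  integer polynomial in the matrix entries.
\<close>

inductive poly_fun_pair :: "(complex^'n^'n \<Rightarrow> complex) \<Rightarrow> ('r::comm_ring_1^'n^'n \<Rightarrow> 'r) \<Rightarrow> bool" where
  const: "poly_fun_pair (\<lambda>A. of_int c) (\<lambda>A. of_int c)"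
| coord: "poly_fun_pair (\<lambda>A. A $ i $ j) (\<lambda>A. A $ i $ j)"
| add: "poly_fun_pair f g \<Longrightarrow> poly_fun_pair f' g' \<Longrightarrow> poly_fun_pair (\<lambda>A. f A + f' A) (\<lambda>A. g A + g' A)"
| mult: "poly_fun_pair f g \<Longrightarrow> poly_fun_pair f' g' \<Longrightarrow> poly_fun_pair (\<lambda>A. f A * f' A) (\<lambda>A. g A * g' A)"

lemma poly_fun_pair_zero: "poly_fun_pair (\<lambda>A. 0) (\<lambda>A. 0)"
  using poly_fun_pair.const [of 0] by simp

lemma poly_fun_pair_sum:
  assumes "\<And>i. i \<in> I \<Longrightarrow> poly_fun_pair (f i) (g i)"
  shows "poly_fun_pair (\<lambda>A. \<Sum>i\<in>I. f i A) (\<lambda>A. \<Sum>i\<in>I. g i A)"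
  using assms
  by (induction I rule: infinite_finite_induct) (auto intro: poly_fun_pair_zero poly_fun_pair.add)

lemma poly_fun_pair_prod:
  assumes "\<And>i. i \<in> I \<Longrightarrow> poly_fun_pair (f i) (g i)"
  shows "poly_fun_pair (\<lambda>A. \<Prod>i\<in>I. f i A) (\<lambda>A. \<Prod>i\<in>I. g i A)"
proof -
  have one: "poly_fun_pair (\<lambda>A. 1) (\<lambda>A. 1)"
    using poly_fun_pair.const [of 1] by simp
  show ?thesis
    using assms by (induction I rule: infinite_finite_induct) (auto intro: one poly_fun_pair.mult)
qed

lemma poly_fun_pair_power:
  "poly_fun_pair f g \<Longrightarrow> poly_fun_pair (\<lambda>A. f A ^ k) (\<lambda>A. g A ^ k)"
  using poly_fun_pair_prod [of "{..<k}" "\<lambda>_. f" "\<lambda>_. g"] by simp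

lemma poly_fun_pair_eval_mat_poly: "poly_fun_pair (eval_mat_poly p) (eval_mat_poly p)"
  unfolding eval_mat_poly_def
  by (auto simp: case_prod_unfold intro!: poly_fun_pair_sum poly_fun_pair_prod poly_fun_pair_power poly_fun_pair.intros)

lemma sum_power_mult:
  fixes a b :: "nat \<Rightarrow> 'a::comm_ring_1"
  shows "(\<Sum>i<m. x ^ i * a i) * (\<Sum>j<n. x ^ j * b j) =
    (\<Sum>l<m + n. x ^ l * (\<Sum>i<m. if i \<le> l \<and> l - i < n then a i * b (l - i) else 0))"
proof -
  have inner: "(\<Sum>l<m + n. x ^ l * (if i \<le> l \<and> l - i < n then a i * b (l - i) else 0)) = x ^ i * a i * (\<Sum>j<n. x ^ j * b j)"
    if "i < m" for i
  proof -
    have "(\<Sum>l<m + n. x ^ l * (if i \<le> l \<and> l - i < n then a i * b (l - i) else 0)) =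
        (\<Sum>l\<in>{i..<i + n}. x ^ l * (a i * b (l - i)))"
      using that by (intro sum.mono_neutral_cong_right) auto
    also have "\<dots> = (\<Sum>j<n. x ^ (i + j) * (a i * b j))"
      by (intro sum.reindex_bij_witness [of _ "\<lambda>j. i + j" "\<lambda>l. l - i"]) auto
    also have "\<dots> = x ^ i * a i * (\<Sum>j<n. x ^ j * b j)"
      by (simp add: sum_distrib_left power_add mult_ac)
    finally show ?thesis .
  qed
  have "(\<Sum>l<m + n. x ^ l * (\<Sum>i<m. if i \<le> l \<and> l - i < n then a i * b (l - i) else 0)) =
      (\<Sum>i<m. \<Sum>l<m + n. x ^ l * (if i \<le> l \<and> l - i < n then a i * b (l - i) else 0))"
    unfolding sum_distrib_left by (rule sum.swap)
  also have "\<dots> = (\<Sum>i<m. x ^ i * a i * (\<Sum>j<n. x ^ j * b j))"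
    by (intro sum.cong refl inner) simp
  finally show ?thesis unfolding sum_distrib_right ..
qed

text \<open>
  Since the coefficients in \<open>x\<close> are again polynomial functions of \<open>A\<close>, vanishing can be passed on from \<open>A\<close>
  to \<open>\<epsilon>\<^sub>\<alpha>(x)A\<close> coefficient by coefficient.
\<close>

lemma poly_fun_pair_root_elt_mult:
  fixes E :: "'v \<Rightarrow> int^'n^'n"
  assumes "poly_fun_pair f (g :: 'r::comm_ring_1^'n^'n \<Rightarrow> 'r)"
  shows "\<exists>d F G. (\<forall>j. poly_fun_pair (F j) (G j :: 'r^'n^'n \<Rightarrow> 'r)) \<and>
    (\<forall>x A. f (root_elt E \<alpha> x ** A) = (\<Sum>j<d. x ^ j * F j A)) \<and>
    (\<forall>x A. g (root_elt E \<alpha> x ** A) = (\<Sum>j<d. x ^ j * G j A))"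
  using assms
proof induction
  case (const c)
  show ?case
    by (rule exI [of _ 1], rule exI [of _ "\<lambda>_ _. of_int c"], rule exI [of _ "\<lambda>_ _. of_int c"])
      (simp add: poly_fun_pair.const)
next
  case (coord i j)
  let ?e = "\<lambda>k m. mat_power (E \<alpha>) k $ i $ m div fact k"
  have expand: "(root_elt E \<alpha> x ** A) $ i $ j = (\<Sum>k<CARD('n). x ^ k * (\<Sum>m\<in>UNIV. of_int (?e k m) * A $ m $ j))"
    for x :: "'c::comm_ring_1" and A
    by (simp add: matrix_matrix_mult_def root_elt_def sum_distrib_left sum_distrib_right mult.assoc sum.swap [of _ "{..<CARD('n)}"])
  show ?case
    by (rule exI [of _ "CARD('n)"], rule exI [of _ "\<lambda>k A. \<Sum>m\<in>UNIV. of_int (?e k m) * A $ m $ j"],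
        rule exI [of _ "\<lambda>k A. \<Sum>m\<in>UNIV. of_int (?e k m) * A $ m $ j"])
      (auto simp: expand intro!: poly_fun_pair_sum poly_fun_pair.intros)
next
  case (add f g f' g')
  from add.IH(1) obtain d F G where FG: "\<forall>j. poly_fun_pair (F j) (G j)"
    "\<forall>x A. f (root_elt E \<alpha> x ** A) = (\<Sum>j<d. x ^ j * F j A)"
    "\<forall>x A. g (root_elt E \<alpha> x ** A) = (\<Sum>j<d. x ^ j * G j A)"
    by blast
  from add.IH(2) obtain d' F' G' where FG': "\<forall>j. poly_fun_pair (F' j) (G' j)"
    "\<forall>x A. f' (root_elt E \<alpha> x ** A) = (\<Sum>j<d'. x ^ j * F' j A)"
    "\<forall>x A. g' (root_elt E \<alpha> x ** A) = (\<Sum>j<d'. x ^ j * G' j A)"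
    by blast
  note 1 = FG [rule_format] and 2 = FG' [rule_format]
  have pad: "(\<Sum>j<d. x ^ j * a j) = (\<Sum>j<d + d'. x ^ j * (if j < d then a j else 0))"
    "(\<Sum>j<d'. x ^ j * a j) = (\<Sum>j<d + d'. x ^ j * (if j < d' then a j else 0))"
    for x :: "'c::comm_ring_1" and a
    by (rule sum.mono_neutral_cong_left; auto)+
  let ?F = "\<lambda>j A. (if j < d then F j A else 0) + (if j < d' then F' j A else 0)"
  let ?G = "\<lambda>j A. (if j < d then G j A else 0) + (if j < d' then G' j A else 0)"
  have "poly_fun_pair (?F j) (?G j)" for j
    using 1(1) 2(1) by (cases "j < d"; cases "j < d'") (auto intro: poly_fun_pair.add poly_fun_pair_zero)
  moreover have "f (root_elt E \<alpha> x ** A) + f' (root_elt E \<alpha> x ** A) = (\<Sum>j<d + d'. x ^ j * ?F j A)" for x A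
    unfolding 1 2 pad by (simp add: sum.distrib [symmetric] distrib_left)
  moreover have "g (root_elt E \<alpha> x ** A) + g' (root_elt E \<alpha> x ** A) = (\<Sum>j<d + d'. x ^ j * ?G j A)" for x A
    unfolding 1 2 pad by (simp add: sum.distrib [symmetric] distrib_left)
  ultimately show ?case
    by (intro exI [of _ "d + d'"] exI [of _ ?F] exI [of _ ?G] conjI allI)
next
  case (mult f g f' g')
  from mult.IH(1) obtain d F G where FG: "\<forall>j. poly_fun_pair (F j) (G j)"
    "\<forall>x A. f (root_elt E \<alpha> x ** A) = (\<Sum>j<d. x ^ j * F j A)"
    "\<forall>x A. g (root_elt E \<alpha> x ** A) = (\<Sum>j<d. x ^ j * G j A)"
    by blast
  from mult.IH(2) obtain d' F' G' where FG': "\<forall>j. poly_fun_pair (F' j) (G' j)"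
    "\<forall>x A. f' (root_elt E \<alpha> x ** A) = (\<Sum>j<d'. x ^ j * F' j A)"
    "\<forall>x A. g' (root_elt E \<alpha> x ** A) = (\<Sum>j<d'. x ^ j * G' j A)"
    by blast
  note 1 = FG [rule_format] and 2 = FG' [rule_format]
  let ?F = "\<lambda>l A. \<Sum>i<d. if i \<le> l \<and> l - i < d' then F i A * F' (l - i) A else 0"
  let ?G = "\<lambda>l A. \<Sum>i<d. if i \<le> l \<and> l - i < d' then G i A * G' (l - i) A else 0"
  have "poly_fun_pair (?F l) (?G l)" for l
  proof (rule poly_fun_pair_sum)
    fix i
    show "poly_fun_pair (\<lambda>A. if i \<le> l \<and> l - i < d' then F i A * F' (l - i) A else 0)
        (\<lambda>A. if i \<le> l \<and> l - i < d' then G i A * G' (l - i) A else 0)"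
      using 1(1) 2(1) by (cases "i \<le> l \<and> l - i < d'") (auto intro: poly_fun_pair.mult poly_fun_pair_zero)
  qed
  moreover have "f (root_elt E \<alpha> x ** A) * f' (root_elt E \<alpha> x ** A) = (\<Sum>j<d + d'. x ^ j * ?F j A)" for x A
    unfolding 1 2 by (rule sum_power_mult)
  moreover have "g (root_elt E \<alpha> x ** A) * g' (root_elt E \<alpha> x ** A) = (\<Sum>j<d + d'. x ^ j * ?G j A)" for x A
    unfolding 1 2 by (rule sum_power_mult)
  ultimately show ?case
    by (intro exI [of _ "d + d'"] exI [of _ ?F] exI [of _ ?G] conjI allI)
qed

inductive_set elementary :: "'v set \<Rightarrow> ('v \<Rightarrow> int^'n^'n) \<Rightarrow> ('r::comm_ring_1^'n^'n) set"
  for \<Phi> E where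
  one: "mat 1 \<in> elementary \<Phi> E"
| step: "\<phi> \<in> \<Phi> \<Longrightarrow> A \<in> elementary \<Phi> E \<Longrightarrow> root_elt E \<phi> x ** A \<in> elementary \<Phi> E"

lemma elementary_mult: "A \<in> elementary \<Phi> E \<Longrightarrow> B \<in> elementary \<Phi> E \<Longrightarrow> A ** B \<in> elementary \<Phi> E"
  by (induction rule: elementary.induct) (auto simp: matrix_mul_assoc [symmetric] intro: elementary.intros)

lemma GL_simps: "mult GL = (**)" "one GL = mat 1"
  by (simp_all add: GL_def units_of_def)

lemma carrier_GL: "carrier GL = {A. \<exists>B. A ** B = mat 1 \<and> B ** A = mat 1}"
  by (auto simp: GL_def units_of_def Units_def)

context chevalley_system
begin

lemma root_elt_elementary: "\<phi> \<in> \<Phi> \<Longrightarrow> root_elt E \<phi> x \<in> elementary \<Phi> E"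
  using elementary.step [OF _ elementary.one, of \<phi> \<Phi> E x] by simp

lemma elementary_inverse:
  "A \<in> elementary \<Phi> E \<Longrightarrow> \<exists>B\<in>elementary \<Phi> E. A ** B = mat 1 \<and> B ** A = mat 1"
proof (induction rule: elementary.induct)
  case one
  show ?case by (rule bexI [of _ "mat 1"]) (simp_all add: elementary.one)
next
  case (step \<phi> A x)
  then obtain B where B: "B \<in> elementary \<Phi> E" "A ** B = mat 1" "B ** A = mat 1" by blast
  have "root_elt E \<phi> x ** A ** (B ** root_elt E \<phi> (- x)) = mat 1"
    "B ** root_elt E \<phi> (- x) ** (root_elt E \<phi> x ** A) = mat 1"
    using B root_elt_inverse [OF step.hyps(1), of x]
    by (metis matrix_mul_assoc matrix_mul_lid)+
  then show ?case
    using B elementary_mult root_elt_elementary step.hyps(1) by blast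
qed

text \<open>
  The elementary group over \<open>R\<close> consists of points of the group scheme: if an integer polynomial
  vanishes on the complex group, then so do the coefficients of its restriction to
  \<open>\<epsilon>\<^sub>\<alpha>(x)A\<close>, as polynomials in \<open>x\<close>.
\<close>

lemma elementary_subset: "elementary \<Phi> E \<subseteq> carrier (chevalley_group \<Phi> E :: ('r::comm_ring_1^'n^'n) monoid)"
proof
  fix A :: "'r^'n^'n" assume A: "A \<in> elementary \<Phi> E"
  have closed: "root_elt E \<phi> z ** B \<in> complex_chevalley_group \<Phi> E"
    if "\<phi> \<in> \<Phi>" "B \<in> complex_chevalley_group \<Phi> E" for \<phi> z B
    using generate.eng [OF generate.incl that(2) [unfolded complex_chevalley_group_def], of "root_elt E \<phi> z"] that(1)
    unfolding complex_chevalley_group_def GL_simps by blast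
  have one: "mat 1 \<in> complex_chevalley_group \<Phi> E"
    using generate.one [where G = GL] unfolding complex_chevalley_group_def GL_simps by blast
  have vanish: "g A = 0" if "poly_fun_pair f g" "\<forall>B\<in>complex_chevalley_group \<Phi> E. f B = 0" for f g
    using A that
  proof (induction arbitrary: f g rule: elementary.induct)
    case one
    from one.prems(1) have "\<exists>c::int. f (mat 1) = of_int c \<and> g (mat 1) = of_int c"
    proof induction
      case (const c)
      then show ?case by blast
    next
      case (coord i j)
      then show ?case by (intro exI [of _ "if i = j then 1 else 0"]) (simp add: mat_def)
    next
      case (add f g f' g')
      then show ?case by (metis of_int_add)
    next
      case (mult f g f' g')
      then show ?case by (metis of_int_mult)
    qed
    then show ?case
      using one.prems(2) \<open>mat 1 \<in> complex_chevalley_group \<Phi> E\<close> by force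
  next
    case (step \<phi> A x)
    obtain d F G where FG': "\<forall>j. poly_fun_pair (F j) (G j)"
      "\<forall>x A. f (root_elt E \<phi> x ** A) = (\<Sum>j<d. x ^ j * F j A)"
      "\<forall>x A. g (root_elt E \<phi> x ** A) = (\<Sum>j<d. x ^ j * G j A)"
      using poly_fun_pair_root_elt_mult [OF step.prems(1), of E \<phi>] by blast
    note FG = FG' [rule_format]
    have "G j A = 0" if "j < d" for j
    proof (rule step.IH [OF FG(1)], rule ballI)
      fix B assume B: "B \<in> complex_chevalley_group \<Phi> E"
      obtain d' where d': "d = Suc d'" using \<open>j < d\<close> by (cases d) auto
      have "(\<Sum>j\<le>d'. F j B * z ^ j) = 0" for z
        using FG(2) [of z B] step.prems(2) closed [OF step.hyps(1) B, of z]
        by (simp add: d' lessThan_Suc_atMost mult.commute)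
      then show "F j B = 0"
        using polyfun_eq_0 [of "\<lambda>j. F j B" d'] that d' by simp
    qed
    then show ?case by (simp add: FG(3))
  qed
  have "A \<in> carrier GL"
    using elementary_inverse [OF A] by (auto simp: carrier_GL)
  then show "A \<in> carrier (chevalley_group \<Phi> E)"
    using vanish poly_fun_pair_eval_mat_poly unfolding chevalley_group_def by auto
qed

text \<open>
  Bounded generation gives the converse inclusion. So the points form a group, which otherwise would
  require the comultiplication of the coordinate ring.
\<close>

lemma carrier_eq_elementary:
  assumes "boundedly_generated_by_root_elts TYPE('r::comm_ring_1) \<Phi> E"
  shows "carrier (chevalley_group \<Phi> E :: ('r^'n^'n) monoid) = elementary \<Phi> E"
proof -
  have "foldr (**) (map2 (root_elt E) \<alpha>s as) (mat 1) \<in> elementary \<Phi> E"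
    if "set \<alpha>s \<subseteq> \<Phi>" "length as = length \<alpha>s" for \<alpha>s and as :: "'r list"
    using that(2,1) by (induction as \<alpha>s rule: list_induct2) (auto intro: elementary.intros)
  note word = this
  obtain \<alpha>s where \<alpha>s: "set \<alpha>s \<subseteq> \<Phi>" "\<forall>A \<in> carrier (chevalley_group \<Phi> E :: ('r^'n^'n) monoid).
      \<exists>as. length as = length \<alpha>s \<and> A = foldr (**) (map2 (root_elt E) \<alpha>s as) (mat 1)"
    using assms unfolding boundedly_generated_by_root_elts_def by (elim exE conjE)
  have "carrier (chevalley_group \<Phi> E :: ('r^'n^'n) monoid) \<subseteq> elementary \<Phi> E"
  proof
    fix A :: "'r^'n^'n" assume "A \<in> carrier (chevalley_group \<Phi> E)"
    with \<alpha>s(2) obtain as where as: "length as = length \<alpha>s" "A = foldr (**) (map2 (root_elt E) \<alpha>s as) (mat 1)"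
      by (elim ballE) auto
    show "A \<in> elementary \<Phi> E"
      unfolding as(2) by (rule word [OF \<alpha>s(1) as(1)])
  qed
  then show ?thesis using elementary_subset by blast
qed

lemma chevalley_group_simps:
  "mult (chevalley_group \<Phi> E) = (**)" "one (chevalley_group \<Phi> E) = mat 1"
  by (simp_all add: chevalley_group_def GL_simps)

lemma group_chevalley_group:
  assumes "boundedly_generated_by_root_elts TYPE('r::comm_ring_1) \<Phi> E"
  shows "group (chevalley_group \<Phi> E :: ('r^'n^'n) monoid)"
proof (rule groupI)
  fix A :: "'r^'n^'n" assume "A \<in> carrier (chevalley_group \<Phi> E)"
  then show "\<exists>B\<in>carrier (chevalley_group \<Phi> E). B \<otimes>\<^bsub>chevalley_group \<Phi> E\<^esub> A = \<one>\<^bsub>chevalley_group \<Phi> E\<^esub>"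
    using elementary_inverse unfolding chevalley_group_simps carrier_eq_elementary [OF assms] by blast
qed (auto simp: chevalley_group_simps carrier_eq_elementary [OF assms] matrix_mul_assoc
  intro: elementary_mult elementary.one)

end

section \<open>Word norms\<close>

context group
begin

lemma foldr_mult_closed: "set ys \<subseteq> carrier G \<Longrightarrow> foldr (\<otimes>) ys \<one> \<in> carrier G"
  by (induction ys) auto

lemma foldr_mult_append:
  "set xs \<subseteq> carrier G \<Longrightarrow> set ys \<subseteq> carrier G \<Longrightarrow> foldr (\<otimes>) (xs @ ys) \<one> = foldr (\<otimes>) xs \<one> \<otimes> foldr (\<otimes>) ys \<one>"
  by (induction xs) (auto simp: foldr_mult_closed m_assoc)

lemma foldr_mult_inv:
  "set ys \<subseteq> carrier G \<Longrightarrow> inv (foldr (\<otimes>) ys \<one>) = foldr (\<otimes>) (rev (map (\<lambda>y. inv y) ys)) \<one>"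
proof (induction ys)
  case (Cons y ys)
  moreover from this have "set (rev (map (\<lambda>y. inv y) ys)) \<subseteq> carrier G" by auto
  ultimately show ?case
    by (simp add: foldr_mult_append foldr_mult_closed inv_mult_group del: foldr_append)
qed simp

lemma foldr_mult_conj:
  "g \<in> carrier G \<Longrightarrow> set ys \<subseteq> carrier G \<Longrightarrow> g \<otimes> foldr (\<otimes>) ys \<one> \<otimes> inv g = foldr (\<otimes>) (map (\<lambda>y. g \<otimes> y \<otimes> inv g) ys) \<one>"
proof (induction ys)
  case (Cons y ys)
  have "g \<otimes> (y \<otimes> P) \<otimes> inv g = (g \<otimes> y \<otimes> inv g) \<otimes> (g \<otimes> P \<otimes> inv g)" if "P \<in> carrier G" for P
    using Cons.prems that by (simp add: m_assoc) (metis inv_closed inv_solve_left l_inv m_assoc m_closed r_one l_one)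
  then show ?case
    using Cons by (simp add: foldr_mult_closed)
qed simp

lemma conjugates_pm_closed:
  assumes "S \<subseteq> carrier G"
  shows "conjugates_pm G S \<subseteq> carrier G"
  using assms by (auto simp: conjugates_pm_def)

lemma conjugates_pmI:
  "g \<in> carrier G \<Longrightarrow> s \<in> S \<union> (\<lambda>t. inv t) ` S \<Longrightarrow> g \<otimes> s \<otimes> inv g \<in> conjugates_pm G S"
  unfolding conjugates_pm_def by blast

lemma conjugates_pm_inv:
  assumes "S \<subseteq> carrier G" "y \<in> conjugates_pm G S"
  shows "inv y \<in> conjugates_pm G S"
proof -
  obtain g s where gs: "g \<in> carrier G" "s \<in> S \<union> (\<lambda>t. inv t) ` S" "y = g \<otimes> s \<otimes> inv g"
    using assms(2) by (auto simp: conjugates_pm_def)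
  then have s: "s \<in> carrier G" using assms(1) by auto
  then have "inv y = g \<otimes> inv s \<otimes> inv g"
    using gs by (simp add: inv_mult_group m_assoc)
  moreover have "inv s \<in> S \<union> (\<lambda>t. inv t) ` S"
    using gs(2) assms(1) by auto
  ultimately show ?thesis
    using conjugates_pmI [OF gs(1)] by simp
qed

lemma conjugates_pm_conj:
  assumes "S \<subseteq> carrier G" "y \<in> conjugates_pm G S" "h \<in> carrier G"
  shows "h \<otimes> y \<otimes> inv h \<in> conjugates_pm G S"
proof -
  obtain g s where gs: "g \<in> carrier G" "s \<in> S \<union> (\<lambda>t. inv t) ` S" "y = g \<otimes> s \<otimes> inv g"
    using assms(2) by (auto simp: conjugates_pm_def)
  then have s: "s \<in> carrier G" using assms(1) by auto
  then have "h \<otimes> y \<otimes> inv h = (h \<otimes> g) \<otimes> s \<otimes> inv (h \<otimes> g)"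
    using gs assms(3) by (simp add: inv_mult_group m_assoc)
  then show ?thesis
    using conjugates_pmI [OF m_closed [OF assms(3) gs(1)] gs(2)] by simp
qed

text \<open>
  Every element of the normal closure is a product of conjugates, so the minimum in the definition
  of the norm is attained.
\<close>

lemma normal_closure_product:
  assumes S: "S \<subseteq> carrier G" and A: "A \<in> normal_closure G S"
  shows "\<exists>ys. set ys \<subseteq> conjugates_pm G S \<and> A = foldr (\<otimes>) ys \<one>"
proof -
  let ?W = "{foldr (\<otimes>) ys \<one> | ys. set ys \<subseteq> conjugates_pm G S}"
  note cl = conjugates_pm_closed [OF S]
  have "?W \<lhd> G"
    unfolding normal_inv_iff
  proof (intro conjI ballI subgroupI)
    show "?W \<subseteq> carrier G"
      using cl foldr_mult_closed by blast
    show "?W \<noteq> {}"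
      by (auto intro: exI [of _ "[]"])
    show "inv a \<in> ?W" if "a \<in> ?W" for a
    proof -
      obtain ys where ys: "a = foldr (\<otimes>) ys \<one>" "set ys \<subseteq> conjugates_pm G S" using \<open>a \<in> ?W\<close> by blast
      then have "set (rev (map (\<lambda>y. inv y) ys)) \<subseteq> conjugates_pm G S"
        using conjugates_pm_inv [OF S] by auto
      moreover have "inv a = foldr (\<otimes>) (rev (map (\<lambda>y. inv y) ys)) \<one>"
        unfolding ys(1) using ys(2) cl by (intro foldr_mult_inv) blast
      ultimately show ?thesis by blast
    qed
    show "a \<otimes> b \<in> ?W" if ab: "a \<in> ?W" "b \<in> ?W" for a b
    proof -
      obtain xs ys where *: "a = foldr (\<otimes>) xs \<one>" "set xs \<subseteq> conjugates_pm G S"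
          "b = foldr (\<otimes>) ys \<one>" "set ys \<subseteq> conjugates_pm G S" using ab by blast
      then have "a \<otimes> b = foldr (\<otimes>) (xs @ ys) \<one>"
        using foldr_mult_append [of xs ys] cl by auto
      moreover have "set (xs @ ys) \<subseteq> conjugates_pm G S" using * by simp
      ultimately show ?thesis by blast
    qed
    show "x \<otimes> h \<otimes> inv x \<in> ?W" if x: "x \<in> carrier G" and h: "h \<in> ?W" for x h
    proof -
      obtain ys where ys: "h = foldr (\<otimes>) ys \<one>" "set ys \<subseteq> conjugates_pm G S" using h by blast
      then have "set (map (\<lambda>y. x \<otimes> y \<otimes> inv x) ys) \<subseteq> conjugates_pm G S"
        using conjugates_pm_conj [OF S _ x] by auto
      moreover have "x \<otimes> h \<otimes> inv x = foldr (\<otimes>) (map (\<lambda>y. x \<otimes> y \<otimes> inv x) ys) \<one>"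
        unfolding ys(1) using ys(2) cl x by (intro foldr_mult_conj) blast+
      ultimately show ?thesis by blast
    qed
  qed
  moreover have "S \<subseteq> ?W"
  proof
    fix s assume s: "s \<in> S"
    then have "\<one> \<otimes> s \<otimes> inv \<one> \<in> conjugates_pm G S"
      by (intro conjugates_pmI) auto
    then have "s \<in> conjugates_pm G S" using s S by auto
    moreover have "s = foldr (\<otimes>) [s] \<one>" using s S by auto
    ultimately show "s \<in> ?W" by (metis (mono_tags, lifting) mem_Collect_eq empty_set empty_subsetI insert_subset list.simps(15))
  qed
  ultimately have "A \<in> ?W"
    using A unfolding normal_closure_def by blast
  then show ?thesis by blast
qed

lemma word_norm_ge:
  assumes S: "S \<subseteq> carrier G"
    and long: "\<And>ys. set ys \<subseteq> conjugates_pm G S \<Longrightarrow> A = foldr (\<otimes>) ys \<one> \<Longrightarrow> k \<le> length ys"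
  shows "enat k \<le> word_norm G S A"
proof (cases "A \<in> normal_closure G S")
  case True
  let ?P = "\<lambda>n. \<exists>ys. length ys = n \<and> set ys \<subseteq> conjugates_pm G S \<and> A = foldr (\<otimes>) ys \<one>"
  have "\<exists>n. ?P n" using normal_closure_product [OF S True] by blast
  then have "?P (LEAST n. ?P n)" by (rule LeastI_ex)
  then obtain ys where "length ys = (LEAST n. ?P n)" "set ys \<subseteq> conjugates_pm G S" "A = foldr (\<otimes>) ys \<one>"
    by (elim exE conjE)
  then have "k \<le> (LEAST n. ?P n)" using long [of ys] by linarith
  then show ?thesis using True by (simp add: word_norm_def)
qed (simp add: word_norm_def)

end

lemma norm_diam_ge:
  assumes "A \<in> carrier G" "enat k \<le> word_norm G S A"
  shows "enat k \<le> norm_diam G S"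
  unfolding norm_diam_def using assms by (auto intro!: Inf_greatest intro: order_trans)

lemma Delta_ge:
  assumes "S \<subseteq> carrier G" "finite S" "card S \<le> k" "normal_closure G S = carrier G" "enat m \<le> norm_diam G S"
  shows "ereal (real m) \<le> Delta k G"
proof -
  have "ereal (real m) \<le> ereal_of_enat (norm_diam G S)"
    using assms(5) by (metis ereal_of_enat_le_iff ereal_of_enat_simps(1))
  also have "\<dots> \<le> Delta k G"
    unfolding Delta_def using assms by (intro Sup_upper) blast
  finally show ?thesis .
qed

section \<open>Maximal ideals and congruence conditions\<close>

definition proper_ideal :: "'r::comm_ring_1 set \<Rightarrow> bool" where
  "proper_ideal P \<longleftrightarrow> 0 \<in> P \<and> (\<forall>x\<in>P. \<forall>y\<in>P. x + y \<in> P) \<and> (\<forall>x\<in>P. \<forall>y. y * x \<in> P) \<and> 1 \<notin> P"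

lemma ring_of_type_simps:
  "carrier ring_of_type_algebra = UNIV" "mult ring_of_type_algebra = (*)" "one ring_of_type_algebra = 1"
  "zero ring_of_type_algebra = 0" "add ring_of_type_algebra = (+)"
  by (simp_all add: ring_of_type_algebra_def)

lemma proper_ideal_maximal:
  assumes "maximalideal (P :: 'r::comm_ring_1 set) ring_of_type_algebra"
  shows "proper_ideal P"
proof -
  interpret maximalideal P "ring_of_type_algebra :: 'r ring" by fact
  show ?thesis
    unfolding proper_ideal_def
  proof (intro conjI ballI allI)
    show "0 \<in> P" using additive_subgroup.zero_closed [OF additive_subgroup_axioms] by (simp add: ring_of_type_simps)
    show "x + y \<in> P" if "x \<in> P" "y \<in> P" for x y
      using additive_subgroup.a_closed [OF additive_subgroup_axioms that] by (simp add: ring_of_type_simps)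
    show "y * x \<in> P" if "x \<in> P" for x y
      using I_l_closed [OF that, of y] by (simp add: ring_of_type_simps)
    show "1 \<notin> P"
      using one_imp_carrier I_notcarr by (auto simp: ring_of_type_simps)
  qed
qed

lemma maximal_ideals_comaximal:
  assumes P: "maximalideal (P :: 'r::comm_ring_1 set) ring_of_type_algebra"
    and Q: "maximalideal Q ring_of_type_algebra" and "P \<noteq> Q"
  shows "\<exists>a\<in>Q. 1 - a \<in> P"
proof -
  let ?R = "ring_of_type_algebra :: 'r ring"
  interpret P: maximalideal P ?R by fact
  interpret Q: maximalideal Q ?R by fact
  let ?J = "P <+>\<^bsub>?R\<^esub> Q"
  have J: "?J = {x + y | x y. x \<in> P \<and> y \<in> Q}"
    unfolding set_add_def' by (auto simp: ring_of_type_simps)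
  have "0 \<in> P" "0 \<in> Q"
    using proper_ideal_maximal [OF P] proper_ideal_maximal [OF Q] by (simp_all add: proper_ideal_def)
  have sub: "P \<subseteq> ?J" "Q \<subseteq> ?J"
  proof -
    have "x + 0 \<in> ?J" if "x \<in> P" for x
      unfolding J using that \<open>0 \<in> Q\<close> by blast
    moreover have "0 + y \<in> ?J" if "y \<in> Q" for y
      unfolding J using that \<open>0 \<in> P\<close> by blast
    ultimately show "P \<subseteq> ?J" "Q \<subseteq> ?J" by simp_all blast+
  qed
  have "ideal ?J ?R"
    by (rule P.add_ideals) (fact P.ideal_axioms Q.ideal_axioms)+
  then have "?J = P \<or> ?J = UNIV" "?J = Q \<or> ?J = UNIV"
    using P.I_maximal [of ?J] Q.I_maximal [of ?J] sub unfolding ring_of_type_simps by blast+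
  then have "1 \<in> ?J" using \<open>P \<noteq> Q\<close> by blast
  then obtain x y where "1 = x + y" "x \<in> P" "y \<in> Q" unfolding J by blast
  then have "1 - y = x" "y \<in> Q" by (simp_all add: diff_eq_eq)
  then show ?thesis using \<open>x \<in> P\<close> by metis
qed

lemma proper_idealD:
  assumes "proper_ideal P"
  shows "0 \<in> P" "x \<in> P \<Longrightarrow> y \<in> P \<Longrightarrow> x + y \<in> P" "x \<in> P \<Longrightarrow> y * x \<in> P" "1 \<notin> P"
    "x \<in> P \<Longrightarrow> x * y \<in> P" "x \<in> P \<Longrightarrow> - x \<in> P" "x \<in> P \<Longrightarrow> y \<in> P \<Longrightarrow> x - y \<in> P"
proof -
  show *: "0 \<in> P" "x \<in> P \<Longrightarrow> y \<in> P \<Longrightarrow> x + y \<in> P" "x \<in> P \<Longrightarrow> y * x \<in> P" "1 \<notin> P" for x y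
    using assms by (auto simp: proper_ideal_def)
  show "x \<in> P \<Longrightarrow> x * y \<in> P" using *(3) [of x y] by (simp add: mult.commute)
  show neg: "x \<in> P \<Longrightarrow> - x \<in> P" for x using *(3) [of x "- 1"] by simp
  show "x \<in> P \<Longrightarrow> y \<in> P \<Longrightarrow> x - y \<in> P" using *(2) [of x "- y"] neg by simp
qed

lemma proper_ideal_sum:
  assumes "proper_ideal P" "\<And>i. i \<in> I \<Longrightarrow> f i \<in> P"
  shows "sum f I \<in> P"
  using assms(2) by (induction I rule: infinite_finite_induct) (auto intro: proper_idealD [OF assms(1)])

text \<open>
  By the Chinese remainder theorem, there are \<open>r\<^sub>i\<close> that vanish modulo all \<open>P\<^sub>j\<close> with \<open>j \<noteq> i\<close> and whose
  sum is \<open>1\<close>: orthogonal idempotents modulo the intersection, corrected in the component \<open>0\<close>.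
\<close>

lemma comaximal_partition_of_unity:
  fixes P :: "nat \<Rightarrow> 'r::comm_ring_1 set"
  assumes P: "\<And>i. i < k \<Longrightarrow> proper_ideal (P i)" and "k \<ge> 1"
    and comax: "\<And>i j. i < k \<Longrightarrow> j < k \<Longrightarrow> i \<noteq> j \<Longrightarrow> \<exists>a\<in>P j. 1 - a \<in> P i"
  shows "\<exists>r. (\<Sum>i<k. r i) = 1 \<and> (\<forall>i<k. \<forall>j<k. j \<noteq> i \<longrightarrow> r i \<in> P j)"
proof -
  have "\<forall>i j. \<exists>a. i < k \<longrightarrow> j < k \<longrightarrow> i \<noteq> j \<longrightarrow> a \<in> P j \<and> 1 - a \<in> P i"
    using comax by blast
  then obtain a where a: "a i j \<in> P j" "1 - a i j \<in> P i" if "i < k" "j < k" "i \<noteq> j" for i j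
    by metis
  define e where "e i = (\<Prod>j\<in>{..<k} - {i}. a i j)" for i
  have e0: "e i \<in> P j" if "i < k" "j < k" "j \<noteq> i" for i j
  proof -
    have "e i = a i j * (\<Prod>j\<in>{..<k} - {i} - {j}. a i j)"
      unfolding e_def using that by (intro prod.remove) auto
    then show ?thesis using a(1) [of i j] that proper_idealD(5) [OF P] by auto
  qed
  have e1: "1 - e i \<in> P i" if i: "i < k" for i
  proof -
    have "1 - (\<Prod>j\<in>J. a i j) \<in> P i" if "finite J" "J \<subseteq> {..<k} - {i}" for J
      using that
    proof (induction J rule: finite_induct)
      case (insert j J)
      have "1 - (\<Prod>j\<in>insert j J. a i j) = (1 - a i j) + a i j * (1 - (\<Prod>j\<in>J. a i j))"
        using insert.hyps by (simp add: algebra_simps)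
      moreover have "1 - a i j \<in> P i" using a(2) [of i j] insert.prems i by auto
      moreover have "a i j * (1 - (\<Prod>j\<in>J. a i j)) \<in> P i"
        using insert.IH insert.prems by (intro proper_idealD(3) [OF P [OF i]]) auto
      ultimately show ?case using proper_idealD(2) [OF P [OF i]] by metis
    qed (simp add: proper_idealD(1) [OF P [OF i]])
    then show ?thesis unfolding e_def by simp
  qed
  define r where "r i = (if i = 0 then 1 - (\<Sum>i\<in>{1..<k}. e i) else e i)" for i
  have split: "{..<k} = insert 0 {1..<k}" using \<open>k \<ge> 1\<close> by auto
  have "(\<Sum>i<k. r i) = 1"
    unfolding split by (simp add: r_def)
  moreover have "r i \<in> P j" if "i < k" "j < k" "j \<noteq> i" for i j
  proof (cases "i = 0")
    case True
    have "(\<Sum>i\<in>{1..<k}. e i) = e j + (\<Sum>i\<in>{1..<k} - {j}. e i)"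
      using that True by (intro sum.remove) auto
    then have "r i = (1 - e j) - (\<Sum>i\<in>{1..<k} - {j}. e i)"
      using True by (simp add: r_def)
    moreover have "(\<Sum>i\<in>{1..<k} - {j}. e i) \<in> P j"
      using that e0 by (intro proper_ideal_sum P) auto
    ultimately show ?thesis
      using e1 [of j] that proper_idealD(7) [OF P] by simp
  next
    case False
    then show ?thesis using e0 that by (simp add: r_def)
  qed
  ultimately show ?thesis by blast
qed

definition congruence_set :: "'r::comm_ring_1 set \<Rightarrow> ('r^'n^'n) set" where
  "congruence_set P = {A. \<forall>i j. (A - mat 1) $ i $ j \<in> P}"

lemma ideal_matrix_mult:
  fixes A B :: "'r::comm_ring_1^'n^'n"
  assumes "proper_ideal P" "\<And>i j. B $ i $ j \<in> P"
  shows "(A ** B) $ i $ j \<in> P" "(B ** A) $ i $ j \<in> P"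
  using assms by (auto simp: matrix_matrix_mult_def intro!: proper_ideal_sum intro: proper_idealD)

lemma congruence_setD: "A \<in> congruence_set P \<Longrightarrow> (A - mat 1) $ i $ j \<in> P"
  unfolding congruence_set_def by blast

lemma congruence_set_one: "proper_ideal P \<Longrightarrow> mat 1 \<in> congruence_set P"
  by (simp add: congruence_set_def proper_ideal_def)

lemma congruence_set_mult:
  assumes P: "proper_ideal P" and A: "A \<in> congruence_set P" and B: "B \<in> congruence_set P"
  shows "A ** B \<in> congruence_set P"
proof -
  have eq: "A ** B - mat 1 = (A - mat 1) ** B + (B - mat 1)"
    by (simp add: matrix_mult_distribs)
  show ?thesis
    unfolding congruence_set_def mem_Collect_eq eq vector_add_component
    using A B by (intro allI proper_idealD(2) [OF P] ideal_matrix_mult(2) [OF P] congruence_setD)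
qed

lemma congruence_set_conj:
  fixes A g g' :: "'r::comm_ring_1^'n^'n"
  assumes P: "proper_ideal P" and A: "A \<in> congruence_set P" and inv: "g ** g' = mat 1"
  shows "g ** A ** g' \<in> congruence_set P"
proof -
  have eq: "g ** A ** g' - mat 1 = g ** (A - mat 1) ** g'"
    by (simp add: matrix_mult_distribs inv)
  have gA: "(g ** (A - mat 1)) $ i $ j \<in> P" for i j
    using A by (intro ideal_matrix_mult(1) [OF P] congruence_setD)
  show ?thesis
    unfolding congruence_set_def mem_Collect_eq eq by (intro allI ideal_matrix_mult(2) [OF P gA])
qed

lemma congruence_set_inv:
  assumes P: "proper_ideal P" and A: "A \<in> congruence_set P" and inv: "A ** B = mat 1"
  shows "B \<in> congruence_set P"
proof -
  have eq: "B - mat 1 = - ((A - mat 1) ** B)"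
    by (simp add: matrix_mult_distribs inv)
  show ?thesis
    unfolding congruence_set_def mem_Collect_eq eq vector_uminus_component
    using A by (intro allI proper_idealD(6) [OF P] ideal_matrix_mult(2) [OF P] congruence_setD)
qed

lemma root_elt_in_congruence_set:
  fixes E :: "'v \<Rightarrow> int^'n^'n"
  assumes P: "proper_ideal P" and r: "r \<in> P"
  shows "root_elt E \<alpha> r \<in> congruence_set P"
proof -
  obtain m where m: "CARD('n) = Suc m"
    using not0_implies_Suc by force
  have "(root_elt E \<alpha> r - mat 1) $ i $ j = (\<Sum>k<m. r * (r ^ k * of_int (mat_power (E \<alpha>) (Suc k) $ i $ j div fact (Suc k))))" for i j
  proof -
    have "of_int ((mat 1 :: int^'n^'n) $ i $ j) = (mat 1 :: 'a^'n^'n) $ i $ j"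
      by (simp add: mat_def)
    then show ?thesis
      unfolding root_elt_def m by (simp add: sum.lessThan_Suc_shift mult.assoc del: sum.lessThan_Suc fact_Suc)
  qed
  then show ?thesis
    unfolding congruence_set_def using r by (auto intro!: proper_ideal_sum [OF P] proper_idealD(5) [OF P])
qed

section \<open>The lower bound\<close>

context irreducible_chevalley_system
begin

lemma root_normalized_normal:
  fixes N :: "('r::comm_ring_1^'n^'n) set"
  assumes bg: "boundedly_generated_by_root_elts TYPE('r) \<Phi> E" and N: "N \<lhd> chevalley_group \<Phi> E"
  shows "root_normalized \<Phi> E H N"
proof -
  let ?G = "chevalley_group \<Phi> E :: ('r^'n^'n) monoid"
  interpret G: group ?G by (rule group_chevalley_group [OF bg])
  interpret N: normal N ?G by fact
  note simps = chevalley_group_simps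
  show ?thesis
  proof
    show "mat 1 \<in> N" using N.one_closed by (simp add: simps)
    show "A ** B \<in> N" if "A \<in> N" "B \<in> N" for A B
      using N.m_closed [OF that] by (simp add: simps)
    show "root_elt E \<phi> x ** A ** root_elt E \<phi> (- x) \<in> N" if "\<phi> \<in> \<Phi>" "A \<in> N" for \<phi> A x
    proof -
      have c: "root_elt E \<phi> y \<in> carrier ?G" for y
        unfolding carrier_eq_elementary [OF bg] by (rule root_elt_elementary [OF that(1)])
      have "inv\<^bsub>?G\<^esub> (root_elt E \<phi> x) = root_elt E \<phi> (- x)"
        using G.inv_equality [of "root_elt E \<phi> (- x)" "root_elt E \<phi> x"] c root_elt_inverse [OF that(1), of x]
        by (simp add: simps)
      then show ?thesis
        using N.inv_op_closed2 [OF c that(2), of x] by (simp add: simps)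
    qed
    show "B \<in> N" if A: "A \<in> N" and AB: "A ** B = mat 1" for A B
    proof -
      have "inv\<^bsub>?G\<^esub> A ** A = mat 1"
        using G.l_inv [OF N.mem_carrier [OF A]] by (simp add: simps)
      then have "inv\<^bsub>?G\<^esub> A = B"
        by (metis AB matrix_mul_assoc matrix_mul_lid matrix_mul_rid)
      then show ?thesis using N.m_inv_closed [OF A] by simp
    qed
  qed
qed

text \<open>
  Conjugates of \<open>\<epsilon>\<^sub>\<alpha>(r\<^sub>i)\<close> are congruent to \<open>1\<close> modulo all chosen ideals except the \<open>i\<close>-th, so each factor of a
  product accounts for at most one of the \<open>k\<close> ideals modulo which \<open>\<epsilon>\<^sub>\<beta>(1)\<close> is nontrivial.
\<close>

theorem Delta_ge_of_maximal_ideals: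
  assumes bg: "boundedly_generated_by_root_elts TYPE('r::comm_ring_1) \<Phi> E"
    and gen: "generating_root TYPE('r) \<alpha>" and vis: "visible_root \<beta>"
    and inf: "infinite {M :: 'r set. maximalideal M ring_of_type_algebra}" and k: "k \<ge> 1"
  shows "Delta k (chevalley_group \<Phi> E :: ('r^'n^'n) monoid) \<ge> ereal (real k)"
proof -
  let ?G = "chevalley_group \<Phi> E :: ('r^'n^'n) monoid"
  interpret G: group ?G by (rule group_chevalley_group [OF bg])
  note simps = chevalley_group_simps and carrier = carrier_eq_elementary [OF bg]
  obtain Q :: "nat \<Rightarrow> 'r set" where Q: "inj Q" "range Q \<subseteq> {M. maximalideal M ring_of_type_algebra}"
    using infinite_countable_subset [OF inf] by blast
  then have Qmax: "maximalideal (Q i) ring_of_type_algebra" for i by blast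
  have Qp: "proper_ideal (Q i)" for i by (rule proper_ideal_maximal [OF Qmax])
  obtain r where r: "(\<Sum>i<k. r i) = 1" "\<And>i j. i < k \<Longrightarrow> j < k \<Longrightarrow> j \<noteq> i \<Longrightarrow> r i \<in> Q j"
    using comaximal_partition_of_unity [of k Q, OF Qp k] maximal_ideals_comaximal [OF Qmax Qmax] Q(1)
    by (metis injD)
  define S where "S = (\<lambda>i. root_elt E \<alpha> (r i)) ` {..<k}"
  have \<alpha>: "\<alpha> \<in> \<Phi>" using gen by (simp add: generating_root_def)
  obtain \<beta>' where \<beta>: "\<beta> \<in> \<Phi>" "\<beta>' \<in> \<Phi>" "cartan \<beta>' \<beta> = -1"
    using vis by (auto simp: visible_root_def)
  have S: "S \<subseteq> carrier ?G"
    unfolding S_def carrier using root_elt_elementary [OF \<alpha>] by auto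
  have "normal_closure ?G S = carrier ?G"
  proof
    have "carrier ?G \<lhd> ?G"
      by (rule G.normal_invI) (auto simp: G.subgroup_self)
    then show "normal_closure ?G S \<subseteq> carrier ?G"
      unfolding normal_closure_def using S by blast
    show "carrier ?G \<subseteq> normal_closure ?G S"
      unfolding normal_closure_def
    proof (intro Inter_greatest)
      fix N assume "N \<in> {N. N \<lhd> ?G \<and> S \<subseteq> N}"
      then have N: "N \<lhd> ?G" "S \<subseteq> N" by auto
      then interpret root_normalized \<Phi> E H N by (intro root_normalized_normal bg)
      have full: "root_elt E \<phi> x \<in> N" if "\<phi> \<in> \<Phi>" for \<phi> x
        using gen [unfolded generating_root_def, THEN conjunct2, rule_format, OF root_normalized_axioms, of "{..<k}" r]
          r(1) N(2) that unfolding S_def by auto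
      show "carrier ?G \<subseteq> N"
      proof
        fix A assume "A \<in> carrier ?G"
        then have "A \<in> elementary \<Phi> E" unfolding carrier .
        then show "A \<in> N"
          by (induction rule: elementary.induct) (auto intro: N_one N_mult full)
      qed
    qed
  qed
  moreover have "enat k \<le> norm_diam ?G S"
  proof (rule norm_diam_ge)
    let ?A = "root_elt E \<beta> (1::'r)"
    show "?A \<in> carrier ?G"
      unfolding carrier by (rule root_elt_elementary [OF \<beta>(1)])
    show "enat k \<le> word_norm ?G S ?A"
    proof (rule G.word_norm_ge [OF S])
      fix ys assume ys: "set ys \<subseteq> conjugates_pm ?G S" "?A = foldr (\<otimes>\<^bsub>?G\<^esub>) ys \<one>\<^bsub>?G\<^esub>"
      show "k \<le> length ys"
      proof (rule ccontr)
        assume short: "\<not> k \<le> length ys"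
        have "\<exists>i. \<forall>j<k. j \<noteq> i \<longrightarrow> y \<in> congruence_set (Q j)" if "y \<in> set ys" for y
        proof -
          obtain g s where gs: "g \<in> carrier ?G" "s \<in> S \<union> (\<lambda>t. inv\<^bsub>?G\<^esub> t) ` S" "y = g \<otimes>\<^bsub>?G\<^esub> s \<otimes>\<^bsub>?G\<^esub> inv\<^bsub>?G\<^esub> g"
            using subsetD [OF ys(1) \<open>y \<in> set ys\<close>] unfolding conjugates_pm_def by blast
          obtain i where i: "i < k" "s = root_elt E \<alpha> (r i) \<or> s = inv\<^bsub>?G\<^esub> (root_elt E \<alpha> (r i))"
            using gs(2) unfolding S_def by blast
          have "y \<in> congruence_set (Q j)" if "j < k" "j \<noteq> i" for j
          proof -
            have t: "root_elt E \<alpha> (r i) \<in> congruence_set (Q j)"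
              by (rule root_elt_in_congruence_set [OF Qp r(2) [OF i(1) that]])
            moreover have "root_elt E \<alpha> (r i) ** inv\<^bsub>?G\<^esub> (root_elt E \<alpha> (r i)) = mat 1"
              using G.r_inv [of "root_elt E \<alpha> (r i)"] S i(1) by (auto simp: simps S_def)
            ultimately have "s \<in> congruence_set (Q j)"
              using i(2) congruence_set_inv [OF Qp] by blast
            moreover have "g ** inv\<^bsub>?G\<^esub> g = mat 1"
              using G.r_inv [OF gs(1)] by (simp add: simps)
            ultimately show ?thesis
              unfolding gs(3) simps by (rule congruence_set_conj [OF Qp])
          qed
          then show ?thesis by blast
        qed
        then obtain f where f: "\<And>y j. y \<in> set ys \<Longrightarrow> j < k \<Longrightarrow> j \<noteq> f y \<Longrightarrow> y \<in> congruence_set (Q j)"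
          by metis
        \<comment> \<open>Each factor has at most one exceptional ideal, so with fewer than \<open>k\<close> factors some ideal is exceptional for none.\<close>
        have "card (f ` set ys) < k"
          using short card_image_le [of "set ys" f] card_length [of ys] by simp
        then have "\<not> {..<k} \<subseteq> f ` set ys"
          using card_mono [of "f ` set ys" "{..<k}"] by auto
        then obtain i where i: "i < k" "i \<notin> f ` set ys" by blast
        then have "set ys \<subseteq> congruence_set (Q i)"
          using f by (metis imageI subsetI)
        then have "foldr (**) ys (mat 1) \<in> congruence_set (Q i)"
          by (induction ys) (auto intro: congruence_set_mult congruence_set_one Qp)
        then have "?A \<in> congruence_set (Q i)"
          unfolding ys(2) simps .
        moreover have "\<exists>i' j'. (?A - mat 1) $ i' $ j' \<notin> Q i"
          by (rule root_elt_one_not_congruent [OF \<beta>]) (use proper_idealD(1-4) [OF Qp [of i]] in blast)+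
        then have "?A \<notin> congruence_set (Q i)"
          using congruence_setD by blast
        ultimately show False by simp
      qed
    qed
  qed
  moreover have "finite S" "card S \<le> k"
    using card_image_le [of "{..<k}" "\<lambda>i. root_elt E \<alpha> (r i)"] by (simp_all add: S_def)
  ultimately show ?thesis
    using Delta_ge S by blast
qed

end

theorem proposition6p1:
  fixes \<Phi> \<Delta> :: "'v::euclidean_space set"
    and E H :: "'v \<Rightarrow> int^'n^'n"
    and k :: nat
  assumes "irreducible_root_system \<Phi>"
    and "DIM('v) \<ge> 2"
    and "simply_connected_realization \<Phi> \<Delta> E H"
    and "dedekind_domain TYPE('r::idom)"
    and "finite_class_number TYPE('r)"
    and "infinite {M :: 'r set. maximalideal M ring_of_type_algebra}"
    and "boundedly_generated_by_root_elts TYPE('r) \<Phi> E"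
    and "type_B2 \<Phi> \<or> type_G2 \<Phi> \<Longrightarrow> (2::'r) dvd 1"
    and "k \<ge> 1"
  shows "Delta k (chevalley_group \<Phi> E :: ('r^'n^'n) monoid) \<ge> ereal (real k)"
proof -
  interpret chevalley_system \<Phi> E H
    using assms(1,3) by (rule chevalley_system_realization)
  interpret irreducible_chevalley_system \<Phi> E H
    by unfold_locales (use root_sys assms(1) in auto)
  have "root_base \<Phi> \<Delta>"
    using assms(3) by (simp add: simply_connected_realization_def chevalley_basis_def)
  then obtain \<alpha> \<beta> where "generating_root TYPE('r) \<alpha>" "visible_root \<beta>"
    using exists_generating_root assms(2,8) by blast
  then show ?thesis
    using Delta_ge_of_maximal_ideals assms(6,7,9) by blast
qed

end
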